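(* For any $\epsilon > 0$, the variable-base joint replenishment problem can be approximated within factor $1+\epsilon$ of optimal; that is, there is an algorithm that computes a replenishment policy $T$ with $F(T) \leq (1+\epsilon)\cdot \inf_{T'} F(T')$. The running time of this algorithm is $O(2^{\tilde{O}(1/\epsilon)} \cdot n^{O(1)})$.
   Context: The (variable-base, continuous-time) joint replenishment problem: there are $n$ commodities; commodity $i \in [n]$ has ordering cost $K_i > 0$ and holding-cost parameter $H_i > 0$, and there is a joint ordering cost $K_0 > 0$. A replenishment policy is a vector $T = (T_1,\ldots,T_n)$ of positive reals, where commodity $i$ is ordered at times $0, T_i, 2T_i, \ldots$. The marginal (EOQ) cost of commodity $i$ is $C_i(T_i) = \frac{K_i}{T_i} + H_i T_i$. For $\Delta \geq 0$, let $N(T,\Delta) = \left| \bigcup_{i\in[n]} \{0, T_i, 2T_i, \ldots, \lfloor \Delta/T_i \rfloor T_i\} \right|$ be the number of distinct joint order times in $[0,\Delta]$, and let $J(T) = K_0 \cdot \lim_{\Delta\to\infty} \frac{N(T,\Delta)}{\Delta}$ (this limit exists). The long-run average cost is $F(T) = J(T) + \sum_{i\in[n]} C_i(T_i)$, to be minimized over all policies. $\tilde{O}(\cdot)$ hides polylogarithmic factors. *)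

theory Defs
  imports Complex_Main
begin

section \<open>The joint replenishment problem\<close>

text \<open>
  Commodities are indexed by \<open>{1..n}\<close>. The parameter \<open>K 0\<close> is the joint ordering cost \<open>K\<^sub>0\<close>;
  \<open>K i\<close> and \<open>H i\<close> with \<open>i \<in> {1..n}\<close> are the parameters of commodity \<open>i\<close>. Values of \<open>K\<close>, \<open>H\<close> and of a
  policy \<open>T\<close> at all other indices are irrelevant.
\<close>

definition jrp_instance :: "nat \<Rightarrow> (nat \<Rightarrow> real) \<Rightarrow> (nat \<Rightarrow> real) \<Rightarrow> bool" where
  "jrp_instance n K H \<longleftrightarrow> n \<ge> 1 \<and> K 0 > 0 \<and> (\<forall>i\<in>{1..n}. K i > 0 \<and> H i > 0)"

definition policy :: "nat \<Rightarrow> (nat \<Rightarrow> real) \<Rightarrow> bool" where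
  "policy n T \<longleftrightarrow> (\<forall>i\<in>{1..n}. T i > 0)"

definition eoq_cost :: "real \<Rightarrow> real \<Rightarrow> real \<Rightarrow> real" where
  "eoq_cost k h t = k / t + h * t"

definition num_joint_orders :: "nat \<Rightarrow> (nat \<Rightarrow> real) \<Rightarrow> real \<Rightarrow> nat" where
  "num_joint_orders n T \<Delta> =
     card (\<Union>i\<in>{1..n}. (\<lambda>m::nat. real m * T i) ` {0..nat \<lfloor>\<Delta> / T i\<rfloor>})"

definition joint_cost :: "nat \<Rightarrow> real \<Rightarrow> (nat \<Rightarrow> real) \<Rightarrow> real" where
  "joint_cost n k0 T = k0 * Lim at_top (\<lambda>\<Delta>::real. real (num_joint_orders n T \<Delta>) / \<Delta>)"

definition total_cost :: "nat \<Rightarrow> (nat \<Rightarrow> real) \<Rightarrow> (nat \<Rightarrow> real) \<Rightarrow> (nat \<Rightarrow> real) \<Rightarrow> real" where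
  "total_cost n K H T = joint_cost n (K 0) T + (\<Sum>i=1..n. eoq_cost (K i) (H i) (T i))"


section \<open>Real RAM programs and their running time\<close>

text \<open>
  Algorithms are programs of a real random access machine, presented as a structured language.
  A memory bank is an unbounded array addressed by natural numbers; natural-number banks and
  real banks are separate, and scalars are cells at constant addresses. A program mentions only
  finitely many banks.

  On reals the machine has exact \<open>+\<close>, \<open>-\<close>, \<open>*\<close>, \<open>/\<close>, square root and comparison, but no rounding
  to an integer, and no real constants other than the images of naturals. Square roots are needed
  because already for one commodity the optimal policy is \<open>sqrt ((K 0 + K 1) / H 1)\<close>, which
  cannot be approximated within a constant factor by a number of field operations and comparisons
  that is independent of the magnitude of the input. On naturals there are only constants, \<open>+\<close>,
  truncated \<open>-\<close> and comparison, so that integers cannot grow faster than in the usual unit-cost RAM.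
  Division by zero and square roots of negative numbers follow the library's total functions;
  a program could detect these cases by a comparison, so this adds no power.
\<close>

type_synonym bank = string

datatype nexp =
    NConst nat
  | NRead bank nexp
  | NAdd nexp nexp
  | NSub nexp nexp

datatype rexp =
    RRead bank nexp
  | ROfNat nexp
  | RAdd rexp rexp
  | RSub rexp rexp
  | RMul rexp rexp
  | RDiv rexp rexp
  | RSqrt rexp

datatype bexp =
    NLess nexp nexp
  | RLess rexp rexp
  | BNot bexp
  | BAnd bexp bexp

datatype com =
    Skip
  | NWrite bank nexp nexp
  | RWrite bank nexp rexp
  | Seq com com
  | Cond bexp com com
  | While bexp com

record state =
  nmem :: "bank \<Rightarrow> nat \<Rightarrow> nat"
  rmem :: "bank \<Rightarrow> nat \<Rightarrow> real"

fun nval :: "nexp \<Rightarrow> state \<Rightarrow> nat" where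
  "nval (NConst k) s = k"
| "nval (NRead x a) s = nmem s x (nval a s)"
| "nval (NAdd a b) s = nval a s + nval b s"
| "nval (NSub a b) s = nval a s - nval b s"

fun rval :: "rexp \<Rightarrow> state \<Rightarrow> real" where
  "rval (RRead x a) s = rmem s x (nval a s)"
| "rval (ROfNat a) s = real (nval a s)"
| "rval (RAdd a b) s = rval a s + rval b s"
| "rval (RSub a b) s = rval a s - rval b s"
| "rval (RMul a b) s = rval a s * rval b s"
| "rval (RDiv a b) s = rval a s / rval b s"
| "rval (RSqrt a) s = sqrt (rval a s)"

fun bval :: "bexp \<Rightarrow> state \<Rightarrow> bool" where
  "bval (NLess a b) s \<longleftrightarrow> nval a s < nval b s"
| "bval (RLess a b) s \<longleftrightarrow> rval a s < rval b s"
| "bval (BNot b) s \<longleftrightarrow> \<not> bval b s"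
| "bval (BAnd a b) s \<longleftrightarrow> bval a s \<and> bval b s"

definition nwrite :: "bank \<Rightarrow> nat \<Rightarrow> nat \<Rightarrow> state \<Rightarrow> state" where
  "nwrite x i v s = s\<lparr>nmem := (nmem s)(x := (nmem s x)(i := v))\<rparr>"

definition rwrite :: "bank \<Rightarrow> nat \<Rightarrow> real \<Rightarrow> state \<Rightarrow> state" where
  "rwrite x i v s = s\<lparr>rmem := (rmem s)(x := (rmem s x)(i := v))\<rparr>"

text \<open>
  \<open>exec c s t s'\<close>: started in \<open>s\<close>, the program \<open>c\<close> halts in \<open>s'\<close> after \<open>t\<close> steps. Every executed
  assignment and every evaluated test is one step. The expressions of a fixed program have bounded
  size, so counting each of their operators separately would change running times by at most a
  constant factor depending on the program only.
\<close>

inductive exec :: "com \<Rightarrow> state \<Rightarrow> nat \<Rightarrow> state \<Rightarrow> bool" where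
  Skip: "exec Skip s 1 s"
| NWrite: "exec (NWrite x a e) s 1 (nwrite x (nval a s) (nval e s) s)"
| RWrite: "exec (RWrite x a e) s 1 (rwrite x (nval a s) (rval e s) s)"
| Seq: "exec c s t s' \<Longrightarrow> exec c' s' t' s'' \<Longrightarrow> exec (Seq c c') s (t + t') s''"
| CondTrue: "bval b s \<Longrightarrow> exec c s t s' \<Longrightarrow> exec (Cond b c c') s (1 + t) s'"
| CondFalse: "\<not> bval b s \<Longrightarrow> exec c' s t s' \<Longrightarrow> exec (Cond b c c') s (1 + t) s'"
| WhileFalse: "\<not> bval b s \<Longrightarrow> exec (While b c) s 1 s"
| WhileTrue: "bval b s \<Longrightarrow> exec c s t s' \<Longrightarrow> exec (While b c) s' t' s'' \<Longrightarrow>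
    exec (While b c) s (1 + t + t') s''"

inductive_cases exec_SkipE: "exec Skip s t s'"
inductive_cases exec_NWriteE: "exec (NWrite x a e) s t s'"
inductive_cases exec_RWriteE: "exec (RWrite x a e) s t s'"
inductive_cases exec_SeqE: "exec (Seq c c') s t s'"
inductive_cases exec_CondE: "exec (Cond b c c') s t s'"
inductive_cases exec_WhileE: "exec (While b c) s t s'"

text \<open>A halting run is the only run, so exhibiting one is the same as guaranteeing termination.\<close>

lemma exec_deterministic:
  "exec c s t s' \<Longrightarrow> exec c s u s'' \<Longrightarrow> u = t \<and> s'' = s'"
proof (induction arbitrary: u s'' rule: exec.induct)
  case (Skip s)
  then show ?case by (auto elim: exec_SkipE)
next
  case (NWrite x a e s)
  then show ?case by (auto elim: exec_NWriteE)
next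
  case (RWrite x a e s)
  then show ?case by (auto elim: exec_RWriteE)
next
  case (Seq c s t s1 c' t' s2)
  from Seq.prems obtain u1 v1 u2 where "exec c s u1 v1" "exec c' v1 u2 s''" "u = u1 + u2"
    by (rule exec_SeqE)
  with Seq.IH show ?case by metis
next
  case (CondTrue b s c t s' c')
  from CondTrue.prems obtain u1 where "exec c s u1 s''" "u = 1 + u1"
    by (rule exec_CondE) (use CondTrue.hyps in simp_all)
  with CondTrue.IH show ?case by metis
next
  case (CondFalse b s c' t s' c)
  from CondFalse.prems obtain u1 where "exec c' s u1 s''" "u = 1 + u1"
    by (rule exec_CondE) (use CondFalse.hyps in simp_all)
  with CondFalse.IH show ?case by metis
next
  case (WhileFalse b s c)
  from WhileFalse.prems show ?case
    by (rule exec_WhileE) (use WhileFalse.hyps in simp_all)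
next
  case (WhileTrue b s c t s1 t' s2)
  from WhileTrue.prems obtain u1 v1 u2 where
    "exec c s u1 v1" "exec (While b c) v1 u2 s''" "u = 1 + u1 + u2"
    by (rule exec_WhileE) (use WhileTrue.hyps in simp_all)
  with WhileTrue.IH show ?case by metis
qed


section \<open>Input and output conventions\<close>

definition jrp_input :: "real \<Rightarrow> nat \<Rightarrow> (nat \<Rightarrow> real) \<Rightarrow> (nat \<Rightarrow> real) \<Rightarrow> state" where
  "jrp_input \<epsilon> n K H =
     \<lparr>nmem = (\<lambda>x i. if x = ''n'' \<and> i = 0 then n else 0),
      rmem = (\<lambda>x i. if x = ''eps'' \<and> i = 0 then \<epsilon>
                    else if x = ''K'' \<and> i \<in> {0..n} then K i
                    else if x = ''H'' \<and> i \<in> {1..n} then H i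
                    else 0)\<rparr>"

definition jrp_output :: "state \<Rightarrow> nat \<Rightarrow> real" where
  "jrp_output s = rmem s ''T''"

end

(*
  Let t be the smallest interval of a good policy. Group the intervals below t/eps into O((1/eps) log (1/eps))
  geometric classes and move every commodity to the smallest interval of its class: no joint order is
  added. Call two of these representatives aligned if their ratio is p/q with p, q at most poly(1/eps).
  Inside a connected component of the alignment graph all ratios are products of such fractions, while
  two lattices from different components meet so rarely that each component may be rescaled by its own
  factor close to 1; the density of the union changes by a factor 1 + O(eps). Rescaling makes the root of
  each component a simple rational multiple of a base time t0, so the representatives are described by
  O((1/eps) log (1/eps)) triples (parent, p, q), and all descriptions can be tried. Intervals above t/eps
  are rounded to multiples of t, or replaced by the unconstrained optimum beyond n t/eps.
  The base time minimizes a convex lower bound on the cost. It has n candidate values, and if t is not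
  within a factor poly(1/eps) of it, then ordering at multiples of eps t0 is already near-optimal.
  Densities of unions of L lattices are estimated by counting, with error 2^O(L) divided by the window.
*)
theory Submission
  imports Defs
begin

section \<open>Densities of unions of lattices\<close>

text \<open>The joint cost is not continuous in \<open>T\<close>: it depends on exact coincidences
  of order times, which rounding the intervals one by one would destroy. Rescaling a whole component
  keeps its inner coincidences. Across components the two directions differ. The rescaled union is
  bounded by plain subadditivity, whatever its coincidences are. Rare overlaps are needed only for
  the original union: at most \<open>L ^ 2\<close> pairs, each of density at most 1 / (B * \<tau>),
  are lost against a total density of at least 1 / \<tau>, where \<tau> is the smallest interval.
  The policy that is finally returned is certified independently of this argument, because estimates
  are correct up to a relative error for every chain tried. With \<open>m = 2 ^ S\<close> of order
  1/\<epsilon> and \<open>L = m * S\<close> classes, \<open>B = 2 ^ (8 * S)\<close> is polynomial in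
  \<open>m\<close>, and \<open>A = B ^ (3 * L)\<close> plays two roles: it is the number of encoded
  chains and the number of multiples inspected for a density estimate.\<close>

definition mults :: "real \<Rightarrow> real set" where
  "mults w = {real a * w | a. a \<ge> 1}"

definition lat :: "real set \<Rightarrow> real set" where
  "lat S = (\<Union>w\<in>S. mults w)"

definition cnt :: "real set \<Rightarrow> real \<Rightarrow> nat" where
  "cnt P x = card (P \<inter> {0<..x})"

text \<open>A bounded discrepancy is kept instead of a mere limit: bounded errors can be added in an
  inclusion-exclusion recursion and later turned into a finite counting window.\<close>

definition has_dens :: "real set \<Rightarrow> real \<Rightarrow> real \<Rightarrow> bool" where
  "has_dens P d C \<longleftrightarrow> (\<forall>x\<ge>0. finite (P \<inter> {0<..x}) \<and> \<bar>real (cnt P x) - d * x\<bar> \<le> C)"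

lemma in_mults_iff: "x \<in> mults w \<longleftrightarrow> (\<exists>a\<ge>1. x = real a * w)"
  unfolding mults_def by auto

lemma mults_window:
  assumes "w > 0"
  shows "mults w \<inter> {0<..x} = (\<lambda>a. real a * w) ` {1..nat \<lfloor>x / w\<rfloor>}"
proof -
  have "real a * w \<le> x \<longleftrightarrow> a \<le> nat \<lfloor>x / w\<rfloor>" if "a \<ge> 1" for a
  proof -
    have "real a * w \<le> x \<longleftrightarrow> real a \<le> x / w" using assms by (simp add: field_simps)
    also have "\<dots> \<longleftrightarrow> int a \<le> \<lfloor>x / w\<rfloor>" by (simp add: le_floor_iff)
    also have "\<dots> \<longleftrightarrow> a \<le> nat \<lfloor>x / w\<rfloor>" using that by linarith
    finally show ?thesis .
  qed
  then show ?thesis using assms unfolding mults_def by (auto simp: image_iff)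
qed

lemma finite_mults_window: "w > 0 \<Longrightarrow> finite (mults w \<inter> {0<..x})"
  by (simp add: mults_window)

lemma cnt_mults: "w > 0 \<Longrightarrow> cnt (mults w) x = nat \<lfloor>x / w\<rfloor>"
  unfolding cnt_def by (simp add: mults_window card_image inj_on_def)

lemma cnt_mults_le: "w > 0 \<Longrightarrow> x \<ge> 0 \<Longrightarrow> real (cnt (mults w) x) \<le> x / w"
  by (simp add: cnt_mults)

text \<open>The least common multiple, when there is one, generates all others by division with
  remainder. Intervals are arbitrary reals, so two lattices may also have no positive point in
  common.\<close>

lemma mults_Int:
  assumes "w > 0" "w' > 0"
  shows "mults w \<inter> mults w' = {} \<or> (\<exists>z\<in>mults w \<inter> mults w'. mults w \<inter> mults w' = mults z)"
proof (cases "mults w \<inter> mults w' = {}")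
  case False
  then obtain b where b: "b \<ge> 1" "real b * w \<in> mults w'" unfolding mults_def by auto
  define a where "a = (LEAST a. a \<ge> 1 \<and> real a * w \<in> mults w')"
  have a: "a \<ge> 1" "real a * w \<in> mults w'"
    using LeastI[of "\<lambda>a. a \<ge> 1 \<and> real a * w \<in> mults w'" b] b unfolding a_def by auto
  have least: "a \<le> r" if "r \<ge> 1" "real r * w \<in> mults w'" for r
    using Least_le[of "\<lambda>a. a \<ge> 1 \<and> real a * w \<in> mults w'" r] that unfolding a_def by auto
  obtain a' where a': "a' \<ge> 1" "real a * w = real a' * w'" using a unfolding mults_def by auto
  have "x \<in> mults (real a * w)" if "x \<in> mults w \<inter> mults w'" for x
  proof -
    from that obtain c where "c \<ge> 1" "x = real c * w" unfolding mults_def by auto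
    moreover from that obtain c' where "c' \<ge> 1" "x = real c' * w'" unfolding mults_def by auto
    ultimately have c: "c \<ge> 1" "x = real c * w" "c' \<ge> 1" "x = real c' * w'" by auto
    define q r where "q = c div a" and "r = c mod a"
    have cqr: "c = q * a + r" by (simp add: q_def r_def)
    have rlt: "r < a" using a by (simp add: r_def)
    have e: "real r * w = (real c' - real (q * a')) * w'"
    proof -
      have "real c * w = real q * (real a * w) + real r * w" by (simp add: cqr algebra_simps)
      then show ?thesis using a' c by (simp add: algebra_simps)
    qed
    have "r = 0"
    proof (rule ccontr)
      assume "r \<noteq> 0"
      then have "real r * w > 0" using assms by simp
      then have pos: "real c' - real (q * a') > 0" using e assms by (simp add: zero_less_mult_iff)
      then have "real (c' - q * a') = real c' - real (q * a')" "c' - q * a' \<ge> 1"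
        by (auto simp del: of_nat_mult simp: of_nat_diff)
      then have "real r * w \<in> mults w'" using e unfolding mults_def by (metis (mono_tags, lifting) mem_Collect_eq)
      then show False using least[of r] \<open>r \<noteq> 0\<close> rlt by simp
    qed
    then have "x = real q * (real a * w)" "q \<ge> 1" using c cqr by (auto intro!: Suc_leI Nat.gr0I)
    then show ?thesis unfolding mults_def by auto
  qed
  moreover have "x \<in> mults w \<inter> mults w'" if "x \<in> mults (real a * w)" for x
  proof -
    from that obtain q where q: "q \<ge> 1" "x = real q * (real a * w)" unfolding in_mults_iff by metis
    have "x = real (q * a) * w" "x = real (q * a') * w'" "q * a \<ge> 1" "q * a' \<ge> 1"
      using q a a' by auto
    then show ?thesis unfolding mults_def by blast
  qed
  moreover have "real a * w \<in> mults w \<inter> mults w'" using a unfolding mults_def by auto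
  ultimately show ?thesis by blast
qed simp

lemma mults_pos: "w > 0 \<Longrightarrow> x \<in> mults w \<Longrightarrow> x > 0"
  unfolding mults_def by auto

lemma finite_lat_window:
  assumes "finite S" "\<forall>w\<in>S. w > 0"
  shows "finite (lat S \<inter> {0<..x})"
proof -
  have "lat S \<inter> {0<..x} = (\<Union>w\<in>S. mults w \<inter> {0<..x})" unfolding lat_def by auto
  then show ?thesis using assms(1) finite_mults_window assms(2) by (metis finite_UN_I)
qed

text \<open>Inclusion-exclusion with one lattice split off: \<open>mults w\<close> meets every other
  lattice in a lattice or not at all, so \<open>mults w \<inter> lat S1\<close> is again a union of
  at most \<open>card S1\<close> lattices. The induction is on the cardinality because it is applied
  to \<open>S1\<close> and to these intersections. The error obeys e (k + 1) = 2 * e k + 1, whence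
  \<open>2 ^ card S - 1\<close>.\<close>

lemma has_dens_lat_exists:
  assumes "finite S" "\<forall>w\<in>S. w > 0"
  shows "\<exists>d. has_dens (lat S) d (2 ^ card S - 1)"
  using assms
proof (induction "card S" arbitrary: S rule: less_induct)
  case less
  show ?case
  proof (cases "S = {}")
    case True
    then show ?thesis by (auto simp: has_dens_def lat_def cnt_def intro!: exI[of _ 0])
  next
    case False
    then obtain w S1 where S: "S = insert w S1" "w \<notin> S1" by (metis insertI1 mk_disjoint_insert all_not_in_conv)
    have fin1: "finite S1" and pos1: "\<forall>w\<in>S1. w > 0" and w: "w > 0" using less.prems S by auto
    have c: "card S = Suc (card S1)" using S fin1 by simp
    define J where "J = {u\<in>S1. mults w \<inter> mults u \<noteq> {}}"
    have "\<forall>u\<in>J. \<exists>z. z \<in> mults w \<and> mults w \<inter> mults u = mults z"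
      using mults_Int w pos1 unfolding J_def by blast
    then obtain f where f: "\<forall>u\<in>J. f u \<in> mults w \<and> mults w \<inter> mults u = mults (f u)" by metis
    define S2 where "S2 = f ` J"
    have J: "finite J" "card J \<le> card S1" using fin1 by (auto simp: J_def intro: card_mono)
    have S2: "finite S2" "card S2 \<le> card S1" "\<forall>u\<in>S2. u > 0"
      using J f w mults_pos card_image_le[of J f] unfolding S2_def by auto
    have Int: "mults w \<inter> lat S1 = lat S2"
    proof -
      have "mults w \<inter> lat S1 = (\<Union>u\<in>J. mults w \<inter> mults u)" unfolding lat_def J_def by auto
      then show ?thesis using f by (simp add: lat_def S2_def)
    qed
    obtain d1 where d1: "has_dens (lat S1) d1 (2 ^ card S1 - 1)"
      using less.hyps[of S1] c fin1 pos1 by auto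
    obtain d2 where d2: "has_dens (lat S2) d2 (2 ^ card S2 - 1)"
      using less.hyps[of S2] c S2 by auto
    have p2: "(2::real) ^ card S2 \<le> 2 ^ card S1" using S2 by (simp add: power_increasing)
    have "\<bar>real (cnt (lat S) x) - (1 / w + d1 - d2) * x\<bar> \<le> 2 ^ card S - 1" if x: "x \<ge> 0" for x
    proof -
      have "lat S \<inter> {0<..x} = (mults w \<inter> {0<..x}) \<union> (lat S1 \<inter> {0<..x})" by (auto simp: S lat_def)
      moreover have "(mults w \<inter> {0<..x}) \<inter> (lat S1 \<inter> {0<..x}) = lat S2 \<inter> {0<..x}" using Int by auto
      ultimately have e: "cnt (lat S) x + cnt (lat S2) x = cnt (mults w) x + cnt (lat S1) x"
        unfolding cnt_def using finite_mults_window[OF w, of x] finite_lat_window[OF fin1 pos1, of x]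
        by (metis card_Un_Int)
      have "\<bar>real (cnt (mults w) x) - x / w\<bar> \<le> 1"
        using w x by (simp add: cnt_mults) linarith
      moreover have "\<bar>real (cnt (lat S1) x) - d1 * x\<bar> \<le> 2 ^ card S1 - 1"
        "\<bar>real (cnt (lat S2) x) - d2 * x\<bar> \<le> 2 ^ card S2 - 1"
        using d1 d2 x unfolding has_dens_def by auto
      moreover have "real (cnt (lat S) x) + real (cnt (lat S2) x) = real (cnt (mults w) x) + real (cnt (lat S1) x)"
        using e by (metis of_nat_add)
      moreover have "(1 / w + d1 - d2) * x = x / w + d1 * x - d2 * x" by (simp add: algebra_simps)
      moreover have "(2::real) ^ card S = 2 * 2 ^ card S1" by (simp add: c)
      ultimately show ?thesis using p2 by linarith
    qed
    then show ?thesis using finite_lat_window less.prems unfolding has_dens_def by blast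
  qed
qed

text \<open>Whatever \<open>SOME\<close> picks is the slope of the counting function up to a bounded
  error, hence determined. \<open>linear_growth_le\<close> turns counting bounds with an arbitrary
  additive constant into comparisons of slopes.\<close>

definition dens :: "real set \<Rightarrow> real" where
  "dens S = (SOME d. has_dens (lat S) d (2 ^ card S - 1))"

lemma dens_bound:
  assumes "finite S" "\<forall>w\<in>S. w > 0" "x \<ge> 0"
  shows "\<bar>real (cnt (lat S) x) - dens S * x\<bar> \<le> 2 ^ card S - 1"
  using someI_ex[OF has_dens_lat_exists[OF assms(1,2)]] assms(3) unfolding dens_def has_dens_def by blast

lemma linear_growth_le:
  fixes a b C :: real
  assumes "\<And>x. x \<ge> 0 \<Longrightarrow> a * x \<le> b * x + C"
  shows "a \<le> b"
proof (rule ccontr)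
  assume n: "\<not> a \<le> b"
  have "a * ((\<bar>C\<bar> + 1) / (a - b)) \<le> b * ((\<bar>C\<bar> + 1) / (a - b)) + C" using assms[of "(\<bar>C\<bar> + 1) / (a - b)"] n by simp
  then have "(a - b) * ((\<bar>C\<bar> + 1) / (a - b)) \<le> C" unfolding left_diff_distrib by linarith
  then show False using n by simp
qed

lemma dens_le_I:
  assumes "finite S" "\<forall>w\<in>S. w > 0" "\<And>x. x \<ge> 0 \<Longrightarrow> real (cnt (lat S) x) \<le> b * x + C"
  shows "dens S \<le> b"
proof (rule linear_growth_le)
  fix x :: real assume x: "x \<ge> 0"
  show "dens S * x \<le> b * x + (C + 2 ^ card S)"
    using dens_bound[OF assms(1,2) x] assms(3)[OF x] by linarith
qed

lemma dens_ge_I: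
  assumes "finite S" "\<forall>w\<in>S. w > 0" "\<And>x. x \<ge> 0 \<Longrightarrow> b * x \<le> real (cnt (lat S) x) + C"
  shows "b \<le> dens S"
proof (rule linear_growth_le)
  fix x :: real assume x: "x \<ge> 0"
  show "b * x \<le> dens S * x + (C + 2 ^ card S)"
    using dens_bound[OF assms(1,2) x] assms(3)[OF x] by linarith
qed

lemma cnt_mono: "finite (Q \<inter> {0<..x}) \<Longrightarrow> P \<subseteq> Q \<Longrightarrow> cnt P x \<le> cnt Q x"
  unfolding cnt_def by (rule card_mono) auto

lemma cnt_Un_le: "cnt (P \<union> Q) x \<le> cnt P x + cnt Q x"
  unfolding cnt_def by (simp add: Int_Un_distrib2 card_Un_le)

lemma dens_mono:
  assumes "finite S" "\<forall>w\<in>S. w > 0" "finite S'" "\<forall>w\<in>S'. w > 0" "lat S \<subseteq> lat S'"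
  shows "dens S \<le> dens S'"
proof (rule dens_le_I[OF assms(1,2)])
  fix x :: real assume x: "x \<ge> 0"
  show "real (cnt (lat S) x) \<le> dens S' * x + 2 ^ card S'"
    using dens_bound[OF assms(3,4) x] cnt_mono[OF finite_lat_window[OF assms(3,4)] assms(5), of x] by linarith
qed

lemma lat_Un: "lat (S \<union> S') = lat S \<union> lat S'"
  unfolding lat_def by auto

lemma dens_Un_le:
  assumes "finite S" "\<forall>w\<in>S. w > 0" "finite S'" "\<forall>w\<in>S'. w > 0"
  shows "dens (S \<union> S') \<le> dens S + dens S'"
proof (rule dens_le_I)
  fix x :: real assume x: "x \<ge> 0"
  show "real (cnt (lat (S \<union> S')) x) \<le> (dens S + dens S') * x + (2 ^ card S + 2 ^ card S')"
    using dens_bound[OF assms(1,2) x] dens_bound[OF assms(3,4) x] cnt_Un_le[of "lat S" "lat S'" x]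
    by (simp add: lat_Un algebra_simps)
qed (use assms in auto)

lemma dens_singleton: "w > 0 \<Longrightarrow> dens {w} = 1 / w"
proof (rule antisym)
  assume w: "w > 0"
  show "dens {w} \<le> 1 / w"
    by (rule dens_le_I[where C = 0]) (use w cnt_mults_le[OF w] in \<open>auto simp: lat_def\<close>)
  show "1 / w \<le> dens {w}"
  proof (rule dens_ge_I[where C = 1])
    fix x :: real assume "x \<ge> 0"
    then show "1 / w * x \<le> real (cnt (lat {w}) x) + 1"
      using w by (simp add: lat_def cnt_mults)
  qed (use w in auto)
qed

lemma dens_empty: "dens {} = 0"
  using dens_le_I[of "{}" 0 0] dens_ge_I[of "{}" 0 0] by (simp add: lat_def cnt_def)

lemma dens_ge_member:
  assumes "finite S" "\<forall>w\<in>S. w > 0" "w \<in> S"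
  shows "1 / w \<le> dens S"
  using dens_mono[of "{w}" S] assms dens_singleton[of w] by (auto simp: lat_def)

lemma dens_le_sum:
  assumes "finite S" "\<forall>w\<in>S. w > 0"
  shows "dens S \<le> (\<Sum>w\<in>S. 1 / w)"
  using assms
proof (induction S rule: finite_induct)
  case (insert w S)
  then show ?case using dens_Un_le[of "{w}" S] dens_singleton[of w] by simp
qed (simp add: dens_empty)

lemma lat_scale: "c > 0 \<Longrightarrow> lat ((*) c ` S) = (*) c ` lat S"
  unfolding lat_def mults_def by (auto simp: image_iff) (metis mult.left_commute)+

text \<open>A common factor preserves all coincidences inside \<open>S\<close>. This is what permits
  one scaling factor per component.\<close>

lemma dens_scale:
  assumes "finite S" "\<forall>w\<in>S. w > 0" "c > 0"
  shows "dens ((*) c ` S) = dens S / c"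
proof -
  have e: "cnt (lat ((*) c ` S)) x = cnt (lat S) (x / c)" for x
  proof -
    have "lat ((*) c ` S) \<inter> {0<..x} = (*) c ` (lat S \<inter> {0<..x / c})"
      unfolding lat_scale[OF assms(3)] using assms(3) by (auto simp: image_iff field_simps zero_less_mult_iff)
    then show ?thesis unfolding cnt_def using assms(3) by (simp add: card_image inj_on_def)
  qed
  have b: "\<bar>real (cnt (lat S) (x / c)) - dens S / c * x\<bar> \<le> 2 ^ card S" if "x \<ge> 0" for x
    using dens_bound[OF assms(1,2), of "x / c"] that assms(3) by simp
  show ?thesis
  proof (rule antisym)
    show "dens ((*) c ` S) \<le> dens S / c"
      by (rule dens_le_I[where C = "2 ^ card S"]) (use assms e b in \<open>auto, smt (verit)\<close>)
    show "dens S / c \<le> dens ((*) c ` S)"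
      by (rule dens_ge_I[where C = "2 ^ card S"]) (use assms e b in \<open>auto, smt (verit)\<close>)
  qed
qed

section \<open>The joint cost as a density\<close>

text \<open>The extra order is the one at time 0, which \<open>mults\<close> leaves out; it vanishes
  in the limit.\<close>

lemma num_joint_orders_eq:
  assumes "policy n T" "n \<ge> 1" "x \<ge> 0"
  shows "num_joint_orders n T x = Suc (cnt (lat (T ` {1..n})) x)"
proof -
  let ?P = "lat (T ` {1..n})"
  have pos: "T i > 0" if "i \<in> {1..n}" for i using assms(1) that unfolding policy_def by auto
  have "(\<lambda>m::nat. real m * T i) ` {0..nat \<lfloor>x / T i\<rfloor>} = insert 0 (mults (T i) \<inter> {0<..x})"
    if "i \<in> {1..n}" for i
  proof -
    have "{0..nat \<lfloor>x / T i\<rfloor>} = insert 0 {1..nat \<lfloor>x / T i\<rfloor>}" by auto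
    then show ?thesis using mults_window[OF pos[OF that], of x] by simp
  qed
  then have "(\<Union>i\<in>{1..n}. (\<lambda>m::nat. real m * T i) ` {0..nat \<lfloor>x / T i\<rfloor>})
      = (\<Union>i\<in>{1..n}. insert 0 (mults (T i) \<inter> {0<..x}))" by (rule SUP_cong[OF refl])
  also have "\<dots> = insert 0 (?P \<inter> {0<..x})" using assms(2) unfolding lat_def by auto
  finally have "num_joint_orders n T x = card (insert 0 (?P \<inter> {0<..x}))"
    unfolding num_joint_orders_def by simp
  also have "\<dots> = Suc (card (?P \<inter> {0<..x}))"
    by (rule card_insert_disjoint) (use pos finite_lat_window[of "T ` {1..n}" x] in auto)
  finally show ?thesis unfolding cnt_def .
qed

text \<open>The bounded discrepancy gives convergence at rate \<open>C / x\<close>. Afterwards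
  densities replace limits altogether.\<close>

lemma joint_cost_eq_dens:
  assumes "policy n T" "n \<ge> 1"
  shows "joint_cost n k0 T = k0 * dens (T ` {1..n})"
proof -
  let ?S = "T ` {1..n}"
  define C :: real where "C = 2 ^ card ?S"
  have S: "finite ?S" "\<forall>w\<in>?S. w > 0" using assms(1) unfolding policy_def by auto
  have b: "norm (real (num_joint_orders n T x) / x - dens ?S) \<le> C / x" if x: "x > 0" for x
  proof -
    have "real (num_joint_orders n T x) / x - dens ?S = (real (num_joint_orders n T x) - dens ?S * x) / x"
      using x by (simp add: field_simps)
    moreover have "\<bar>real (num_joint_orders n T x) - dens ?S * x\<bar> \<le> C"
      using dens_bound[OF S, of x] x num_joint_orders_eq[OF assms, of x] unfolding C_def by simp
    ultimately show ?thesis using x by (simp add: divide_right_mono)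
  qed
  have "((\<lambda>x. C / x) \<longlongrightarrow> 0) at_top"
    by (rule real_tendsto_divide_at_top[OF tendsto_const filterlim_ident])
  then have "((\<lambda>x. real (num_joint_orders n T x) / x - dens ?S) \<longlongrightarrow> 0) at_top"
  proof (rule metric_tendsto_imp_tendsto)
    show "\<forall>\<^sub>F x in at_top. dist (real (num_joint_orders n T x) / x - dens ?S) 0 \<le> dist (C / x) 0"
      using eventually_gt_at_top[of 0]
    proof (rule eventually_mono)
      fix x :: real assume "x > 0"
      then show "dist (real (num_joint_orders n T x) / x - dens ?S) 0 \<le> dist (C / x) 0"
        using b[of x] unfolding dist_real_def C_def by simp
    qed
  qed
  then have "((\<lambda>x. real (num_joint_orders n T x) / x) \<longlongrightarrow> dens ?S) at_top"
    by (simp add: LIM_zero_iff)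
  then show ?thesis unfolding joint_cost_def by (simp add: tendsto_Lim)
qed

section \<open>Estimating a density from finitely many multiples\<close>

text \<open>The density of new multiples contributed by \<open>v (k + 1)\<close> is measured by their frequency among its first
  \<open>A\<close> multiples. The window is counted in multiples rather than in time because the machine cannot round.\<close>

definition fresh :: "(nat \<Rightarrow> real) \<Rightarrow> nat \<Rightarrow> nat \<Rightarrow> nat set" where
  "fresh v k A = {a\<in>{1..A}. real a * v (Suc k) \<notin> lat (v ` {1..k})}"

definition dens_est :: "(nat \<Rightarrow> real) \<Rightarrow> nat \<Rightarrow> nat \<Rightarrow> real" where
  "dens_est v L A = (\<Sum>k<L. real (card (fresh v k A)) / (real A * v (Suc k)))"

lemma card_fresh:
  assumes "\<forall>k\<in>{1..Suc k}. v k > 0"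
  shows "card (fresh v k A) + cnt (lat (v ` {1..k})) (real A * v (Suc k))
    = cnt (lat (v ` {1..Suc k})) (real A * v (Suc k))"
proof -
  let ?w = "v (Suc k)" and ?W = "{0<..real A * v (Suc k)}"
  have w: "?w > 0" using assms by auto
  have m: "mults ?w \<inter> ?W = (\<lambda>a. real a * ?w) ` {1..A}" using w by (simp add: mults_window)
  have "(\<lambda>a. real a * ?w) ` fresh v k A = mults ?w \<inter> ?W - lat (v ` {1..k})"
    unfolding m fresh_def by auto
  moreover have "inj_on (\<lambda>a. real a * ?w) (fresh v k A)" using w by (auto simp: inj_on_def)
  ultimately have c: "card (fresh v k A) = card (mults ?w \<inter> ?W - lat (v ` {1..k}))"
    by (metis card_image)
  have "lat (v ` {1..Suc k}) \<inter> ?W = (mults ?w \<inter> ?W - lat (v ` {1..k})) \<union> (lat (v ` {1..k}) \<inter> ?W)"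
    unfolding lat_def by (auto simp: atLeastAtMostSuc_conv)
  moreover have "card ((mults ?w \<inter> ?W - lat (v ` {1..k})) \<union> (lat (v ` {1..k}) \<inter> ?W))
      = card (mults ?w \<inter> ?W - lat (v ` {1..k})) + card (lat (v ` {1..k}) \<inter> ?W)"
    by (rule card_Un_disjoint) (use assms finite_mults_window[OF w] in \<open>auto intro!: finite_lat_window\<close>)
  ultimately show ?thesis unfolding cnt_def c by simp
qed

text \<open>Each entry has a window of its own, and there the counts for the lattices before and
  after adding it are off by less than \<open>2 ^ L\<close> and \<open>2 ^ Suc L\<close>. Divided by
  a window of length at least \<open>A * u\<close>, these errors form a geometric series, so the
  bound keeps its shape in the induction.\<close>

lemma dens_est_approx:
  assumes "\<forall>k\<in>{1..L}. v k > 0" "\<forall>k\<in>{1..L}. u \<le> v k" "u > 0" "A \<ge> 1"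
  shows "\<bar>dens_est v L A - dens (v ` {1..L})\<bar> \<le> 2 ^ (L + 2) / (real A * u)"
  using assms(1,2)
proof (induction L)
  case 0
  then show ?case using assms by (simp add: dens_est_def dens_empty)
next
  case (Suc L)
  let ?S = "v ` {1..L}" and ?S' = "v ` {1..Suc L}" and ?w = "v (Suc L)"
  have w: "?w > 0" "u \<le> ?w" using Suc.prems by auto
  have S: "finite ?S" "\<forall>w\<in>?S. w > 0" "finite ?S'" "\<forall>w\<in>?S'. w > 0" using Suc.prems by auto
  have x: "real A * ?w > 0" using w assms by simp
  have cb: "card ?S \<le> L" "card ?S' \<le> Suc L" using card_image_le[of "{1..L}" v] card_image_le[of "{1..Suc L}" v] by auto
  have pb: "(2::real) ^ card ?S \<le> 2 ^ L" "(2::real) ^ card ?S' \<le> 2 ^ Suc L"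
    using cb by (auto intro!: power_increasing simp del: power_Suc)
  have "real (card (fresh v L A)) + real (cnt (lat ?S) (real A * ?w)) = real (cnt (lat ?S') (real A * ?w))"
    using card_fresh[OF Suc.prems(1), of A] by (metis of_nat_add)
  then have "\<bar>real (card (fresh v L A)) - (dens ?S' - dens ?S) * (real A * ?w)\<bar> \<le> 2 ^ Suc L + 2 ^ L - 2"
    using dens_bound[OF S(1,2), of "real A * ?w"] dens_bound[OF S(3,4), of "real A * ?w"] x pb
    unfolding left_diff_distrib by linarith
  then have a: "\<bar>real (card (fresh v L A)) - (dens ?S' - dens ?S) * (real A * ?w)\<bar> \<le> 2 ^ (L + 2)"
    by simp
  have "real (card (fresh v L A)) / (real A * ?w) - (dens ?S' - dens ?S)
      = (real (card (fresh v L A)) - (dens ?S' - dens ?S) * (real A * ?w)) / (real A * ?w)"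
    unfolding diff_divide_distrib using x by (metis nonzero_mult_div_cancel_right less_irrefl)
  then have "\<bar>real (card (fresh v L A)) / (real A * ?w) - (dens ?S' - dens ?S)\<bar>
      = \<bar>real (card (fresh v L A)) - (dens ?S' - dens ?S) * (real A * ?w)\<bar> / (real A * ?w)"
    using x by (simp only: abs_divide abs_of_pos)
  also have "\<dots> \<le> 2 ^ (L + 2) / (real A * ?w)" using a x by (intro divide_right_mono) auto
  also have "\<dots> \<le> 2 ^ (L + 2) / (real A * u)"
    using x w assms by (intro divide_left_mono mult_left_mono) auto
  finally have b: "\<bar>real (card (fresh v L A)) / (real A * ?w) - (dens ?S' - dens ?S)\<bar>
      \<le> 2 ^ (L + 2) / (real A * u)" .
  have ih: "\<bar>dens_est v L A - dens ?S\<bar> \<le> 2 ^ (L + 2) / (real A * u)"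
    using Suc by auto
  have "dens_est v (Suc L) A = dens_est v L A + real (card (fresh v L A)) / (real A * ?w)" by (simp add: dens_est_def)
  then have "\<bar>dens_est v (Suc L) A - dens ?S'\<bar> \<le> 2 ^ (L + 2) / (real A * u) + 2 ^ (L + 2) / (real A * u)"
    using add_mono[OF ih b] abs_triangle_ineq[of "dens_est v L A - dens ?S"
        "real (card (fresh v L A)) / (real A * ?w) - (dens ?S' - dens ?S)"]
    by (simp add: algebra_simps)
  then show ?case by (simp add: mult.commute)
qed

section \<open>Overlaps between components\<close>

text \<open>A Bonferroni inequality for blocks: adding block \<open>i\<close> loses at most its
  overlap with the earlier blocks, and every overlap point lies in \<open>M x \<inter> M y\<close>
  for some \<open>x\<close> labelled \<open>i\<close> and some \<open>y\<close> of an earlier label.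
  The sum runs over ordered pairs, which is more than enough.\<close>

lemma card_Un_components:
  assumes "finite I" "\<And>i. i \<in> I \<Longrightarrow> finite (P i)" "finite R"
    and "\<And>i. i \<in> I \<Longrightarrow> P i = (\<Union>x\<in>{x\<in>R. lab x = i}. M x)"
  shows "(\<Sum>i\<in>I. card (P i)) \<le> card (\<Union>i\<in>I. P i)
    + (\<Sum>(x, y)\<in>{(x, y). x \<in> R \<and> y \<in> R \<and> lab x \<noteq> lab y \<and> lab x \<in> I \<and> lab y \<in> I}. card (M x \<inter> M y))"
  using assms(1,2,4)
proof (induction I rule: finite_induct)
  case (insert i I)
  let ?X = "\<lambda>I. {(x, y). x \<in> R \<and> y \<in> R \<and> lab x \<noteq> lab y \<and> lab x \<in> I \<and> lab y \<in> I}"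
  let ?N = "{(x, y). x \<in> R \<and> y \<in> R \<and> lab x = i \<and> lab y \<in> I}"
  have fR: "finite (R \<times> R)" using assms(3) by simp
  have fin: "finite (?X (insert i I))" "finite (?X I)" "finite ?N"
    by (rule finite_subset[OF _ fR], auto)+
  have disj: "?X I \<inter> ?N = {}" using insert.hyps by auto
  have sub: "?X I \<union> ?N \<subseteq> ?X (insert i I)" using insert.hyps by auto
  have ih: "(\<Sum>i\<in>I. card (P i)) \<le> card (\<Union>i\<in>I. P i) + (\<Sum>(x, y)\<in>?X I. card (M x \<inter> M y))"
    using insert by auto
  have "P i \<inter> (\<Union>i\<in>I. P i) \<subseteq> (\<Union>(x, y)\<in>?N. M x \<inter> M y)" using insert.prems by auto
  moreover have Mf: "finite (M x)" if "x \<in> R" "lab x \<in> insert i I" for x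
    using insert.prems(1)[OF that(2)] insert.prems(2)[OF that(2)] that(1)
    by (metis (mono_tags, lifting) UN_upper finite_subset mem_Collect_eq)
  ultimately have "card (P i \<inter> (\<Union>i\<in>I. P i)) \<le> card (\<Union>(x, y)\<in>?N. M x \<inter> M y)"
    using fin(3) by (intro card_mono) auto
  also have "\<dots> \<le> (\<Sum>(x, y)\<in>?N. card (M x \<inter> M y))"
    using card_UN_le[OF fin(3), of "\<lambda>(x, y). M x \<inter> M y"] by (simp add: case_prod_beta)
  finally have a: "card (P i \<inter> (\<Union>i\<in>I. P i)) \<le> (\<Sum>(x, y)\<in>?N. card (M x \<inter> M y))" .
  have "(\<Sum>(x, y)\<in>?X I. card (M x \<inter> M y)) + (\<Sum>(x, y)\<in>?N. card (M x \<inter> M y))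
      = (\<Sum>(x, y)\<in>?X I \<union> ?N. card (M x \<inter> M y))"
    by (rule sum.union_disjoint[symmetric]) (use fin disj in auto)
  also have "\<dots> \<le> (\<Sum>(x, y)\<in>?X (insert i I). card (M x \<inter> M y))"
    by (rule sum_mono2) (use fin sub in auto)
  finally have b: "(\<Sum>(x, y)\<in>?X I. card (M x \<inter> M y)) + (\<Sum>(x, y)\<in>?N. card (M x \<inter> M y))
      \<le> (\<Sum>(x, y)\<in>?X (insert i I). card (M x \<inter> M y))" .
  have "card (P i) + card (\<Union>i\<in>I. P i) = card (\<Union>i\<in>insert i I. P i) + card (P i \<inter> (\<Union>i\<in>I. P i))"
    using card_Un_Int[of "P i" "\<Union>i\<in>I. P i"] insert by auto
  moreover have "(\<Sum>i\<in>insert i I. card (P i)) = card (P i) + (\<Sum>i\<in>I. card (P i))" using insert.hyps by simp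
  ultimately show ?case using ih a b by linarith
qed simp

definition aligned :: "nat \<Rightarrow> real \<Rightarrow> real \<Rightarrow> bool" where
  "aligned B x y \<longleftrightarrow> (\<exists>p\<in>{1..B}. \<exists>q\<in>{1..B}. real q * x = real p * y)"

lemma aligned_sym: "aligned B x y \<Longrightarrow> aligned B y x"
  unfolding aligned_def by metis

text \<open>Common multiples are multiples of a single z = a * x = b * y. Unless \<open>x\<close>
  and \<open>y\<close> are aligned, \<open>a\<close> or \<open>b\<close> exceeds \<open>B\<close>,
  so \<open>z\<close> is at least \<open>B * \<tau>\<close>.\<close>

lemma cnt_unaligned_le:
  assumes "x > 0" "y > 0" "\<not> aligned B x y" "\<tau> \<le> x" "\<tau> \<le> y" "\<tau> > 0" "B \<ge> 1" "w \<ge> 0"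
  shows "real (card (mults x \<inter> mults y \<inter> {0<..w})) \<le> w / (real B * \<tau>)"
proof (cases "mults x \<inter> mults y = {}")
  case False
  then obtain z where z: "z \<in> mults x" "z \<in> mults y" "mults x \<inter> mults y = mults z"
    using mults_Int[OF assms(1,2)] by blast
  obtain a b where ab: "a \<ge> 1" "z = real a * x" "b \<ge> 1" "z = real b * y"
    using z(1,2) unfolding in_mults_iff by metis
  then have "a \<in> {1..B} \<Longrightarrow> b \<in> {1..B} \<Longrightarrow> aligned B x y" unfolding aligned_def by (intro bexI[of _ b] bexI[of _ a]) auto
  then have "\<not> (a \<le> B \<and> b \<le> B)" using assms(3) ab by auto
  then have "real B * \<tau> \<le> z"
  proof (cases "a \<le> B")
    case True
    then have "real B \<le> real b" using \<open>\<not> (a \<le> B \<and> b \<le> B)\<close> by simp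
    then show ?thesis using ab(4) assms by (simp add: mult_mono)
  next
    case False
    then have "real B \<le> real a" by simp
    then show ?thesis using ab(2) assms by (simp add: mult_mono)
  qed
  moreover have "z > 0" "real B * \<tau> > 0" using mults_pos[OF assms(1) z(1)] assms by auto
  ultimately have "w / z \<le> w / (real B * \<tau>)" using assms(8) by (intro divide_left_mono) auto
  then show ?thesis using cnt_mults_le[OF \<open>z > 0\<close> assms(8)] z(3) unfolding cnt_def by simp
qed (use assms in simp)

text \<open>Labels have to be constant along alignments and may be coarser than the connected
  components. Different labels then mean unaligned lattices, and each of the at most
  \<open>card R ^ 2\<close> pairs overlaps with density at most
  \<open>1 / (B * \<tau>)\<close>.\<close>

lemma sum_dens_components_le:
  assumes R: "finite R" "\<forall>x\<in>R. \<tau> \<le> x" "\<tau> > 0" "B \<ge> 1"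
    and lab: "\<And>x y. x \<in> R \<Longrightarrow> y \<in> R \<Longrightarrow> aligned B x y \<Longrightarrow> lab x = lab y"
  shows "(\<Sum>i\<in>lab ` R. dens {x\<in>R. lab x = i}) \<le> dens R + real (card R) ^ 2 / (real B * \<tau>)"
proof (rule linear_growth_le)
  fix w :: real assume w: "w \<ge> 0"
  let ?S = "\<lambda>i. {x\<in>R. lab x = i}"
  let ?X = "{(x, y). x \<in> R \<and> y \<in> R \<and> lab x \<noteq> lab y \<and> lab x \<in> lab ` R \<and> lab y \<in> lab ` R}"
  define C where "C = (\<Sum>i\<in>lab ` R. 2 ^ card (?S i)) + (2::real) ^ card R"
  have pos: "\<forall>x\<in>R. x > 0" using R by force
  have U: "(\<Union>i\<in>lab ` R. lat (?S i) \<inter> {0<..w}) = lat R \<inter> {0<..w}"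
    unfolding lat_def by auto
  have "(\<Sum>i\<in>lab ` R. card (lat (?S i) \<inter> {0<..w})) \<le> card (\<Union>i\<in>lab ` R. lat (?S i) \<inter> {0<..w})
      + (\<Sum>(x, y)\<in>?X. card ((mults x \<inter> {0<..w}) \<inter> (mults y \<inter> {0<..w})))"
  proof (rule card_Un_components[OF _ _ R(1)])
    show "finite (lat (?S i) \<inter> {0<..w})" for i using R pos by (intro finite_lat_window) auto
    show "lat (?S i) \<inter> {0<..w} = (\<Union>x\<in>{x\<in>R. lab x = i}. mults x \<inter> {0<..w})" for i unfolding lat_def by auto
  qed (use R in simp)
  then have "(\<Sum>i\<in>lab ` R. cnt (lat (?S i)) w) \<le> cnt (lat R) w
      + (\<Sum>(x, y)\<in>?X. card (mults x \<inter> mults y \<inter> {0<..w}))"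
    unfolding U cnt_def by (simp add: Int_ac)
  then have "real (\<Sum>i\<in>lab ` R. cnt (lat (?S i)) w) \<le> real (cnt (lat R) w
      + (\<Sum>(x, y)\<in>?X. card (mults x \<inter> mults y \<inter> {0<..w})))" by (simp only: of_nat_le_iff)
  then have 1: "(\<Sum>i\<in>lab ` R. real (cnt (lat (?S i)) w)) \<le> real (cnt (lat R) w)
      + (\<Sum>(x, y)\<in>?X. real (card (mults x \<inter> mults y \<inter> {0<..w})))"
    by (simp add: case_prod_beta)
  have fX: "finite ?X" "card ?X \<le> card R * card R"
  proof -
    have "?X \<subseteq> R \<times> R" by auto
    moreover have "finite (R \<times> R)" using R(1) by simp
    ultimately show "finite ?X" by (rule finite_subset)
    show "card ?X \<le> card R * card R"
      unfolding card_cartesian_product[symmetric] by (rule card_mono) fact+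
  qed
  have "(\<Sum>(x, y)\<in>?X. real (card (mults x \<inter> mults y \<inter> {0<..w}))) \<le> (\<Sum>(x, y)\<in>?X. w / (real B * \<tau>))"
  proof (rule sum_mono, clarify)
    fix x y assume "x \<in> R" "y \<in> R" "lab x \<noteq> lab y"
    then show "real (card (mults x \<inter> mults y \<inter> {0<..w})) \<le> w / (real B * \<tau>)"
      using cnt_unaligned_le[of x y B \<tau> w] lab pos R w by blast
  qed
  also have "\<dots> = real (card ?X) * (w / (real B * \<tau>))" by (simp add: case_prod_beta)
  also have "\<dots> \<le> real (card R * card R) * (w / (real B * \<tau>))"
    using fX R w by (intro mult_right_mono) (simp_all del: of_nat_mult)
  finally have 2: "(\<Sum>(x, y)\<in>?X. real (card (mults x \<inter> mults y \<inter> {0<..w}))) \<le> real (card R) ^ 2 / (real B * \<tau>) * w"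
    by (simp add: power2_eq_square)
  have "(\<Sum>i\<in>lab ` R. dens (?S i) * w) \<le> (\<Sum>i\<in>lab ` R. real (cnt (lat (?S i)) w) + 2 ^ card (?S i))"
  proof (rule sum_mono)
    fix i
    show "dens (?S i) * w \<le> real (cnt (lat (?S i)) w) + 2 ^ card (?S i)"
      using dens_bound[of "?S i" w] R pos w by (simp add: abs_le_iff)
  qed
  also have "\<dots> \<le> real (cnt (lat R) w) + real (card R) ^ 2 / (real B * \<tau>) * w + (\<Sum>i\<in>lab ` R. 2 ^ card (?S i))"
    using 1 2 by (simp add: sum.distrib)
  also have "\<dots> \<le> (dens R + real (card R) ^ 2 / (real B * \<tau>)) * w + C"
    using dens_bound[of R w] R pos w unfolding C_def by (simp add: algebra_simps abs_le_iff)
  finally show "(\<Sum>i\<in>lab ` R. dens (?S i)) * w \<le> (dens R + real (card R) ^ 2 / (real B * \<tau>)) * w + C"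
    by (simp add: sum_distrib_right)
qed

section \<open>Economic order quantities and the base time\<close>

lemma eoq_cost_pos: "k > 0 \<Longrightarrow> h > 0 \<Longrightarrow> t > 0 \<Longrightarrow> eoq_cost k h t > 0"
  unfolding eoq_cost_def by (simp add: add_pos_pos)

text \<open>Completing the square in \<open>h * (M - t) ^ 2 \<ge> 0\<close>. For
  \<open>k = h * M ^ 2\<close> the bound is the minimum of the cost, attained at
  \<open>M\<close>.\<close>

lemma eoq_cost_ge_sq:
  assumes "h > 0" "t > 0" "k \<ge> h * M ^ 2"
  shows "eoq_cost k h t \<ge> 2 * h * M"
proof -
  have "0 \<le> h * (M - t) ^ 2" using assms by simp
  then have "2 * h * M * t \<le> h * M ^ 2 + h * t * t" by (simp add: power2_eq_square algebra_simps)
  also have "\<dots> \<le> k + h * t * t" using assms by simp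
  finally show ?thesis unfolding eoq_cost_def using assms by (simp add: field_simps)
qed

lemma eoq_cost_mono:
  assumes "k > 0" "h > 0" "sqrt (k / h) \<le> s" "s \<le> t"
  shows "eoq_cost k h s \<le> eoq_cost k h t"
proof -
  have s: "s > 0" using assms by (smt (verit) divide_pos_pos real_sqrt_gt_zero)
  have "k / h \<le> s ^ 2" using assms by (simp add: sqrt_le_D)
  also have "\<dots> \<le> s * t" using s assms by (simp add: power2_eq_square)
  finally have "k \<le> h * (s * t)" using assms by (simp add: field_simps)
  then have "k * (t - s) \<le> h * (s * t) * (t - s)" using assms by (intro mult_right_mono) auto
  then have "k * t + h * s * (s * t) \<le> k * s + h * t * (s * t)" by (simp add: algebra_simps)
  then show ?thesis unfolding eoq_cost_def using s assms by (simp add: field_simps)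
qed

text \<open>One summand shrinks and the other grows by at most \<open>c\<close>. Together with the
  mirrored statement below, moving an interval by a factor \<open>c\<close> in either direction
  costs at most that factor.\<close>

lemma eoq_cost_up:
  assumes "k > 0" "h > 0" "0 < s" "s \<le> t" "t \<le> c * s"
  shows "eoq_cost k h t \<le> c * eoq_cost k h s"
proof -
  have c: "c \<ge> 1" using assms by (smt (verit) mult_le_cancel_right1)
  have "k / t \<le> k / s" using assms by (simp add: frac_le)
  also have "\<dots> \<le> c * (k / s)" using mult_right_mono[OF c, of "k / s"] assms by simp
  finally have "k / t \<le> c * (k / s)" .
  moreover have "h * t \<le> h * (c * s)" using assms by simp
  ultimately show ?thesis unfolding eoq_cost_def by (simp add: algebra_simps)
qed

lemma eoq_cost_down:
  assumes "k > 0" "h > 0" "0 < t" "t \<le> s" "s \<le> c * t"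
  shows "eoq_cost k h t \<le> c * eoq_cost k h s"
proof -
  have c: "c \<ge> 1" using assms by (smt (verit) mult_le_cancel_right1)
  have "k / t \<le> c * (k / s)" using assms by (simp add: field_simps)
  moreover have "h * t \<le> h * s" "h * s \<le> c * (h * s)" using assms mult_right_mono[OF c, of "h * s"] by auto
  ultimately show ?thesis unfolding eoq_cost_def by (simp add: algebra_simps)
qed

text \<open>When the multiple of \<open>u\<close> needed to round \<open>\<tau>\<close> up exceeds \<open>X\<close>, commodities whose own optimum is below \<open>X * u\<close>
  can be pulled down to \<open>X * u\<close>, and the others can afford private joint orders.\<close>

lemma round_to_multiple:
  assumes "k > 0" "h > 0" "k0 > 0" "u > 0" "m \<ge> 1" "\<tau> \<ge> m * u" "X \<ge> 1"
  shows "(\<exists>l\<in>{1..X}. eoq_cost k h (real l * u) \<le> (1 + 1 / m) * eoq_cost k h \<tau>) \<or>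
    eoq_cost k h (sqrt (k / h)) + k0 / sqrt (k / h) \<le> eoq_cost k h \<tau> + k0 / (real X * u)"
proof -
  let ?E = "sqrt (k / h)"
  have E: "?E > 0" using assms by simp
  have tau: "\<tau> > 0" using assms by (smt (verit) mult_pos_pos)
  have ge: "1 * eoq_cost k h \<tau> \<le> (1 + 1 / m) * eoq_cost k h \<tau>"
    using eoq_cost_pos[OF assms(1,2) tau] assms(5) by (intro mult_right_mono) auto
  consider "\<tau> \<le> real X * u" | "real X * u < \<tau>" "?E \<le> real X * u" | "real X * u < ?E" by linarith
  then show ?thesis
  proof cases
    case 1
    define l where "l = nat \<lceil>\<tau> / u\<rceil>"
    have pos: "\<tau> / u > 0" using tau assms by simp
    have l: "real l < \<tau> / u + 1" "\<tau> / u \<le> real l" using pos unfolding l_def by linarith+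
    have "\<tau> / u \<le> real X" using 1 assms by (simp add: field_simps)
    then have "l \<le> X" unfolding l_def by (simp add: nat_le_iff ceiling_le_iff)
    moreover have "l \<ge> 1" using l pos by linarith
    moreover have "\<tau> \<le> real l * u" "real l * u \<le> \<tau> + u" using l assms by (simp_all add: field_simps)
    moreover have "u \<le> \<tau> / m" using assms by (simp add: field_simps)
    ultimately have "l \<in> {1..X}" "\<tau> \<le> real l * u" "real l * u \<le> (1 + 1 / m) * \<tau>" by (auto simp: algebra_simps)
    then show ?thesis using eoq_cost_up[OF assms(1,2) tau] by blast
  next
    case 2
    then have "eoq_cost k h (real X * u) \<le> eoq_cost k h \<tau>" using eoq_cost_mono[OF assms(1,2)] by simp
    then show ?thesis using ge assms(7) by force
  next
    case 3
    have "h * ?E ^ 2 \<le> k" using assms by simp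
    then have "2 * h * ?E \<le> eoq_cost k h \<tau>" using eoq_cost_ge_sq[OF assms(2) tau] by blast
    moreover have "eoq_cost k h ?E = 2 * h * ?E"
    proof -
      have "k = h * ?E * ?E" using assms by (simp add: real_sqrt_mult_self mult.assoc)
      then have "k / ?E = h * ?E" using E by (metis less_irrefl nonzero_mult_div_cancel_right)
      then show ?thesis unfolding eoq_cost_def by simp
    qed
    moreover have "k0 / ?E \<le> k0 / (real X * u)" using 3 assms by (intro divide_left_mono) auto
    ultimately show ?thesis by linarith
  qed
qed

text \<open>The minimizer \<open>t\<close> of the convex relaxation in which all intervals are at least \<open>t\<close> and the joint cost is
  \<open>K 0 / t\<close> satisfies the stationarity condition \<open>balanced\<close>, so it is one of \<open>n\<close> explicit square roots,
  one for each initial segment of the commodities sorted by \<open>K i / H i\<close>.\<close>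

definition base_time :: "(nat \<Rightarrow> real) \<Rightarrow> (nat \<Rightarrow> real) \<Rightarrow> nat \<Rightarrow> nat \<Rightarrow> real" where
  "base_time K H n j = sqrt ((K 0 + (\<Sum>i\<in>{i\<in>{1..n}. \<not> K j / H j < K i / H i}. K i)) /
      (\<Sum>i\<in>{i\<in>{1..n}. \<not> K j / H j < K i / H i}. H i))"

definition balanced :: "(nat \<Rightarrow> real) \<Rightarrow> (nat \<Rightarrow> real) \<Rightarrow> nat \<Rightarrow> real \<Rightarrow> bool" where
  "balanced K H n t \<longleftrightarrow> t > 0 \<and> (\<Sum>i=1..n. max 0 (H i * t ^ 2 - K i)) = K 0"

text \<open>The sum in \<open>balanced\<close> is continuous in \<open>t\<close> and reaches
  \<open>K 0\<close>, so a root exists. At the root only commodities with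
  \<open>K i / H i < t ^ 2\<close> contribute; they form an initial segment by this ratio, and a
  contributing \<open>j\<close> of largest ratio describes the segment, ties included. On that fixed
  set the equation is quadratic in \<open>t\<close> and is solved by
  \<open>base_time K H n j\<close>.\<close>

lemma base_time_balanced:
  assumes inst: "jrp_instance n K H"
  shows "\<exists>j\<in>{1..n}. balanced K H n (base_time K H n j)"
proof -
  have n: "n \<ge> 1" and K0: "K 0 > 0" and KH: "\<And>i. i \<in> {1..n} \<Longrightarrow> K i > 0 \<and> H i > 0"
    using inst unfolding jrp_instance_def by auto
  define f where "f t = (\<Sum>i=1..n. max 0 (H i * t ^ 2 - K i))" for t
  \<comment> \<open>At \<open>b\<close> commodity 1 alone already contributes
    \<open>K 0\<close>.\<close>
  define b where "b = sqrt ((K 0 + K 1) / H 1)"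
  have K1: "K 1 > 0" "H 1 > 0" using KH[of 1] n by auto
  have "b ^ 2 = (K 0 + K 1) / H 1" unfolding b_def using K0 K1 by simp
  then have "max 0 (H 1 * b ^ 2 - K 1) = K 0" using K0 K1 by simp
  moreover have "max 0 (H 1 * b ^ 2 - K 1) \<le> f b" unfolding f_def
    by (rule member_le_sum[where f = "\<lambda>i. max 0 (H i * b ^ 2 - K i)"]) (use n in auto)
  ultimately have fb: "K 0 \<le> f b" by simp
  have f0: "f 0 = 0" unfolding f_def by (rule sum.neutral) (use KH in force)
  have "continuous_on {0..b} f" unfolding f_def by (intro continuous_intros)
  moreover have "0 \<le> b" unfolding b_def using K0 K1 by simp
  ultimately obtain t where t: "0 \<le> t" "t \<le> b" "f t = K 0"
    using IVT'[of f 0 "K 0" b] f0 fb K0 by auto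
  have tp: "t > 0" using t f0 K0 by (metis less_eq_real_def less_irrefl)
  define S where "S = {i\<in>{1..n}. K i / H i < t ^ 2}"
  have finS: "finite S" unfolding S_def by simp
  have iff: "K i / H i < t ^ 2 \<longleftrightarrow> K i < H i * t ^ 2" if "i \<in> {1..n}" for i
    using KH[OF that] by (simp add: field_simps)
  have fS: "f t = (\<Sum>i\<in>S. H i * t ^ 2 - K i)"
  proof -
    have "f t = (\<Sum>i\<in>S. max 0 (H i * t ^ 2 - K i))" unfolding f_def
      by (rule sum.mono_neutral_right) (use iff in \<open>auto simp: S_def\<close>)
    also have "\<dots> = (\<Sum>i\<in>S. H i * t ^ 2 - K i)" by (rule sum.cong) (use iff in \<open>auto simp: S_def\<close>)
    finally show ?thesis .
  qed
  have "S \<noteq> {}" using fS t K0 by auto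
  then have "Max ((\<lambda>i. K i / H i) ` S) \<in> (\<lambda>i. K i / H i) ` S" using finS by (intro Max_in) auto
  then obtain j where j: "j \<in> S" "K j / H j = Max ((\<lambda>i. K i / H i) ` S)" by auto
  have jmax: "K i / H i \<le> K j / H j" if "i \<in> S" for i using that finS j by simp
  have Sj: "{i\<in>{1..n}. \<not> K j / H j < K i / H i} = S"
  proof
    show "S \<subseteq> {i\<in>{1..n}. \<not> K j / H j < K i / H i}" using jmax unfolding S_def by force
    show "{i\<in>{1..n}. \<not> K j / H j < K i / H i} \<subseteq> S" using j(1) unfolding S_def by force
  qed
  have H: "(\<Sum>i\<in>S. H i) > 0" using \<open>S \<noteq> {}\<close> finS KH by (intro sum_pos) (auto simp: S_def)
  have "(\<Sum>i\<in>S. H i) * t ^ 2 - (\<Sum>i\<in>S. K i) = K 0"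
    using fS t(3) by (simp add: sum_subtractf sum_distrib_right)
  then have "(K 0 + (\<Sum>i\<in>S. K i)) / (\<Sum>i\<in>S. H i) = t ^ 2" using H by (simp add: field_simps)
  then have "base_time K H n j = t" unfolding base_time_def Sj using tp by simp
  then have "balanced K H n (base_time K H n j)" using t tp unfolding balanced_def f_def by simp
  then show ?thesis using j unfolding S_def by blast
qed

lemma joint_cost_ge:
  assumes "policy n T" "i \<in> {1..n}" "k0 > 0"
  shows "k0 / T i \<le> joint_cost n k0 T"
proof -
  have "1 / T i \<le> dens (T ` {1..n})"
    by (rule dens_ge_member) (use assms in \<open>auto simp: policy_def\<close>)
  then have "k0 * (1 / T i) \<le> k0 * dens (T ` {1..n})" using assms by (intro mult_left_mono) auto
  then show ?thesis using joint_cost_eq_dens[OF assms(1)] assms(2) by simp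
qed

text \<open>Charging \<open>K 0 / min T\<close> to the commodities in proportion to \<open>max 0 (H i * t ^ 2 - K i)\<close> decouples the
  cost into independent economic order quantity problems.\<close>

lemma total_cost_ge_relaxation:
  assumes inst: "jrp_instance n K H" and T: "policy n T" and t: "balanced K H n t"
  shows "(\<Sum>i=1..n. 2 * H i * max t (sqrt (K i / H i))) \<le> total_cost n K H T"
proof -
  have n: "n \<ge> 1" and K0: "K 0 > 0" and KH: "\<And>i. i \<in> {1..n} \<Longrightarrow> K i > 0 \<and> H i > 0"
    using inst unfolding jrp_instance_def by auto
  have Tp: "\<And>i. i \<in> {1..n} \<Longrightarrow> T i > 0" using T unfolding policy_def by auto
  define \<tau> where "\<tau> = Min (T ` {1..n})"
  have tau: "\<tau> \<in> T ` {1..n}" "\<And>i. i \<in> {1..n} \<Longrightarrow> \<tau> \<le> T i"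
    unfolding \<tau>_def using n by (auto intro!: Min_in)
  then have taup: "\<tau> > 0" using Tp by auto
  let ?l = "\<lambda>i. max 0 (H i * t ^ 2 - K i)"
  have "(\<Sum>i=1..n. ?l i / T i) \<le> (\<Sum>i=1..n. ?l i / \<tau>)"
    by (intro sum_mono divide_left_mono) (use tau Tp taup in auto)
  also have "\<dots> = K 0 / \<tau>" using t unfolding balanced_def by (simp flip: sum_divide_distrib)
  also have "\<dots> \<le> joint_cost n (K 0) T" using joint_cost_ge[OF T _ K0] tau(1) by auto
  finally have J: "(\<Sum>i=1..n. ?l i / T i) \<le> joint_cost n (K 0) T" .
  \<comment> \<open>Adding the charged share \<open>?l i\<close> to \<open>K i\<close> moves the
    unconstrained optimum up to \<open>max t (sqrt (K i / H i))\<close>.\<close>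
  have "2 * H i * max t (sqrt (K i / H i)) \<le> ?l i / T i + eoq_cost (K i) (H i) (T i)" if i: "i \<in> {1..n}" for i
  proof -
    have "H i * max t (sqrt (K i / H i)) ^ 2 \<le> K i + ?l i"
    proof (cases "sqrt (K i / H i) \<le> t")
      case False
      then have "max t (sqrt (K i / H i)) = sqrt (K i / H i)" by simp
      then have "H i * max t (sqrt (K i / H i)) ^ 2 = K i" using KH[OF i] by simp
      then show ?thesis by simp
    qed (simp add: max_def)
    then have "2 * H i * max t (sqrt (K i / H i)) \<le> eoq_cost (K i + ?l i) (H i) (T i)"
      using eoq_cost_ge_sq KH[OF i] Tp[OF i] by blast
    then show ?thesis unfolding eoq_cost_def by (simp add: add_divide_distrib)
  qed
  then have "(\<Sum>i=1..n. 2 * H i * max t (sqrt (K i / H i))) \<le> (\<Sum>i=1..n. ?l i / T i + eoq_cost (K i) (H i) (T i))"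
    by (rule sum_mono)
  then show ?thesis using J unfolding total_cost_def by (simp add: sum.distrib)
qed

text \<open>Deviations in both directions are expensive. A short smallest interval makes
  \<open>K 0 / T i\<close> large. A long one makes all intervals long, and then holding costs
  dominate, because balance implies that \<open>K 0\<close> is at most \<open>t ^ 2\<close> times
  the sum of the \<open>H i\<close>.\<close>

lemma balanced_min_interval:
  assumes inst: "jrp_instance n K H" and T: "policy n T" and t: "balanced K H n t"
    and i: "i \<in> {1..n}" "\<And>i'. i' \<in> {1..n} \<Longrightarrow> T i \<le> T i'"
    and c: "total_cost n K H T \<le> c * (K 0 / t)"
  shows "t \<le> c * T i" "T i \<le> c * t"
proof -
  have K0: "K 0 > 0" and KH: "\<And>i. i \<in> {1..n} \<Longrightarrow> K i > 0 \<and> H i > 0"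
    using inst unfolding jrp_instance_def by auto
  have Tp: "\<And>i. i \<in> {1..n} \<Longrightarrow> T i > 0" using T unfolding policy_def by auto
  have tp: "t > 0" using t unfolding balanced_def by simp
  have C: "0 \<le> eoq_cost (K i) (H i) (T i)" if "i \<in> {1..n}" for i
    using eoq_cost_pos KH Tp that by (meson less_imp_le)
  have "K 0 / T i \<le> total_cost n K H T"
    using joint_cost_ge[OF T i(1) K0] C unfolding total_cost_def
    by (smt (verit) sum_nonneg)
  then have "K 0 / T i \<le> c * (K 0 / t)" using c by linarith
  then have "K 0 * t \<le> K 0 * (c * T i)" using Tp[OF i(1)] tp by (simp add: field_simps)
  then show "t \<le> c * T i" using K0 by simp
  have "K 0 \<le> (\<Sum>i=1..n. H i * t ^ 2)"
  proof -
    have "(\<Sum>i=1..n. max 0 (H i * t ^ 2 - K i)) \<le> (\<Sum>i=1..n. H i * t ^ 2)"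
      by (rule sum_mono) (use KH in \<open>force simp: less_imp_le\<close>)
    then show ?thesis using t unfolding balanced_def by simp
  qed
  then have a: "K 0 \<le> (\<Sum>i=1..n. H i) * t ^ 2" by (simp add: sum_distrib_right)
  have "(\<Sum>i=1..n. H i) * T i = (\<Sum>i'=1..n. H i' * T i)" by (simp add: sum_distrib_right)
  also have "\<dots> \<le> (\<Sum>i'=1..n. eoq_cost (K i') (H i') (T i'))"
  proof (rule sum_mono)
    fix i' assume i': "i' \<in> {1..n}"
    have "H i' * T i \<le> H i' * T i'" using i i' KH by (simp add: less_imp_le)
    then show "H i' * T i \<le> eoq_cost (K i') (H i') (T i')"
      unfolding eoq_cost_def using KH[OF i'] Tp[OF i'] by (smt (verit) divide_pos_pos)
  qed
  also have "\<dots> \<le> total_cost n K H T"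
  proof -
    have "0 < K 0 / T i" using K0 Tp[OF i(1)] by simp
    then show ?thesis unfolding total_cost_def using joint_cost_ge[OF T i(1) K0] by linarith
  qed
  finally have b: "(\<Sum>i=1..n. H i) * T i \<le> c * (K 0 / t)" using c by linarith
  have c0: "c > 0"
  proof -
    have "0 < K 0 / T i" using K0 Tp[OF i(1)] by simp
    then have "0 < c * (K 0 / t)" using \<open>K 0 / T i \<le> c * (K 0 / t)\<close> by linarith
    then show ?thesis using K0 tp by (simp add: zero_less_mult_iff zero_less_divide_iff)
  qed
  have Hp: "(\<Sum>i=1..n. H i) > 0" using i(1) KH by (intro sum_pos) auto
  have "c * (K 0 / t) \<le> c * ((\<Sum>i=1..n. H i) * t ^ 2 / t)"
    using a c0 tp by (intro mult_left_mono divide_right_mono) auto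
  also have "\<dots> = (\<Sum>i=1..n. H i) * (c * t)" using tp by (simp add: power2_eq_square)
  finally have "(\<Sum>i=1..n. H i) * T i \<le> (\<Sum>i=1..n. H i) * (c * t)" using b by linarith
  then show "T i \<le> c * t" using Hp by simp
qed

section \<open>Rational chains approximating a policy\<close>

text \<open>\<open>v 0 = t\<close> is a reference point only; the order intervals are \<open>v 1, \<dots>, v L\<close>.\<close>

definition is_chain :: "nat \<Rightarrow> nat \<Rightarrow> real \<Rightarrow> (nat \<Rightarrow> real) \<Rightarrow> bool" where
  "is_chain B L t v \<longleftrightarrow> v 0 = t \<and>
    (\<forall>k<L. \<exists>j\<le>k. \<exists>p\<in>{1..B}. \<exists>q\<in>{1..B}. v (Suc k) = real p / real q * v j)"

lemma is_chain_extend: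
  assumes "is_chain B r t v" "j \<le> r" "p \<in> {1..B}" "q \<in> {1..B}"
  shows "is_chain B (Suc r) t (v(Suc r := real p / real q * v j))" (is "is_chain _ _ _ ?v")
  unfolding is_chain_def
proof (intro conjI allI impI)
  show "?v 0 = t" using assms(1) by (simp add: is_chain_def)
  fix k assume "k < Suc r"
  then consider "k < r" | "k = r" by linarith
  then show "\<exists>j\<le>k. \<exists>p\<in>{1..B}. \<exists>q\<in>{1..B}. ?v (Suc k) = real p / real q * ?v j"
  proof cases
    case 1
    then obtain j p q where "j \<le> k" "p \<in> {1..B}" "q \<in> {1..B}" "v (Suc k) = real p / real q * v j"
      using assms(1) unfolding is_chain_def by blast
    then show ?thesis using 1 by (intro exI[of _ j] conjI bexI[of _ p] bexI[of _ q]) auto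
  next
    case 2
    then show ?thesis using assms(2-4) by (intro exI[of _ j] conjI bexI[of _ p] bexI[of _ q]) auto
  qed
qed

text \<open>The search enumerates chains of one fixed length. Repeating \<open>v 1\<close> with the
  fraction 1/1 adds no lattice.\<close>

lemma is_chain_pad:
  assumes "is_chain B r t v" "r \<ge> 1" "B \<ge> 1" "r \<le> L"
  shows "\<exists>v'. is_chain B L t v' \<and> v' ` {1..L} = v ` {1..r} \<and> v' 1 = v 1"
  using assms(4)
proof (induction L rule: dec_induct)
  case base
  show ?case using assms by blast
next
  case (step L)
  then obtain v' where v': "is_chain B L t v'" "v' ` {1..L} = v ` {1..r}" "v' 1 = v 1" by blast
  have L: "1 \<le> L" using step assms by simp
  let ?v = "v'(Suc L := real (1::nat) / real (1::nat) * v' 1)"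
  have "is_chain B (Suc L) t ?v" by (rule is_chain_extend[OF v'(1)]) (use L assms in auto)
  moreover have "?v ` {1..Suc L} = insert (v' 1) (v' ` {1..L})"
    by (auto simp: atLeastAtMostSuc_conv image_iff)
  moreover have "v' 1 \<in> v' ` {1..L}" using L by auto
  ultimately have "?v ` {1..Suc L} = v ` {1..r}" using v'(2) by (metis insert_absorb)
  moreover have "?v 1 = v 1" using v'(3) L by simp
  ultimately show ?case using \<open>is_chain B (Suc L) t ?v\<close> by blast
qed

text \<open>With the denominator fixed to \<open>b\<close> the numerator is at least
  \<open>m\<close>, so dropping the fractional part loses a relative \<open>1 / m\<close> at most.
  Rounding goes down, which keeps all scaling factors at most 1.\<close>

lemma rational_round_down:
  assumes "m \<ge> 1" "b \<ge> 1" "b \<le> B" "x \<ge> real m / real b" "x * real b \<le> real B"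
  shows "\<exists>p\<in>{1..B}. \<exists>q\<in>{1..B}. real p / real q \<le> x \<and> x \<le> (1 + 1 / real m) * (real p / real q)"
proof -
  define a where "a = nat \<lfloor>x * real b\<rfloor>"
  have xb: "real m \<le> x * real b" using assms by (simp add: field_simps)
  then have a: "real a \<le> x * real b" "x * real b < real a + 1" unfolding a_def by linarith+
  then have am: "m \<le> a" using xb by linarith
  have "a \<le> B" using a assms(5) by linarith
  moreover have "real a / real b \<le> x" using a assms by (simp add: field_simps)
  moreover have "x \<le> (1 + 1 / real m) * (real a / real b)"
  proof -
    have "1 \<le> real a / real m" using am assms by simp
    then have "x * real b \<le> (1 + 1 / real m) * real a" using a by (simp add: algebra_simps)
    then show ?thesis using assms by (simp add: field_simps)
  qed
  ultimately show ?thesis using am assms by (intro bexI[of _ a] bexI[of _ b]) auto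
qed

lemma aligned_ratio:
  assumes "aligned B y x" "x > 0"
  shows "\<exists>p\<in>{1..B}. \<exists>q\<in>{1..B}. y = real p / real q * x"
proof -
  obtain p q where "p \<in> {1..B}" "q \<in> {1..B}" "real q * y = real p * x"
    using assms unfolding aligned_def by blast
  then show ?thesis by (intro bexI[of _ p] bexI[of _ q]) (auto simp: field_simps)
qed

text \<open>The invariant of a greedy listing of \<open>R\<close>: \<open>Q\<close> is the part
  already listed, \<open>\<theta>\<close> gives each label its scaling factor, and \<open>c\<close>
  is the newest label. The last clause closes the older components: only elements labelled
  \<open>c\<close> may be aligned with something outside \<open>Q\<close>. The entry
  \<open>v 1\<close> is tied to \<open>\<tau>\<close> because long intervals are later rounded to
  multiples of \<open>v 1\<close>.\<close>

definition partial_chain :: "real set \<Rightarrow> real \<Rightarrow> real \<Rightarrow> nat \<Rightarrow> nat \<Rightarrow> nat \<Rightarrow> real set \<Rightarrow> (nat \<Rightarrow> real) \<Rightarrow>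
    (real \<Rightarrow> nat) \<Rightarrow> (nat \<Rightarrow> real) \<Rightarrow> nat \<Rightarrow> bool" where
  "partial_chain R \<tau> t m B r Q v lab \<theta> c \<longleftrightarrow> Q \<subseteq> R \<and> card Q = r \<and> \<tau> \<in> Q \<and> is_chain B r t v \<and>
    v ` {1..r} = (\<lambda>x. \<theta> (lab x) * x) ` Q \<and> v 1 = \<theta> (lab \<tau>) * \<tau> \<and>
    (\<forall>x\<in>Q. \<theta> (lab x) \<le> 1 \<and> 1 \<le> (1 + 1 / real m) * \<theta> (lab x) \<and> lab x \<le> c) \<and>
    (\<forall>x\<in>Q. \<forall>y\<in>Q. aligned B x y \<longrightarrow> lab x = lab y) \<and>
    (\<forall>x\<in>Q. \<forall>y\<in>R-Q. aligned B x y \<longrightarrow> lab x = c)"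

text \<open>Grown greedily: an element aligned with an already listed one joins the current component with the
  same scaling factor; if there is none, any remaining element opens a new component, and the older
  components are never aligned with anything that is listed later.\<close>

lemma component_chain:
  assumes R: "finite R" "\<tau> \<in> R" "\<forall>x\<in>R. x > 0" "t > 0" "m \<ge> (1::nat)"
    and approx: "\<And>x. x \<in> R \<Longrightarrow> \<exists>p\<in>{1..B}. \<exists>q\<in>{1..B}.
        real p / real q \<le> x / t \<and> x / t \<le> (1 + 1 / real m) * (real p / real q)"
    and r: "1 \<le> r" "r \<le> card R"
  shows "\<exists>Q v lab \<theta> c. partial_chain R \<tau> t m B r Q v lab \<theta> c"
  using r
proof (induction r rule: dec_induct)
  case base
  obtain p q where pq: "p \<in> {1..B}" "q \<in> {1..B}" "real p / real q \<le> \<tau> / t"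
      "\<tau> / t \<le> (1 + 1 / real m) * (real p / real q)" using approx[OF R(2)] by blast
  have tp: "\<tau> > 0" using R by auto
  let ?v = "(\<lambda>_. t)(Suc 0 := real p / real q * t)"
  let ?\<theta> = "\<lambda>_::nat. real p / real q * t / \<tau>"
  have "is_chain B 1 t ?v"
    using is_chain_extend[of B 0 t "\<lambda>_. t" 0 p q] pq by (simp add: is_chain_def)
  moreover have "real p / real q * t / \<tau> \<le> 1"
  proof -
    have "real p / real q * t \<le> \<tau>" using pq(3) R(4) by (simp only: pos_le_divide_eq)
    then show ?thesis using tp by (simp only: pos_divide_le_eq mult_1)
  qed
  moreover have "1 \<le> (1 + 1 / real m) * (real p / real q * t / \<tau>)"
  proof -
    have "\<tau> \<le> (1 + 1 / real m) * (real p / real q) * t" using pq(4) R(4) by (simp only: pos_divide_le_eq)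
    then have "1 \<le> (1 + 1 / real m) * (real p / real q) * t / \<tau>" using tp by (simp only: pos_le_divide_eq mult_1)
    moreover have "a * b * c / d = a * (b * c / d)" for a b c d :: real by simp
    ultimately show ?thesis by metis
  qed
  ultimately have "partial_chain R \<tau> t m B 1 {\<tau>} ?v (\<lambda>_. 0) ?\<theta> 0"
    using R tp unfolding partial_chain_def by (auto simp del: fun_upd_apply simp: fun_upd_same)
  then show ?case by blast
next
  case (step r)
  have "r \<le> card R" using step.prems by simp
  from step.IH[OF this] obtain Q v lab \<theta> c where "partial_chain R \<tau> t m B r Q v lab \<theta> c" by blast
  then have Q: "Q \<subseteq> R" "card Q = r" "\<tau> \<in> Q"
    and v: "is_chain B r t v" "v ` {1..r} = (\<lambda>x. \<theta> (lab x) * x) ` Q" "v 1 = \<theta> (lab \<tau>) * \<tau>"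
    and inv: "\<forall>x\<in>Q. \<theta> (lab x) \<le> 1 \<and> 1 \<le> (1 + 1 / real m) * \<theta> (lab x) \<and> lab x \<le> c"
      "\<forall>x\<in>Q. \<forall>y\<in>Q. aligned B x y \<longrightarrow> lab x = lab y" "\<forall>x\<in>Q. \<forall>y\<in>R-Q. aligned B x y \<longrightarrow> lab x = c"
    unfolding partial_chain_def by simp_all
  have th: "\<theta> (lab x) \<le> 1 \<and> 1 \<le> (1 + 1 / real m) * \<theta> (lab x) \<and> lab x \<le> c" if "x \<in> Q" for x
    using inv(1) that by blast
  have al: "lab x = lab y" if "x \<in> Q" "y \<in> Q" "aligned B x y" for x y using inv(2) that by blast
  have cl: "lab x = c" if "x \<in> Q" "y \<in> R - Q" "aligned B x y" for x y using inv(3) that by blast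
  have finQ: "finite Q" using Q R finite_subset by blast
  have "R - Q \<noteq> {}"
  proof
    assume "R - Q = {}"
    then have "Q = R" using Q(1) by blast
    then show False using step.prems Q(2) by simp
  qed
  have r1: "1 \<le> r" by fact
  \<comment> \<open>Both ways of choosing the next element \<open>y\<close> deliver the same data:
    its scaled value is a fraction of an earlier entry, and \<open>l\<close> is the label it
    receives. On labels already in use \<open>\<theta>'\<close> agrees with
    \<open>\<theta>\<close>.\<close>
  obtain y j p q l \<theta>' where y: "y \<in> R - Q" and jpq: "j \<le> r" "p \<in> {1..B}" "q \<in> {1..B}"
    and val: "real p / real q * v j = \<theta>' l * y" and lth: "\<theta>' l \<le> 1" "1 \<le> (1 + 1 / real m) * \<theta>' l" "c \<le> l"
    and same_th: "\<And>x. x \<in> Q \<Longrightarrow> \<theta>' (lab x) = \<theta> (lab x)"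
    and cl': "\<And>x z. x \<in> Q \<Longrightarrow> z \<in> R - Q \<Longrightarrow> aligned B x z \<Longrightarrow> lab x = l"
  proof (cases "\<exists>y\<in>R-Q. \<exists>x\<in>Q. aligned B x y")
    case True
    then obtain x y where xy: "y \<in> R - Q" "x \<in> Q" "aligned B x y" by blast
    have "x > 0" using xy Q R by auto
    then obtain p q where pq: "p \<in> {1..B}" "q \<in> {1..B}" "y = real p / real q * x"
      using aligned_ratio[OF aligned_sym[OF xy(3)]] by blast
    have "\<theta> (lab x) * x \<in> v ` {1..r}" using v(2) xy by auto
    then obtain j where j: "j \<in> {1..r}" "v j = \<theta> (lab x) * x" by auto
    have cx: "lab x = c" using cl xy by blast
    show thesis
      by (rule that[of y j p q \<theta> c]) (use xy(1) j pq cx th[OF xy(2)] cl in auto)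
  next
    case False
    obtain y where y: "y \<in> R - Q" using \<open>R - Q \<noteq> {}\<close> by blast
    have yp: "y > 0" using y R by auto
    obtain p q where pq: "p \<in> {1..B}" "q \<in> {1..B}" "real p / real q \<le> y / t"
        "y / t \<le> (1 + 1 / real m) * (real p / real q)" using approx[of y] y by blast
    \<comment> \<open>The factor that makes the scaled root exactly a fraction of \<open>t\<close>;
      its parent is the reference point at index 0.\<close>
    define th0 where "th0 = real p / real q * t / y"
    have th0: "th0 \<le> 1" "1 \<le> (1 + 1 / real m) * th0" "real p / real q * v 0 = th0 * y"
    proof -
      have "real p / real q * t \<le> y" using pq(3) R(4) by (simp only: pos_le_divide_eq)
      then show "th0 \<le> 1" unfolding th0_def using yp by (simp only: pos_divide_le_eq mult_1)
      have "y \<le> (1 + 1 / real m) * (real p / real q) * t" using pq(4) R(4) by (simp only: pos_divide_le_eq)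
      then have "1 \<le> (1 + 1 / real m) * (real p / real q) * t / y" using yp by (simp only: pos_le_divide_eq mult_1)
      moreover have "a * b * c / d = a * (b * c / d)" for a b c d :: real by simp
      ultimately show "1 \<le> (1 + 1 / real m) * th0" unfolding th0_def by metis
      show "real p / real q * v 0 = th0 * y" using v(1) yp unfolding is_chain_def th0_def by simp
    qed
    have new: "lab x \<noteq> Suc c" if "x \<in> Q" for x using th[OF that] by simp
    show thesis
      by (rule that[of y 0 p q "\<theta>(Suc c := th0)" "Suc c"]) (use y pq(1,2) th0 new False in auto)
  qed
  define v' where "v' = v(Suc r := real p / real q * v j)"
  define lab' where "lab' = lab(y := l)"
  have same: "lab' z = lab z" if "z \<in> Q" for z using that y unfolding lab'_def by auto
  have "v' ` {1..Suc r} = insert (v' (Suc r)) (v' ` {1..r})" by (auto simp: atLeastAtMostSuc_conv)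
  also have "v' ` {1..r} = v ` {1..r}" unfolding v'_def by auto
  also have "v ` {1..r} = (\<lambda>x. \<theta>' (lab' x) * x) ` Q" unfolding v(2) using same same_th by (auto simp: image_iff)
  finally have "v' ` {1..Suc r} = (\<lambda>x. \<theta>' (lab' x) * x) ` insert y Q" unfolding v'_def using val by (simp add: lab'_def)
  moreover have "is_chain B (Suc r) t v'" unfolding v'_def by (rule is_chain_extend[OF v(1) jpq])
  moreover have "v' 1 = \<theta>' (lab' \<tau>) * \<tau>" using v(3) r1 same[OF Q(3)] same_th[OF Q(3)] unfolding v'_def by simp
  moreover have "insert y Q \<subseteq> R" "card (insert y Q) = Suc r" "\<tau> \<in> insert y Q" using y Q finQ by auto
  moreover have "\<theta>' (lab' z) \<le> 1 \<and> 1 \<le> (1 + 1 / real m) * \<theta>' (lab' z) \<and> lab' z \<le> l" if "z \<in> insert y Q" for z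
    using that th[of z] same[of z] same_th[of z] lth by (auto simp: lab'_def)
  moreover have "lab' a = lab' b" if ab: "a \<in> insert y Q" "b \<in> insert y Q" "aligned B a b" for a b
  proof -
    have "lab' b = l" if "a = y" "b \<in> Q" using cl'[OF that(2) y] same that ab aligned_sym by auto
    moreover have "lab' a = l" if "b = y" "a \<in> Q" using cl'[OF that(2) y] same that ab by auto
    moreover have "lab' a = lab' b" if "a \<in> Q" "b \<in> Q" using al same that ab by auto
    ultimately show ?thesis using ab by (auto simp: lab'_def)
  qed
  moreover have "lab' a = l" if ab: "a \<in> insert y Q" "b \<in> R - insert y Q" "aligned B a b" for a b
    using ab cl'[of a b] same[of a] by (auto simp: lab'_def)
  ultimately have "partial_chain R \<tau> t m B (Suc r) (insert y Q) v' lab' \<theta>' l"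
    unfolding partial_chain_def by (intro conjI ballI impI) blast+
  then show ?case by blast
qed

text \<open>Class \<open>l\<close> starts at \<open>\<tau> * (1 + 1 / m) ^ l\<close>, and the growth
  hypothesis lets \<open>L\<close> classes reach \<open>m * \<tau>\<close>. Representatives are
  minima of their classes, hence members of \<open>S\<close>, so passing to them can only remove
  lattices. The last class may extend beyond \<open>m * \<tau>\<close>, which is why
  \<open>R\<close> is cut off there.\<close>

lemma class_representatives:
  assumes S: "finite S" "\<tau> \<in> S" "\<forall>x\<in>S. \<tau> \<le> x" "\<tau> > 0" and m: "m \<ge> 1" "L \<ge> 1" and L: "real m \<le> (1 + 1 / real m) ^ L"
  shows "\<exists>R \<subseteq> S. card R \<le> L \<and> \<tau> \<in> R \<and> (\<forall>x\<in>R. x \<le> real m * \<tau>) \<and>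
    (\<forall>x\<in>S. x < real m * \<tau> \<longrightarrow> (\<exists>y\<in>R. y \<le> x \<and> x \<le> (1 + 1 / real m) * y))"
proof -
  let ?g = "1 + 1 / real m"
  define cls where "cls x = (LEAST l. x < \<tau> * ?g ^ Suc l)" for x
  define S' where "S' = {x\<in>S. x < \<tau> * ?g ^ L}"
  have g: "?g > 1" using m by simp
  have ex: "cls x < L" "x < \<tau> * ?g ^ Suc (cls x)" "\<tau> * ?g ^ cls x \<le> x" if "x \<in> S'" for x
  proof -
    have L0: "L \<noteq> 0" using that S unfolding S'_def by (intro notI) auto
    then have "x < \<tau> * ?g ^ Suc (L - 1)" using that unfolding S'_def by simp
    then show "x < \<tau> * ?g ^ Suc (cls x)" unfolding cls_def by (rule LeastI)
    have "cls x \<le> L - 1" unfolding cls_def by (rule Least_le) fact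
    then show "cls x < L" using L0 by simp
    show "\<tau> * ?g ^ cls x \<le> x"
    proof (cases "cls x")
      case 0
      then show ?thesis using S that unfolding S'_def by simp
    next
      case (Suc l)
      then show ?thesis using not_less_Least[of l "\<lambda>l. x < \<tau> * ?g ^ Suc l"] unfolding cls_def by (simp add: not_less)
    qed
  qed
  define rep where "rep l = Min {x\<in>S'. cls x = l}" for l
  define R where "R = (\<lambda>x. rep (cls x)) ` S' \<inter> {x. x \<le> real m * \<tau>}"
  have fin: "finite {x\<in>S'. cls x = l}" for l using S unfolding S'_def by simp
  have rep: "rep (cls x) \<in> S'" "cls (rep (cls x)) = cls x" "rep (cls x) \<le> x" if "x \<in> S'" for x
  proof -
    have "rep (cls x) \<in> {y\<in>S'. cls y = cls x}" unfolding rep_def by (rule Min_in[OF fin]) (use that in auto)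
    then show "rep (cls x) \<in> S'" "cls (rep (cls x)) = cls x" by auto
    show "rep (cls x) \<le> x" unfolding rep_def by (rule Min_le[OF fin]) (use that in auto)
  qed
  have "R \<subseteq> S" using rep unfolding R_def S'_def by auto
  moreover have "card R \<le> L"
  proof -
    have "R \<subseteq> rep ` {..<L}" unfolding R_def using ex by auto
    then have "card R \<le> card (rep ` {..<L})" by (intro card_mono) auto
    also have "\<dots> \<le> L" using card_image_le[of "{..<L}" rep] by simp
    finally show ?thesis .
  qed
  moreover have mS: "x \<in> S'" if "x \<in> S" "x < real m * \<tau>" for x
    using that L S unfolding S'_def by (smt (verit) mem_Collect_eq mult.commute mult_right_mono)
  moreover have "\<tau> \<in> R"
  proof -
    have "1 * \<tau> \<le> real m * \<tau>" using m S by (intro mult_right_mono) auto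
    moreover have "\<tau> \<in> S'"
    proof -
      have "1 < ?g ^ L" using g m by (intro one_less_power) auto
      then have "\<tau> * 1 < \<tau> * ?g ^ L" using S by (intro mult_strict_left_mono) auto
      then show ?thesis using S unfolding S'_def by simp
    qed
    ultimately show ?thesis using rep[of \<tau>] S unfolding R_def S'_def by (force simp: image_iff)
  qed
  moreover have "\<exists>y\<in>R. y \<le> x \<and> x \<le> ?g * y" if x: "x \<in> S" "x < real m * \<tau>" for x
  proof -
    have x': "x \<in> S'" using mS x by blast
    have "x \<le> ?g * (\<tau> * ?g ^ cls x)" using ex(2)[OF x'] by (simp add: algebra_simps)
    also have "\<dots> \<le> ?g * rep (cls x)" using ex(3)[OF rep(1)[OF x']] rep(2)[OF x'] g by (intro mult_left_mono) auto
    finally show ?thesis using rep(3)[OF x'] x x' unfolding R_def by force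
  qed
  ultimately show ?thesis unfolding R_def by (intro exI[of _ R]) (auto simp: R_def)
qed

text \<open>An entry at index \<open>k\<close> is \<open>t\<close> times at most \<open>k\<close>
  fractions between \<open>1 / B\<close> and \<open>B\<close>. These crude bounds decide how many
  multiples must be counted and how long a membership test may take.\<close>

lemma is_chain_bounds:
  assumes "is_chain B L t v" "t > 0" "k \<le> L"
  shows "t / real B ^ k \<le> v k \<and> v k \<le> t * real B ^ k \<and> v k > 0"
  using assms(3)
proof (induction k rule: less_induct)
  case (less k)
  show ?case
  proof (cases k)
    case 0
    then show ?thesis using assms by (simp add: is_chain_def)
  next
    case (Suc k')
    then obtain j p q where j: "j \<le> k'" "p \<in> {1..B}" "q \<in> {1..B}" "v k = real p / real q * v j"
      using assms(1) less.prems unfolding is_chain_def by (metis Suc_le_eq)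
    have ih: "t / real B ^ j \<le> v j" "v j \<le> t * real B ^ j" "v j > 0" using less.IH[of j] j Suc less.prems by auto
    have B: "real B \<ge> 1" using j by auto
    have pw: "real B ^ j \<le> real B ^ k'" using B j by (intro power_increasing) auto
    have pq: "real p / real q \<le> real B" "1 / real B \<le> real p / real q" "real p / real q > 0"
    proof -
      have "real p / real q \<le> real B / 1" using j by (intro frac_le) auto
      then show "real p / real q \<le> real B" by simp
      show "1 / real B \<le> real p / real q" using j by (intro frac_le) auto
      show "real p / real q > 0" using j by auto
    qed
    have "v k \<le> real B * (t * real B ^ j)" unfolding j(4) using pq ih by (intro mult_mono) auto
    also have "\<dots> \<le> real B * (t * real B ^ k')" using B pw assms(2) by (intro mult_left_mono) auto
    finally have 1: "v k \<le> t * real B ^ k" using Suc by (simp add: algebra_simps)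
    have "t / real B ^ k' \<le> t / real B ^ j" using pw B assms(2) by (intro divide_left_mono) auto
    then have "1 / real B * (t / real B ^ k') \<le> v k" unfolding j(4) using pq ih assms(2) B
      by (intro mult_mono) auto
    then have 2: "t / real B ^ k \<le> v k" using Suc by simp
    have "v k > 0" unfolding j(4) using pq(3) ih(3) by (rule mult_pos_pos)
    then show ?thesis using 1 2 by simp
  qed
qed

lemma dens_UN_le:
  assumes "finite I" "\<And>i. i \<in> I \<Longrightarrow> finite (S i)" "\<And>i w. i \<in> I \<Longrightarrow> w \<in> S i \<Longrightarrow> w > 0"
  shows "dens (\<Union>i\<in>I. S i) \<le> (\<Sum>i\<in>I. dens (S i))"
  using assms
proof (induction I rule: finite_induct)
  case (insert i I)
  have "dens (S i \<union> (\<Union>i\<in>I. S i)) \<le> dens (S i) + dens (\<Union>i\<in>I. S i)"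
    using insert by (intro dens_Un_le) auto
  moreover have "dens (\<Union>i\<in>I. S i) \<le> (\<Sum>i\<in>I. dens (S i))" using insert.IH insert.prems by blast
  ultimately show ?case using insert.hyps by simp
qed (simp add: dens_empty)

lemma dens_nonneg: "finite S \<Longrightarrow> \<forall>w\<in>S. w > 0 \<Longrightarrow> dens S \<ge> 0"
  using dens_mono[of "{}" S] by (simp add: dens_empty lat_def)

text \<open>In the last clause one factor \<open>1 + 1 / m\<close> pays for moving to the class
  minimum and the other for the scaling of its component. The condition
  \<open>L ^ 2 * m \<le> B\<close> keeps the total overlap between components below
  \<open>1 / (m * \<tau>)\<close>.\<close>

lemma approximating_chain:
  assumes S: "finite S" "\<tau> \<in> S" "\<forall>x\<in>S. \<tau> \<le> x" "\<tau> > 0"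
    and m: "m \<ge> 1" "L \<ge> 1" "real m \<le> (1 + 1 / real m) ^ L" "m ^ 6 \<le> B" "L ^ 2 * m \<le> B"
    and t: "t > 0" "t \<le> real m ^ 2 * \<tau>" "\<tau> \<le> real m ^ 2 * t"
  shows "\<exists>v. is_chain B L t v \<and> dens (v ` {1..L}) \<le> (1 + 1 / real m) * (dens S + 1 / (real m * \<tau>)) \<and>
    v 1 \<le> \<tau> \<and> \<tau> \<le> (1 + 1 / real m) * v 1 \<and>
    (\<forall>x\<in>S. x < real m * \<tau> \<longrightarrow> (\<exists>k\<in>{1..L}. v k \<le> x \<and> x \<le> (1 + 1 / real m) ^ 2 * v k))"
proof -
  let ?g = "1 + 1 / real m"
  have g: "?g \<ge> 1" by simp
  have B: "B \<ge> 1" using m by (metis le_trans one_le_power)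
  obtain R where R: "R \<subseteq> S" "card R \<le> L" "\<tau> \<in> R" "\<forall>x\<in>R. x \<le> real m * \<tau>"
      "\<forall>x\<in>S. x < real m * \<tau> \<longrightarrow> (\<exists>y\<in>R. y \<le> x \<and> x \<le> ?g * y)"
    using class_representatives[OF S m(1,2,3)] by blast
  have finR: "finite R" using R S finite_subset by blast
  have posS: "\<forall>x\<in>S. x > 0" using S by force
  have posR: "\<forall>x\<in>R. x > 0" using posS R by blast
  have approx: "\<exists>p\<in>{1..B}. \<exists>q\<in>{1..B}. real p / real q \<le> x / t \<and> x / t \<le> ?g * (real p / real q)" if x: "x \<in> R" for x
  \<comment> \<open>The ratio \<open>x / t\<close> lies between \<open>1 / m ^ 2\<close> and
    \<open>m ^ 3\<close>. With denominator \<open>m ^ 3\<close> the numerator is at least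
    \<open>m\<close> and at most \<open>m ^ 6\<close>, whence the condition
    \<open>m ^ 6 \<le> B\<close>.\<close>
  proof (rule rational_round_down[of m "m ^ 3"])
    have "m ^ 3 \<le> m ^ 6" using m by (intro power_increasing) auto
    then show "m ^ 3 \<le> B" using m by linarith
    have "t \<le> real m ^ 2 * x" using t R S x by (smt (verit) mult_left_mono subsetD zero_le_power2)
    then show "real m / real (m ^ 3) \<le> x / t" using m t by (simp add: field_simps power2_eq_square power3_eq_cube)
    have "x * real m ^ 3 \<le> (real m * (real m ^ 2 * t)) * real m ^ 3"
    proof (rule mult_right_mono)
      have "real m * \<tau> \<le> real m * (real m ^ 2 * t)" using t by (intro mult_left_mono) auto
      then show "x \<le> real m * (real m ^ 2 * t)" using R(4) x by force
    qed simp
    also have "\<dots> = real (m ^ 6) * t" by (simp add: power_numeral_reduce)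
    also have "\<dots> \<le> real B * t" by (rule mult_right_mono[OF of_nat_mono[OF m(4)] less_imp_le[OF t(1)]])
    finally show "x / t * real (m ^ 3) \<le> real B" using t by (simp add: field_simps)
  qed (use m in auto)
  have R1: "1 \<le> card R" using R finR by (metis One_nat_def Suc_leI card_gt_0_iff empty_iff)
  obtain v lab \<theta> where v: "is_chain B (card R) t v" "v ` {1..card R} = (\<lambda>x. \<theta> (lab x) * x) ` R"
      "v 1 = \<theta> (lab \<tau>) * \<tau>"
    and th: "\<And>x. x \<in> R \<Longrightarrow> \<theta> (lab x) \<le> 1 \<and> 1 \<le> ?g * \<theta> (lab (x::real)::nat)"
    and al: "\<And>x y. x \<in> R \<Longrightarrow> y \<in> R \<Longrightarrow> aligned B x y \<Longrightarrow> lab x = lab y"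
  proof -
    obtain Q v lab \<theta> c where "partial_chain R \<tau> t m B (card R) Q v lab \<theta> c"
      using component_chain[OF finR R(3) posR t(1) m(1) approx R1 order.refl] by blast
    then have Q: "Q \<subseteq> R" "card Q = card R" "is_chain B (card R) t v"
      "v ` {1..card R} = (\<lambda>x. \<theta> (lab x) * x) ` Q" "v 1 = \<theta> (lab \<tau>) * \<tau>"
      "\<forall>x\<in>Q. \<theta> (lab x) \<le> 1 \<and> 1 \<le> ?g * \<theta> (lab x) \<and> lab x \<le> c"
      "\<forall>x\<in>Q. \<forall>y\<in>Q. aligned B x y \<longrightarrow> lab x = lab y"
      unfolding partial_chain_def by simp_all
    have "Q = R" using Q(1,2) finR card_subset_eq by blast
    then show thesis using Q(3-7) by (intro that[of v \<theta> lab]) simp_all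
  qed
  obtain v' where v': "is_chain B L t v'" "v' ` {1..L} = v ` {1..card R}" "v' 1 = v 1"
    using is_chain_pad[OF v(1) R1 B R(2)] by blast
  let ?S = "\<lambda>i. {x\<in>R. lab x = i}"
  have thp: "\<theta> (lab x) > 0" if "x \<in> R" for x
  proof (rule ccontr)
    assume "\<not> \<theta> (lab x) > 0"
    then have "?g * \<theta> (lab x) \<le> 0" using g by (intro mult_nonneg_nonpos) auto
    then show False using th[OF that] by linarith
  qed
  have eq: "v' ` {1..L} = (\<Union>i\<in>lab ` R. (*) (\<theta> i) ` ?S i)" unfolding v'(2) v(2)
    by (auto simp: image_iff) metis
  \<comment> \<open>Whatever coincidences the different factors create or destroy, the union has at
    most the summed density.\<close>
  have "dens (v' ` {1..L}) \<le> (\<Sum>i\<in>lab ` R. dens ((*) (\<theta> i) ` ?S i))"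
    unfolding eq by (rule dens_UN_le) (use finR posR thp in auto)
  also have "\<dots> \<le> (\<Sum>i\<in>lab ` R. ?g * dens (?S i))"
  proof (rule sum_mono)
    fix i assume "i \<in> lab ` R"
    then have i: "\<theta> i > 0" "1 \<le> ?g * \<theta> i" using thp th by auto
    have "dens ((*) (\<theta> i) ` ?S i) = dens (?S i) / \<theta> i" by (rule dens_scale) (use finR posR i in auto)
    also have "\<dots> \<le> ?g * dens (?S i)"
    proof -
      have "dens (?S i) * 1 \<le> dens (?S i) * (?g * \<theta> i)" using i finR posR by (intro mult_left_mono dens_nonneg) auto
      then show ?thesis using i by (simp add: field_simps)
    qed
    finally show "dens ((*) (\<theta> i) ` ?S i) \<le> ?g * dens (?S i)" .
  qed
  also have "\<dots> = ?g * (\<Sum>i\<in>lab ` R. dens (?S i))" by (simp add: sum_distrib_left)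
  also have "\<dots> \<le> ?g * (dens R + real (card R) ^ 2 / (real B * \<tau>))"
    by (intro mult_left_mono sum_dens_components_le[OF finR _ S(4) B al]) (use R S in auto)
  also have "\<dots> \<le> ?g * (dens S + 1 / (real m * \<tau>))"
  proof (intro mult_left_mono add_mono)
    show "dens R \<le> dens S" by (rule dens_mono) (use finR posR S posS R in \<open>auto simp: lat_def\<close>)
    have "real (card R ^ 2 * m) \<le> real (L ^ 2 * m)" using R(2) by (intro of_nat_mono mult_right_mono power_mono) auto
    also have "\<dots> \<le> real B" using m(5) by (simp only: of_nat_le_iff)
    finally have "real (card R) ^ 2 * real m \<le> real B" by simp
    then have "real (card R) ^ 2 * real m * \<tau> \<le> real B * \<tau>" using S by (intro mult_right_mono) auto
    then show "real (card R) ^ 2 / (real B * \<tau>) \<le> 1 / (real m * \<tau>)" using S m B by (simp add: field_simps)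
  qed (use g in auto)
  finally have d: "dens (v' ` {1..L}) \<le> ?g * (dens S + 1 / (real m * \<tau>))" .
  have scaled: "\<theta> (lab y) * y \<le> y" "y \<le> ?g * (\<theta> (lab y) * y)" if "y \<in> R" for y
  proof -
    have "\<theta> (lab y) * y \<le> 1 * y" "1 * y \<le> (?g * \<theta> (lab y)) * y"
      using th[OF that] posR that by (auto intro!: mult_right_mono)
    then show "\<theta> (lab y) * y \<le> y" "y \<le> ?g * (\<theta> (lab y) * y)" by (simp_all only: mult.assoc mult_1)
  qed
  have "\<exists>k\<in>{1..L}. v' k \<le> x \<and> x \<le> ?g ^ 2 * v' k" if x: "x \<in> S" "x < real m * \<tau>" for x
  proof -
    obtain y where y: "y \<in> R" "y \<le> x" "x \<le> ?g * y" using R(5) x by blast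
    have "\<theta> (lab y) * y \<in> v' ` {1..L}" unfolding v'(2) v(2) using y by blast
    then obtain k where k: "k \<in> {1..L}" "v' k = \<theta> (lab y) * y" by force
    have "?g * y \<le> ?g * (?g * v' k)" using scaled(2)[OF y(1)] k g by (intro mult_left_mono) auto
    then have "x \<le> ?g ^ 2 * v' k" using y by (simp add: power2_eq_square)
    then show ?thesis using k y scaled(1)[OF y(1)] by (intro bexI[of _ k]) auto
  qed
  then show ?thesis using v'(1,3) d v(3) scaled[OF R(3)] by (intro exI[of _ v']) auto
qed

section \<open>Evaluating a chain\<close>

text \<open>A commodity that prefers its unconstrained optimum to all offers places private joint orders,
  which cost at most \<open>k0 / w\<close> in the long run.\<close>

definition choice :: "real \<Rightarrow> real \<Rightarrow> real \<Rightarrow> real set \<Rightarrow> real \<Rightarrow> real \<Rightarrow> bool" where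
  "choice k0 k h cs w c \<longleftrightarrow>
    (w \<in> cs \<and> c = eoq_cost k h w \<or> w = sqrt (k / h) \<and> c = eoq_cost k h w + k0 / w) \<and>
    (\<forall>x\<in>cs. c \<le> eoq_cost k h x) \<and> c \<le> eoq_cost k h (sqrt (k / h)) + k0 / sqrt (k / h)"

text \<open>Intervals whose orders all fall on order times of the chain, so that choosing one adds
  no joint order. The multiples of \<open>v 1\<close> serve the long intervals.\<close>

definition offers :: "nat \<Rightarrow> nat \<Rightarrow> (nat \<Rightarrow> real) \<Rightarrow> real set" where
  "offers L X v = v ` {1..L} \<union> (\<lambda>l. real l * v 1) ` {1..X}"

text \<open>A relation rather than a function: ties leave \<open>W\<close> open, and so are its
  values outside \<open>{1..n}\<close>. The estimate \<open>e\<close> charges private orders in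
  full, without crediting coincidences.\<close>

definition outcome :: "(nat \<Rightarrow> real) \<Rightarrow> (nat \<Rightarrow> real) \<Rightarrow> nat \<Rightarrow> nat \<Rightarrow> nat \<Rightarrow> nat \<Rightarrow> (nat \<Rightarrow> real) \<Rightarrow>
    (nat \<Rightarrow> real) \<Rightarrow> real \<Rightarrow> bool" where
  "outcome K H n L X A v W e \<longleftrightarrow>
    (\<exists>c. (\<forall>i\<in>{1..n}. choice (K 0) (K i) (H i) (offers L X v) (W i) (c i)) \<and>
      e = K 0 * dens_est v L A + (\<Sum>i=1..n. c i))"

text \<open>Every multiple of the first entry is fresh. The bound serves to turn the absolute error
  of the estimate into a relative one.\<close>

lemma dens_est_ge:
  assumes "L \<ge> 1" "A \<ge> 1" "\<forall>k\<in>{1..L}. v k > 0"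
  shows "1 / v 1 \<le> dens_est v L A"
proof -
  have "real (card (fresh v 0 A)) / (real A * v (Suc 0)) \<le> dens_est v L A" unfolding dens_est_def
    by (rule member_le_sum) (use assms in \<open>auto simp: less_imp_le\<close>)
  moreover have "fresh v 0 A = {1..A}" by (auto simp: fresh_def lat_def)
  ultimately show ?thesis using assms by simp
qed

text \<open>All entries are at least \<open>t / B ^ L\<close> while \<open>v 1 \<le> t * B\<close>,
  so this size of \<open>A\<close> pushes the absolute error below \<open>1 / (m * v 1)\<close>.
  Density and estimate are both at least \<open>1 / v 1\<close>, which makes the error relative in
  both directions.\<close>

lemma dens_est_dens:
  assumes ch: "is_chain B L t v" "t > 0" and m: "m \<ge> 1" "L \<ge> 1" "B \<ge> 1"
    and A: "2 ^ (L + 2) * m * B ^ (2 * L) \<le> A"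
  shows "dens (v ` {1..L}) \<le> (1 + 1 / real m) * dens_est v L A"
    and "dens_est v L A \<le> (1 + 1 / real m) * dens (v ` {1..L})"
proof -
  have A1: "A \<ge> 1"
  proof -
    have "0 < 2 ^ (L + 2) * m * B ^ (2 * L)" using m by simp
    then show ?thesis using A by linarith
  qed
  have pos: "\<forall>k\<in>{1..L}. v k > 0" using is_chain_bounds[OF ch] by auto
  define u where "u = t / real B ^ L"
  have u: "u > 0" unfolding u_def using m ch by simp
  have low: "\<forall>k\<in>{1..L}. u \<le> v k"
  proof
    fix k assume k: "k \<in> {1..L}"
    have "u \<le> t / real B ^ k" unfolding u_def using k m ch by (intro divide_left_mono power_increasing) auto
    then show "u \<le> v k" using is_chain_bounds[OF ch, of k] k by auto
  qed
  have ap: "\<bar>dens_est v L A - dens (v ` {1..L})\<bar> \<le> 2 ^ (L + 2) / (real A * u)"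
    by (rule dens_est_approx[OF pos low u A1])
  have v1: "v 1 \<le> t * real B" "v 1 > 0" using is_chain_bounds[OF ch, of 1] m by auto
  have "2 ^ (L + 2) / (real A * u) \<le> 1 / (real m * v 1)"
  proof -
    have "2 ^ (L + 2) * (real m * v 1) \<le> 2 ^ (L + 2) * (real m * (t * real B))" using v1 by (intro mult_left_mono) auto
    also have "\<dots> = (2 ^ (L + 2) * real m * (real B ^ L * real B)) * u" unfolding u_def using m by simp
    also have "\<dots> \<le> (2 ^ (L + 2) * real m * (real B ^ L * real B ^ L)) * u"
    proof (intro mult_right_mono mult_left_mono)
      show "real B \<le> real B ^ L" using m self_le_power[of "real B" L] by simp
    qed (use u in simp_all)
    also have "\<dots> = real (2 ^ (L + 2) * m * B ^ (2 * L)) * u"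
      by (simp only: of_nat_mult of_nat_power of_nat_numeral mult_2 power_add)
    also have "\<dots> \<le> real A * u" by (rule mult_right_mono[OF of_nat_mono[OF A] less_imp_le[OF u]])
    finally show ?thesis using m v1 A1 u by (simp add: field_simps)
  qed
  then have close: "\<bar>dens_est v L A - dens (v ` {1..L})\<bar> \<le> 1 / v 1 / real m" using ap by (simp add: mult.commute)
  have "1 / v 1 \<le> dens_est v L A" by (rule dens_est_ge[OF m(2) A1 pos])
  then have "1 / v 1 / real m \<le> dens_est v L A / real m" by (intro divide_right_mono) auto
  then show "dens (v ` {1..L}) \<le> (1 + 1 / real m) * dens_est v L A" using close by (simp add: algebra_simps)
  have "1 / v 1 \<le> dens (v ` {1..L})" by (rule dens_ge_member) (use pos m in auto)
  then have "1 / v 1 / real m \<le> dens (v ` {1..L}) / real m" by (intro divide_right_mono) auto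
  then show "dens_est v L A \<le> (1 + 1 / real m) * dens (v ` {1..L})" using close by (simp add: algebra_simps)
qed

lemma offers_mults: "L \<ge> 1 \<Longrightarrow> w \<in> offers L X v \<Longrightarrow> mults w \<subseteq> lat (v ` {1..L})"
proof -
  assume L: "L \<ge> 1" and w: "w \<in> offers L X v"
  have "mults (real l * v 1) \<subseteq> mults (v 1)" if "l \<ge> 1" for l
  proof
    fix x assume "x \<in> mults (real l * v 1)"
    then obtain a where "a \<ge> 1" "x = real a * (real l * v 1)" unfolding in_mults_iff by metis
    then have "x = real (a * l) * v 1" "a * l \<ge> 1" using that by auto
    then show "x \<in> mults (v 1)" unfolding in_mults_iff by blast
  qed
  then show ?thesis using L w unfolding offers_def lat_def by fastforce
qed

text \<open>Commodities that accept an offer order only at times of the chain. Each of the others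
  adds at most \<open>1 / W i\<close> to the density by the union bound, and \<open>choice\<close>
  has charged exactly that. Hence only the estimated density of the chain calls for the extra
  factor.\<close>

lemma outcome_sound:
  assumes inst: "jrp_instance n K H" and ch: "is_chain B L t v" "t > 0" and m: "m \<ge> 1" "L \<ge> 1" "B \<ge> 1"
    and A: "2 ^ (L + 2) * m * B ^ (2 * L) \<le> A" and o: "outcome K H n L X A v W e"
  shows "policy n W" "total_cost n K H W \<le> (1 + 1 / real m) * e"
proof -
  have n: "n \<ge> 1" and K0: "K 0 > 0" and KH: "\<And>i. i \<in> {1..n} \<Longrightarrow> K i > 0 \<and> H i > 0"
    using inst unfolding jrp_instance_def by auto
  obtain c where c: "\<And>i. i \<in> {1..n} \<Longrightarrow> choice (K 0) (K i) (H i) (offers L X v) (W i) (c i)"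
    and e: "e = K 0 * dens_est v L A + (\<Sum>i=1..n. c i)" using o unfolding outcome_def by blast
  have vpos: "v k > 0" if "k \<le> L" for k using is_chain_bounds[OF ch that] by blast
  have cpos: "w > 0" if "w \<in> offers L X v" for w
    using that vpos m unfolding offers_def by auto
  define P where "P = {i\<in>{1..n}. \<not> (W i \<in> offers L X v \<and> c i = eoq_cost (K i) (H i) (W i))}"
  have P: "W i = sqrt (K i / H i)" "c i = eoq_cost (K i) (H i) (W i) + K 0 / W i" if "i \<in> P" for i
    using that c[of i] unfolding P_def choice_def by auto
  have Wpos: "W i > 0" if "i \<in> {1..n}" for i
    using P[of i] KH[OF that] cpos that unfolding P_def by (cases "i \<in> P") (auto simp: P_def)
  then show pol: "policy n W" unfolding policy_def by blast
  have fP: "finite P" unfolding P_def by simp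
  let ?V = "v ` {1..L}"
  have "dens (W ` {1..n}) \<le> dens (?V \<union> W ` P)"
  proof (rule dens_mono)
    show "lat (W ` {1..n}) \<subseteq> lat (?V \<union> W ` P)"
    proof
      fix x assume "x \<in> lat (W ` {1..n})"
      then obtain i where i: "i \<in> {1..n}" "x \<in> mults (W i)" unfolding lat_def by auto
      show "x \<in> lat (?V \<union> W ` P)"
      proof (cases "i \<in> P")
        case True
        then show ?thesis using i unfolding lat_def by auto
      next
        case False
        then have "W i \<in> offers L X v" using i unfolding P_def by auto
        then show ?thesis using offers_mults[OF m(2)] i unfolding lat_Un by blast
      qed
    qed
  qed (use Wpos vpos fP in \<open>auto simp: P_def\<close>)
  also have "\<dots> \<le> dens ?V + dens (W ` P)"
    by (rule dens_Un_le) (use Wpos vpos fP in \<open>auto simp: P_def\<close>)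
  also have "dens (W ` P) \<le> (\<Sum>w\<in>W ` P. 1 / w)"
    by (rule dens_le_sum) (use Wpos fP in \<open>auto simp: P_def\<close>)
  also have "\<dots> \<le> (\<Sum>i\<in>P. 1 / W i)"
    using sum_image_le[OF fP, of "\<lambda>w. 1 / w" W] Wpos unfolding P_def by (simp add: less_imp_le o_def)
  finally have d: "dens (W ` {1..n}) \<le> dens ?V + (\<Sum>i\<in>P. 1 / W i)" by simp
  have "joint_cost n (K 0) W \<le> K 0 * (dens ?V + (\<Sum>i\<in>P. 1 / W i))"
    unfolding joint_cost_eq_dens[OF pol n] using d K0 by simp
  also have "\<dots> \<le> K 0 * ((1 + 1 / real m) * dens_est v L A) + (\<Sum>i\<in>P. K 0 / W i)"
    using dens_est_dens(1)[OF ch m A] K0 by (simp add: distrib_left sum_distrib_left)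
  finally have J: "joint_cost n (K 0) W \<le> (1 + 1 / real m) * (K 0 * dens_est v L A) + (\<Sum>i\<in>P. K 0 / W i)"
    by (simp add: algebra_simps)
  have "(\<Sum>i=1..n. c i) = (\<Sum>i=1..n. eoq_cost (K i) (H i) (W i) + (if i \<in> P then K 0 / W i else 0))"
  proof (rule sum.cong)
    fix i assume "i \<in> {1..n}"
    then show "c i = eoq_cost (K i) (H i) (W i) + (if i \<in> P then K 0 / W i else 0)"
      using P(2)[of i] unfolding P_def by (cases "W i \<in> offers L X v \<and> c i = eoq_cost (K i) (H i) (W i)") simp_all
  qed simp
  also have "\<dots> = (\<Sum>i=1..n. eoq_cost (K i) (H i) (W i)) + (\<Sum>i\<in>P. K 0 / W i)"
  proof -
    have "P \<subseteq> {1..n}" unfolding P_def by auto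
    then have "{1..n} \<inter> P = P" by auto
    then show ?thesis by (simp add: sum.distrib sum.If_cases)
  qed
  finally have C: "(\<Sum>i=1..n. c i) = (\<Sum>i=1..n. eoq_cost (K i) (H i) (W i)) + (\<Sum>i\<in>P. K 0 / W i)" .
  have "0 \<le> (\<Sum>i=1..n. c i)"
    unfolding C by (intro add_nonneg_nonneg sum_nonneg) (use eoq_cost_pos KH Wpos K0 in \<open>auto simp: less_imp_le P_def\<close>)
  then have "(\<Sum>i=1..n. c i) \<le> (1 + 1 / real m) * (\<Sum>i=1..n. c i)" by (simp add: mult_le_cancel_right1)
  then show "total_cost n K H W \<le> (1 + 1 / real m) * e"
    using J C unfolding total_cost_def e by (simp add: distrib_left)
qed

text \<open>Since \<open>choice\<close> is minimal over all options, exhibiting one good option per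
  commodity is enough.\<close>

lemma outcome_le:
  assumes o: "outcome K H n L X A v W e" and d: "dens_est v L A \<le> D" and K0: "K 0 > 0"
    and b: "\<And>i. i \<in> {1..n} \<Longrightarrow> (\<exists>x\<in>offers L X v. eoq_cost (K i) (H i) x \<le> b i) \<or>
      eoq_cost (K i) (H i) (sqrt (K i / H i)) + K 0 / sqrt (K i / H i) \<le> b i"
  shows "e \<le> K 0 * D + (\<Sum>i=1..n. b i)"
proof -
  obtain c where c: "\<And>i. i \<in> {1..n} \<Longrightarrow> choice (K 0) (K i) (H i) (offers L X v) (W i) (c i)"
    and e: "e = K 0 * dens_est v L A + (\<Sum>i=1..n. c i)" using o unfolding outcome_def by blast
  have "c i \<le> b i" if "i \<in> {1..n}" for i
    using b[OF that] c[OF that] unfolding choice_def by force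
  then have "(\<Sum>i=1..n. c i) \<le> (\<Sum>i=1..n. b i)" by (rule sum_mono)
  moreover have "K 0 * dens_est v L A \<le> K 0 * D" using d K0 by simp
  ultimately show ?thesis unfolding e by linarith
qed

text \<open>The split is at \<open>F = m ^ 2 * K 0 / t\<close>. Above it, joint orders at all
  multiples of \<open>t / m\<close> cost about \<open>F / m\<close>, and every commodity can be
  rounded close to its optimum in the relaxation, whose value is a lower bound for \<open>F\<close>.
  Below it, \<open>balanced_min_interval\<close> with \<open>c = m ^ 2\<close> places the smallest
  interval near \<open>t\<close>, as \<open>approximating_chain\<close> demands.\<close>

lemma good_chain_exists:
  assumes inst: "jrp_instance n K H" and T: "policy n T"
    and m: "m \<ge> 1" "L \<ge> 1" "real m \<le> (1 + 1 / real m) ^ L" "m ^ 6 \<le> B" "L ^ 2 * m \<le> B"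
    and A: "2 ^ (L + 2) * m * B ^ (2 * L) \<le> A" and X: "X = n * m"
  shows "\<exists>j\<in>{1..n}. \<exists>v. is_chain B L (base_time K H n j) v \<and> base_time K H n j > 0 \<and>
    (\<forall>W e. outcome K H n L X A v W e \<longrightarrow> e \<le> (1 + 9 / real m) * total_cost n K H T)"
proof -
  have n: "n \<ge> 1" and K0: "K 0 > 0" and KH: "\<And>i. i \<in> {1..n} \<Longrightarrow> K i > 0 \<and> H i > 0"
    using inst unfolding jrp_instance_def by auto
  have Tp: "\<And>i. i \<in> {1..n} \<Longrightarrow> T i > 0" using T unfolding policy_def by auto
  have B: "B \<ge> 1" using m by (metis le_trans one_le_power)
  have X1: "X \<ge> 1" using X n m by simp
  let ?F = "total_cost n K H T" and ?g = "1 + 1 / real m"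
  obtain j where j: "j \<in> {1..n}" "balanced K H n (base_time K H n j)" using base_time_balanced[OF inst] by blast
  define t where "t = base_time K H n j"
  have bal: "balanced K H n t" and tp: "t > 0" using j unfolding t_def balanced_def by auto
  define x where "x = 1 / real m"
  have x: "0 < x" "x \<le> 1" "real m = 1 / x" unfolding x_def using m by auto
  have x2: "x * x \<le> x" "x * x * x \<le> x" using x
    by (auto simp: mult_le_cancel_right1 mult_le_one)
  have Cpos: "0 \<le> eoq_cost (K i) (H i) (T i)" if "i \<in> {1..n}" for i
    using eoq_cost_pos KH Tp that by (meson less_imp_le)
  have J0: "0 \<le> joint_cost n (K 0) T" using joint_cost_ge[OF T, of 1 "K 0"] n K0 Tp[of 1]
    by (smt (verit) atLeastAtMost_iff divide_nonneg_pos le_refl)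
  have F0: "?F \<ge> 0" unfolding total_cost_def using J0 Cpos by (intro add_nonneg_nonneg sum_nonneg)
  \<comment> \<open>The reason for \<open>X = n * m\<close>: even if all \<open>n\<close>
    commodities order privately beyond \<open>X * u\<close>, together they pay at most the fraction
    \<open>1 / m\<close> of \<open>K 0 / u\<close>.\<close>
  have nX: "real n * (k0 / (real X * u)) = k0 / (real m * u)" for k0 u using n unfolding X by simp
  show ?thesis
  proof (cases "real m ^ 2 * (K 0 / t) \<le> ?F")
    case True
    define v where "v k = (if k = 0 then t else t / real m)" for k :: nat
    have mB: "m \<le> B" using m by (meson le_trans self_le_power zero_less_numeral)
    have ch: "is_chain B L t v"
      unfolding is_chain_def
    proof (intro conjI allI impI)
      fix k
      show "\<exists>j\<le>k. \<exists>p\<in>{1..B}. \<exists>q\<in>{1..B}. v (Suc k) = real p / real q * v j"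
        by (intro exI[of _ 0] conjI bexI[of _ 1] bexI[of _ m]) (use mB m in \<open>auto simp: v_def\<close>)
    qed (simp add: v_def)
    have V: "v ` {1..L} = {t / real m}" using m unfolding v_def by force
    have dh: "dens_est v L A \<le> ?g * (real m / t)"
      using dens_est_dens(2)[OF ch tp m(1,2) B A] dens_singleton[of "t / real m"] tp m unfolding V by simp
    let ?M = "\<lambda>i. max t (sqrt (K i / H i))"
    define b where "b i = ?g * (2 * H i * ?M i) + K 0 / (real X * (t / real m))" for i
    have G: "(\<Sum>i=1..n. 2 * H i * ?M i) \<le> ?F" by (rule total_cost_ge_relaxation[OF inst T bal])
    have "e \<le> (1 + 9 / real m) * ?F" if o: "outcome K H n L X A v W e" for W e
    proof -
      have "e \<le> K 0 * (?g * (real m / t)) + (\<Sum>i=1..n. b i)"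
      proof (rule outcome_le[where b = b, OF o dh K0])
        fix i assume i: "i \<in> {1..n}"
        have M: "eoq_cost (K i) (H i) (?M i) \<le> 2 * H i * ?M i"
        proof -
          have Mp: "?M i > 0" using tp by simp
          have "K i / H i \<le> ?M i ^ 2" using KH[OF i] Mp by (simp add: sqrt_le_D)
          then have "K i \<le> H i * ?M i * ?M i" using KH[OF i] by (simp add: field_simps power2_eq_square)
          then have "K i / ?M i \<le> H i * ?M i" using Mp by (simp add: pos_divide_le_eq)
          then show ?thesis unfolding eoq_cost_def by simp
        qed
        have gm: "?g * eoq_cost (K i) (H i) (?M i) \<le> ?g * (2 * H i * ?M i)" using M by (intro mult_left_mono) auto
        have Kn: "0 \<le> K 0 / (real X * (t / real m))" using K0 tp by simp
        have v1: "v 1 = t / real m" by (simp add: v_def)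
        have "(\<exists>l\<in>{1..X}. eoq_cost (K i) (H i) (real l * (t / real m)) \<le> ?g * eoq_cost (K i) (H i) (?M i)) \<or>
          eoq_cost (K i) (H i) (sqrt (K i / H i)) + K 0 / sqrt (K i / H i)
            \<le> eoq_cost (K i) (H i) (?M i) + K 0 / (real X * (t / real m))"
          by (rule round_to_multiple) (use KH[OF i] K0 tp m X1 in auto)
        then show "(\<exists>x\<in>offers L X v. eoq_cost (K i) (H i) x \<le> b i) \<or>
          eoq_cost (K i) (H i) (sqrt (K i / H i)) + K 0 / sqrt (K i / H i) \<le> b i"
        proof (elim disjE bexE)
          fix l assume l: "l \<in> {1..X}" "eoq_cost (K i) (H i) (real l * (t / real m)) \<le> ?g * eoq_cost (K i) (H i) (?M i)"
          have "real l * (t / real m) \<in> offers L X v" unfolding offers_def v1 using l by blast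
          moreover have "eoq_cost (K i) (H i) (real l * (t / real m)) \<le> b i" unfolding b_def using l gm Kn by linarith
          ultimately show ?thesis by blast
        next
          assume a: "eoq_cost (K i) (H i) (sqrt (K i / H i)) + K 0 / sqrt (K i / H i)
            \<le> eoq_cost (K i) (H i) (?M i) + K 0 / (real X * (t / real m))"
          have "1 * (2 * H i * ?M i) \<le> ?g * (2 * H i * ?M i)"
            using KH[OF i] tp by (intro mult_right_mono) (auto simp: less_imp_le)
          then show ?thesis unfolding b_def using a M by linarith
        qed
      qed
      also have "(\<Sum>i=1..n. b i) = ?g * (\<Sum>i=1..n. 2 * H i * ?M i) + real n * (K 0 / (real X * (t / real m)))"
        unfolding b_def by (simp add: sum.distrib sum_distrib_left)
      also have "real n * (K 0 / (real X * (t / real m))) = K 0 / t" unfolding nX using m by simp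
      finally have "e \<le> K 0 * (?g * (real m / t)) + (?g * (\<Sum>i=1..n. 2 * H i * ?M i) + K 0 / t)" .
      moreover have "a * (g * (b / c)) = g * (a / c * b)" for a b c g :: real by simp
      ultimately have 1: "e \<le> ?g * (K 0 / t * real m) + (?g * (\<Sum>i=1..n. 2 * H i * ?M i) + K 0 / t)"
        by metis
      have xm: "x * real m = 1" unfolding x_def using m by simp
      have "(x * x) * (real m ^ 2 * (K 0 / t)) \<le> (x * x) * ?F" using True x by (intro mult_left_mono) auto
      also have "(x * x) * (real m ^ 2 * (K 0 / t)) = (x * real m) * (x * real m) * (K 0 / t)"
        by (simp only: power2_eq_square ac_simps)
      finally have kt: "K 0 / t \<le> x * x * ?F" unfolding xm by (simp only: mult_1)
      then have "K 0 / t * real m \<le> (x * x * ?F) * real m" by (intro mult_right_mono) auto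
      also have "\<dots> = (x * real m) * (x * ?F)" by (simp only: ac_simps)
      finally have "K 0 / t * real m \<le> x * ?F" unfolding xm by (simp only: mult_1)
      then have "?g * (K 0 / t * real m) \<le> ?g * (x * ?F)" by (intro mult_left_mono) auto
      moreover have "?g * (\<Sum>i=1..n. 2 * H i * ?M i) \<le> ?g * ?F" using G by (intro mult_left_mono) auto
      ultimately have "e \<le> ?g * (x * ?F) + (?g * ?F + x * x * ?F)" using 1 kt by linarith
      also have "\<dots> = (1 + 2 * x + 2 * (x * x)) * ?F" by (simp add: x_def[symmetric] algebra_simps)
      also have "\<dots> \<le> (1 + 9 * x) * ?F" using x x2 F0 by (intro mult_right_mono) auto
      finally show ?thesis by (simp add: x_def)
    qed
    then show ?thesis using j(1) ch tp unfolding t_def by blast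
  next
    case False
    define \<tau> where "\<tau> = Min (T ` {1..n})"
    have tau: "\<tau> \<in> T ` {1..n}" "\<And>i. i \<in> {1..n} \<Longrightarrow> \<tau> \<le> T i"
      unfolding \<tau>_def using n by (auto intro!: Min_in)
    then have taup: "\<tau> > 0" using Tp by auto
    obtain i0 where i0: "i0 \<in> {1..n}" "\<tau> = T i0" using tau by auto
    have rng: "t \<le> real m ^ 2 * \<tau>" "\<tau> \<le> real m ^ 2 * t"
      using balanced_min_interval[OF inst T bal i0(1), of "real m ^ 2"] tau(2) i0 False by auto
    let ?S = "T ` {1..n}"
    have S: "finite ?S" "\<tau> \<in> ?S" "\<forall>x\<in>?S. \<tau> \<le> x" using tau by auto
    obtain v where v: "is_chain B L t v" "dens (v ` {1..L}) \<le> ?g * (dens ?S + 1 / (real m * \<tau>))"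
        "v 1 \<le> \<tau>" "\<tau> \<le> ?g * v 1"
        "\<forall>x\<in>?S. x < real m * \<tau> \<longrightarrow> (\<exists>k\<in>{1..L}. v k \<le> x \<and> x \<le> ?g ^ 2 * v k)"
      using approximating_chain[OF S taup m tp rng] by blast
    have vpos: "v k > 0" if "k \<le> L" for k using is_chain_bounds[OF v(1) tp that] by blast
    have v1p: "v 1 > 0" using vpos m by simp
    have dS: "1 / \<tau> \<le> dens ?S" by (rule dens_ge_member) (use S taup in force)+
    have "1 / (real m * \<tau>) = x * (1 / \<tau>)" by (simp add: x_def)
    also have "\<dots> \<le> x * dens ?S" using dS x by (intro mult_left_mono) auto
    finally have "1 / (real m * \<tau>) \<le> x * dens ?S" .
    then have "?g * (dens ?S + 1 / (real m * \<tau>)) \<le> ?g * (dens ?S + x * dens ?S)" by (intro mult_left_mono) auto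
    then have "dens (v ` {1..L}) \<le> ?g * (?g * dens ?S)" using v(2) by (simp add: x_def algebra_simps)
    then have "?g * dens (v ` {1..L}) \<le> ?g * (?g * (?g * dens ?S))" by (intro mult_left_mono) auto
    \<comment> \<open>The three factors come from the estimate, from the scaling of components, and
      from the overlap term, absorbed by means of \<open>1 / \<tau> \<le> dens ?S\<close>.\<close>
    then have dh: "dens_est v L A \<le> ?g * (?g * (?g * dens ?S))"
      using dens_est_dens(2)[OF v(1) tp m(1,2) B A] by linarith
    let ?C = "\<lambda>i. eoq_cost (K i) (H i) (T i)"
    define b where "b i = ?g ^ 2 * ?C i + K 0 / (real X * v 1)" for i
    have Kn: "0 \<le> K 0 / (real X * v 1)" using K0 v1p by simp
    have g2: "1 \<le> ?g ^ 2" "?g \<le> ?g ^ 2" by (auto simp: self_le_power)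
    have "e \<le> (1 + 9 / real m) * ?F" if o: "outcome K H n L X A v W e" for W e
    proof -
      have "e \<le> K 0 * (?g * (?g * (?g * dens ?S))) + (\<Sum>i=1..n. b i)"
      proof (rule outcome_le[where b = b, OF o dh K0])
        fix i assume i: "i \<in> {1..n}"
        show "(\<exists>x\<in>offers L X v. eoq_cost (K i) (H i) x \<le> b i) \<or>
          eoq_cost (K i) (H i) (sqrt (K i / H i)) + K 0 / sqrt (K i / H i) \<le> b i"
        proof (cases "T i < real m * \<tau>")
          case True
          then obtain k where k: "k \<in> {1..L}" "v k \<le> T i" "T i \<le> ?g ^ 2 * v k" using v(5) i by blast
          have "eoq_cost (K i) (H i) (v k) \<le> ?g ^ 2 * ?C i"
            using eoq_cost_down[OF _ _ _ k(2,3)] KH[OF i] vpos k(1) by auto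
          then have "eoq_cost (K i) (H i) (v k) \<le> b i" unfolding b_def using Kn by linarith
          then show ?thesis using k unfolding offers_def by blast
        next
          case False
          have "real m * v 1 \<le> real m * \<tau>" using v(3) by (intro mult_left_mono) auto
          then have "real m * v 1 \<le> T i" using False by linarith
          then have "(\<exists>l\<in>{1..X}. eoq_cost (K i) (H i) (real l * v 1) \<le> ?g * ?C i) \<or>
            eoq_cost (K i) (H i) (sqrt (K i / H i)) + K 0 / sqrt (K i / H i) \<le> ?C i + K 0 / (real X * v 1)"
            using round_to_multiple[of "K i" "H i" "K 0" "v 1" "real m" "T i" X] KH[OF i] K0 v1p m X1 by auto
          then show ?thesis
          proof (elim disjE bexE)
            fix l assume l: "l \<in> {1..X}" "eoq_cost (K i) (H i) (real l * v 1) \<le> ?g * ?C i"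
            have "real l * v 1 \<in> offers L X v" unfolding offers_def using l(1) by blast
            moreover have "eoq_cost (K i) (H i) (real l * v 1) \<le> b i"
              unfolding b_def using l(2) mult_right_mono[OF g2(2) Cpos[OF i]] Kn by linarith
            ultimately show ?thesis by blast
          next
            assume "eoq_cost (K i) (H i) (sqrt (K i / H i)) + K 0 / sqrt (K i / H i) \<le> ?C i + K 0 / (real X * v 1)"
            then show ?thesis unfolding b_def using mult_right_mono[OF g2(1) Cpos[OF i]] by linarith
          qed
        qed
      qed
      also have "(\<Sum>i=1..n. b i) = ?g ^ 2 * (\<Sum>i=1..n. ?C i) + real n * (K 0 / (real X * v 1))"
        unfolding b_def by (simp add: sum.distrib sum_distrib_left)
      also have "real n * (K 0 / (real X * v 1)) = x * (K 0 / v 1)" unfolding nX by (simp add: x_def)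
      finally have "e \<le> K 0 * (?g * (?g * (?g * dens ?S))) + (?g ^ 2 * (\<Sum>i=1..n. ?C i) + x * (K 0 / v 1))" .
      moreover have "a * (g * (g * (g * d))) = g ^ 3 * (a * d)" for a d g :: real by (simp add: power3_eq_cube)
      ultimately have 1: "e \<le> ?g ^ 3 * (K 0 * dens ?S) + (?g ^ 2 * (\<Sum>i=1..n. ?C i) + x * (K 0 / v 1))"
        by metis
      have J: "joint_cost n (K 0) T = K 0 * dens ?S" by (rule joint_cost_eq_dens[OF T n])
      have "1 / v 1 \<le> ?g / \<tau>" using v(4) v1p taup by (simp add: field_simps)
      also have "\<dots> \<le> ?g * dens ?S" using mult_left_mono[OF dS, of ?g] by simp
      finally have "K 0 * (1 / v 1) \<le> K 0 * (?g * dens ?S)" using K0 by (intro mult_left_mono) auto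
      then have "K 0 / v 1 \<le> ?g * joint_cost n (K 0) T" unfolding J by (simp add: algebra_simps)
      also have "\<dots> \<le> 2 * joint_cost n (K 0) T"
        by (rule mult_right_mono[OF _ J0]) (use x(2) in \<open>simp add: x_def\<close>)
      finally have "x * (K 0 / v 1) \<le> x * (2 * joint_cost n (K 0) T)" using x by (intro mult_left_mono) auto
      \<comment> \<open>For \<open>x \<le> 1\<close> the cube is at most \<open>1 + 7 * x\<close>;
        the private orders add \<open>2 * x\<close>, which makes up the constant 9.\<close>
      moreover have "?g ^ 3 * joint_cost n (K 0) T \<le> (1 + 7 * x) * joint_cost n (K 0) T"
        using J0 x2 by (intro mult_right_mono) (auto simp: x_def[symmetric] power3_eq_cube algebra_simps)
      moreover have "?g ^ 2 * (\<Sum>i=1..n. ?C i) \<le> (1 + 9 * x) * (\<Sum>i=1..n. ?C i)"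
        using Cpos x(1) x2 by (intro mult_right_mono sum_nonneg) (auto simp: x_def[symmetric] power2_eq_square algebra_simps)
      ultimately have "e \<le> (1 + 9 * x) * ?F" using 1 unfolding J[symmetric] total_cost_def
        by (simp add: algebra_simps)
      then show ?thesis by (simp add: x_def)
    qed
    then show ?thesis using j(1) v(1) tp unfolding t_def by blast
  qed
qed

section \<open>Timed total correctness\<close>

fun nat_writes :: "com \<Rightarrow> bank set" where
  "nat_writes Skip = {}"
| "nat_writes (NWrite x a e) = {x}"
| "nat_writes (RWrite x a e) = {}"
| "nat_writes (Seq c c') = nat_writes c \<union> nat_writes c'"
| "nat_writes (Cond b c c') = nat_writes c \<union> nat_writes c'"
| "nat_writes (While b c) = nat_writes c"

fun real_writes :: "com \<Rightarrow> bank set" where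
  "real_writes Skip = {}"
| "real_writes (NWrite x a e) = {}"
| "real_writes (RWrite x a e) = {x}"
| "real_writes (Seq c c') = real_writes c \<union> real_writes c'"
| "real_writes (Cond b c c') = real_writes c \<union> real_writes c'"
| "real_writes (While b c) = real_writes c"

definition frame :: "bank set \<Rightarrow> bank set \<Rightarrow> state \<Rightarrow> state \<Rightarrow> bool" where
  "frame N R s s' \<longleftrightarrow> (\<forall>x. x \<notin> N \<longrightarrow> nmem s' x = nmem s x) \<and> (\<forall>x. x \<notin> R \<longrightarrow> rmem s' x = rmem s x)"

abbreviation com_frame :: "com \<Rightarrow> state \<Rightarrow> state \<Rightarrow> bool" where
  "com_frame c \<equiv> frame (nat_writes c) (real_writes c)"

abbreviation loop_frame :: "bank \<Rightarrow> com \<Rightarrow> state \<Rightarrow> state \<Rightarrow> bool" where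
  "loop_frame x c \<equiv> frame (insert x (nat_writes c)) (real_writes c)"

lemma nmem_nwrite [simp]: "nmem (nwrite x i v s) = (nmem s)(x := (nmem s x)(i := v))"
  and rmem_nwrite [simp]: "rmem (nwrite x i v s) = rmem s"
  and rmem_rwrite [simp]: "rmem (rwrite x i r s) = (rmem s)(x := (rmem s x)(i := r))"
  and nmem_rwrite [simp]: "nmem (rwrite x i r s) = nmem s"
  by (simp_all add: nwrite_def rwrite_def)

lemma exec_frame: "exec c s t s' \<Longrightarrow> com_frame c s s'"
  by (induction rule: exec.induct) (auto simp: frame_def)

text \<open>Step counts enter only as upper bounds, so that they can be rounded up to monomials in
  one size parameter \<open>G\<close> before they are composed.\<close>

definition runs :: "com \<Rightarrow> state \<Rightarrow> nat \<Rightarrow> (state \<Rightarrow> bool) \<Rightarrow> bool" where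
  "runs c s T Q \<longleftrightarrow> (\<exists>t s'. exec c s t s' \<and> t \<le> T \<and> Q s')"

lemma runs_conseq: "runs c s T Q \<Longrightarrow> T \<le> T' \<Longrightarrow> (\<And>s'. Q s' \<Longrightarrow> Q' s') \<Longrightarrow> runs c s T' Q'"
  unfolding runs_def using le_trans by blast

lemma runs_post: "runs c s T Q \<Longrightarrow> (\<And>s'. Q s' \<Longrightarrow> Q' s') \<Longrightarrow> runs c s T Q'"
  using runs_conseq by blast

lemma runs_frame: "runs c s T Q \<Longrightarrow> runs c s T (\<lambda>s'. Q s' \<and> com_frame c s s')"
  unfolding runs_def using exec_frame by blast

lemma runs_Skip: "Q s \<Longrightarrow> 1 \<le> T \<Longrightarrow> runs Skip s T Q"
  unfolding runs_def using exec.Skip by blast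

lemma runs_NWrite: "Q (nwrite x (nval a s) (nval e s) s) \<Longrightarrow> 1 \<le> T \<Longrightarrow> runs (NWrite x a e) s T Q"
  unfolding runs_def using exec.NWrite by blast

lemma runs_RWrite: "Q (rwrite x (nval a s) (rval e s) s) \<Longrightarrow> 1 \<le> T \<Longrightarrow> runs (RWrite x a e) s T Q"
  unfolding runs_def using exec.RWrite by blast

lemma runs_Seq:
  assumes "runs c s T1 R" "\<And>s1. R s1 \<Longrightarrow> runs c' s1 T2 Q" "T1 + T2 \<le> T"
  shows "runs (Seq c c') s T Q"
proof -
  obtain t1 s1 where 1: "exec c s t1 s1" "t1 \<le> T1" "R s1" using assms(1) unfolding runs_def by blast
  then obtain t2 s2 where "exec c' s1 t2 s2" "t2 \<le> T2" "Q s2" using assms(2) unfolding runs_def by blast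
  then show ?thesis unfolding runs_def using exec.Seq[OF 1(1)] 1(2) assms(3) by fastforce
qed

lemma runs_NWrite_Seq:
  "runs c' (nwrite x (nval a s) (nval e s) s) T' Q \<Longrightarrow> T' < T \<Longrightarrow> runs (Seq (NWrite x a e) c') s T Q"
  by (rule runs_Seq[where R = "\<lambda>s1. s1 = nwrite x (nval a s) (nval e s) s"], rule runs_NWrite[where T = 1]) auto

lemma runs_RWrite_Seq:
  "runs c' (rwrite x (nval a s) (rval e s) s) T' Q \<Longrightarrow> T' < T \<Longrightarrow> runs (Seq (RWrite x a e) c') s T Q"
  by (rule runs_Seq[where R = "\<lambda>s1. s1 = rwrite x (nval a s) (rval e s) s"], rule runs_RWrite[where T = 1]) auto

lemma runs_Cond:
  assumes "bval b s \<Longrightarrow> runs c s T' Q" "\<not> bval b s \<Longrightarrow> runs c' s T' Q" "T' < T"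
  shows "runs (Cond b c c') s T Q"
proof (cases "bval b s")
  case True
  then obtain t s' where "exec c s t s'" "t \<le> T'" "Q s'" using assms(1) unfolding runs_def by blast
  then show ?thesis unfolding runs_def using exec.CondTrue[OF True] assms(3)
    by (intro exI[of _ "1 + t"] exI[of _ s']) auto
next
  case False
  then obtain t s' where "exec c' s t s'" "t \<le> T'" "Q s'" using assms(2) unfolding runs_def by blast
  then show ?thesis unfolding runs_def using exec.CondFalse[OF False] assms(3)
    by (intro exI[of _ "1 + t"] exI[of _ s']) auto
qed

lemma runs_While:
  assumes "I s" "\<And>s1. I s1 \<Longrightarrow> bval b s1 \<Longrightarrow> runs c s1 T (\<lambda>s2. I s2 \<and> V s2 < (V s1 :: nat))"
  shows "runs (While b c) s (1 + V s * (T + 1)) (\<lambda>s'. I s' \<and> \<not> bval b s')"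
  using assms(1)
proof (induction "V s" arbitrary: s rule: less_induct)
  case less
  show ?case
  proof (cases "bval b s")
    case True
    obtain t1 s1 where 1: "exec c s t1 s1" "t1 \<le> T" "I s1" "V s1 < V s"
      using assms(2)[OF less.prems True] unfolding runs_def by blast
    obtain t2 s2 where 2: "exec (While b c) s1 t2 s2" "t2 \<le> 1 + V s1 * (T + 1)" "I s2 \<and> \<not> bval b s2"
      using less.hyps[OF 1(4,3)] unfolding runs_def by blast
    have "(V s1 + 1) * (T + 1) \<le> V s * (T + 1)" using 1(4) by (intro mult_right_mono) auto
    then have "1 + t1 + t2 \<le> 1 + V s * (T + 1)" using 1(2) 2(2) by (simp add: algebra_simps)
    then show ?thesis unfolding runs_def using exec.WhileTrue[OF True 1(1) 2(1)] 2(3) by blast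
  next
    case False
    then show ?thesis unfolding runs_def using exec.WhileFalse[OF False] less.prems by fastforce
  qed
qed

abbreviation NV :: "bank \<Rightarrow> nexp" where "NV x \<equiv> NRead x (NConst 0)"
abbreviation Succ :: "bank \<Rightarrow> nexp" where "Succ x \<equiv> NAdd (NV x) (NConst 1)"
abbreviation RV :: "bank \<Rightarrow> rexp" where "RV x \<equiv> RRead x (NConst 0)"
abbreviation NSet :: "bank \<Rightarrow> nexp \<Rightarrow> com" where "NSet x e \<equiv> NWrite x (NConst 0) e"
abbreviation RSet :: "bank \<Rightarrow> rexp \<Rightarrow> com" where "RSet x e \<equiv> RWrite x (NConst 0) e"

definition For :: "bank \<Rightarrow> nexp \<Rightarrow> com \<Rightarrow> com" where
  "For x e c = Seq (NSet x (NConst 0)) (While (NLess (NV x) e) (Seq c (NSet x (Succ x))))"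

lemma nat_writes_For [simp]: "nat_writes (For x e c) = insert x (nat_writes c)"
  and real_writes_For [simp]: "real_writes (For x e c) = real_writes c"
  by (auto simp: For_def)

text \<open>One nesting level raises the exponent of \<open>G\<close> by one and the coefficient by
  4, which absorbs tests, increments and initialization. The counter is increased only after the
  body has established \<open>I (Suc k)\<close>, so by \<open>ins\<close> the invariant must not
  depend on it. The frame refers to the state before the loop; facts about untouched banks therefore
  need not be part of \<open>I\<close>.\<close>

lemma runs_For:
  assumes I0: "I 0 s" and ins: "\<And>k s1 v. I k s1 \<Longrightarrow> I k (nwrite x 0 v s1)" and x: "x \<notin> nat_writes c"
    and step: "\<And>k s1. k < N \<Longrightarrow> I k s1 \<Longrightarrow> nmem s1 x 0 = k \<Longrightarrow>
      loop_frame x c s s1 \<Longrightarrow> runs c s1 (a * G ^ d) (I (Suc k))"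
    and e: "\<And>s1. loop_frame x c s s1 \<Longrightarrow> nval e s1 = N"
    and G: "N \<le> G" "1 \<le> G" and T: "(a + 4) * G ^ Suc d \<le> T"
  shows "runs (For x e c) s T (\<lambda>s'. I N s' \<and> loop_frame x c s s')"
proof -
  let ?fr = "loop_frame x c s"
  let ?T = "a * G ^ d"
  let ?J = "\<lambda>s1. I (nmem s1 x 0) s1 \<and> nmem s1 x 0 \<le> N \<and> ?fr s1"
  let ?w = "While (NLess (NV x) e) (Seq c (NSet x (Succ x)))"
  have "runs ?w (nwrite x 0 0 s) (1 + (N - nmem (nwrite x 0 0 s) x 0) * ((?T + 1) + 1))
      (\<lambda>s'. ?J s' \<and> \<not> bval (NLess (NV x) e) s')"
  proof (rule runs_While[where V = "\<lambda>s1. N - nmem s1 x 0"])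
    show "?J (nwrite x 0 0 s)" using I0 ins by (auto simp: frame_def)
    fix s1 assume J: "?J s1" and b: "bval (NLess (NV x) e) s1"
    let ?k = "nmem s1 x 0"
    have k: "?k < N" using b e J by simp
    have fr: "?fr s1" using J by blast
    have "runs c s1 ?T (\<lambda>s2. I (Suc ?k) s2 \<and> com_frame c s1 s2)"
      using runs_frame[OF step[OF k _ refl fr]] J by blast
    then show "runs (Seq c (NSet x (Succ x))) s1 (?T + 1)
        (\<lambda>s2. ?J s2 \<and> N - nmem s2 x 0 < N - nmem s1 x 0)"
    proof (rule runs_Seq)
      fix s2 assume a: "I (Suc ?k) s2 \<and> com_frame c s1 s2"
      then have xk: "nmem s2 x = nmem s1 x" using x by (auto simp: frame_def)
      have "?fr (nwrite x 0 (nmem s2 x 0 + 1) s2)" using a fr by (auto simp: frame_def)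
      moreover have "I (Suc ?k) (nwrite x 0 (nmem s2 x 0 + 1) s2)" using a ins by blast
      ultimately show "runs (NSet x (Succ x)) s2 1 (\<lambda>s2. ?J s2 \<and> N - nmem s2 x 0 < N - nmem s1 x 0)"
        using k xk by (intro runs_NWrite) auto
    qed simp
  qed
  then have "runs (For x e c) s (2 + N * (?T + 2)) (\<lambda>s'. ?J s' \<and> \<not> bval (NLess (NV x) e) s')"
    unfolding For_def by (intro runs_NWrite_Seq) auto
  then show ?thesis
  proof (rule runs_conseq)
    have "2 + N * (?T + 2) \<le> 2 + G * (?T + 2)" by (intro add_left_mono mult_right_mono G(1)) simp
    also have "\<dots> = 2 + a * G ^ Suc d + 2 * G" by (simp add: algebra_simps)
    also have "\<dots> \<le> 2 * G ^ Suc d + a * G ^ Suc d + 2 * G ^ Suc d"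
      using G one_le_power[OF G(2), of "Suc d"] self_le_power[OF G(2), of "Suc d"]
      by (intro add_mono mult_left_mono) (auto simp del: power_Suc)
    also have "\<dots> = (a + 4) * G ^ Suc d" by (simp add: algebra_simps)
    finally show "2 + N * (?T + 2) \<le> T" using T by linarith
    fix s' assume a: "?J s' \<and> \<not> bval (NLess (NV x) e) s'"
    then have "nmem s' x 0 = N" using e by force
    then show "I N s' \<and> ?fr s'" using a by auto
  qed
qed

text \<open>Naturals can be multiplied and exponentiated only by loops. The time is linear in the
  loop bound, so \<open>Pow2\<close> produces a number exponential in its running time.\<close>

definition Mul :: "bank \<Rightarrow> bank \<Rightarrow> nexp \<Rightarrow> nexp \<Rightarrow> com" where
  "Mul x i e e' = Seq (NSet x (NConst 0)) (For i e (NSet x (NAdd (NV x) e')))"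

definition Pow2 :: "bank \<Rightarrow> bank \<Rightarrow> nexp \<Rightarrow> com" where
  "Pow2 x i e = Seq (NSet x (NConst 1)) (For i e (NSet x (NAdd (NV x) (NV x))))"

lemma writes_Mul [simp]: "nat_writes (Mul x i e e') = {x, i}" "real_writes (Mul x i e e') = {}"
  by (auto simp: Mul_def)

lemma writes_Pow2 [simp]: "nat_writes (Pow2 x i e) = {x, i}" "real_writes (Pow2 x i e) = {}"
  by (auto simp: Pow2_def)

lemma runs_Mul:
  assumes "x \<noteq> i" "\<And>s1. frame {x, i} {} s s1 \<Longrightarrow> nval e s1 = N \<and> nval e' s1 = M" "N \<le> G" "1 \<le> G"
  shows "runs (Mul x i e e') s (6 * G) (\<lambda>s'. nmem s' x 0 = N * M \<and> frame {x, i} {} s s')"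
proof -
  let ?s = "nwrite x 0 0 s"
  have fr: "frame {x, i} {} s s1" if "frame {i, x} {} ?s s1" for s1
    using that by (auto simp: frame_def)
  have "runs (For i e (NSet x (NAdd (NV x) e'))) ?s (5 * G) (\<lambda>s'. nmem s' x 0 = N * M \<and>
      frame (insert i (nat_writes (NSet x (NAdd (NV x) e')))) (real_writes (NSet x (NAdd (NV x) e'))) ?s s')"
  proof (rule runs_For[where I = "\<lambda>k s. nmem s x 0 = k * M" and a = 1 and d = 0 and G = G])
    fix k and s1 :: state assume "nmem s1 x 0 = k * M"
      "frame (insert i (nat_writes (NSet x (NAdd (NV x) e')))) (real_writes (NSet x (NAdd (NV x) e'))) ?s s1"
    then show "runs (NSet x (NAdd (NV x) e')) s1 (1 * G ^ 0) (\<lambda>s. nmem s x 0 = Suc k * M)"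
      using assms(2)[OF fr, of s1] by (intro runs_NWrite) auto
  qed (use assms fr in auto)
  note F = this
  show ?thesis unfolding Mul_def
    by (rule runs_NWrite_Seq[where T' = "5 * G"], unfold nval.simps, rule runs_post[OF F]) (use assms fr in auto)
qed

lemma runs_Pow2:
  assumes "x \<noteq> i" "\<And>s1. frame {x, i} {} s s1 \<Longrightarrow> nval e s1 = N" "N \<le> G" "1 \<le> G"
  shows "runs (Pow2 x i e) s (6 * G) (\<lambda>s'. nmem s' x 0 = 2 ^ N \<and> frame {x, i} {} s s')"
proof -
  let ?s = "nwrite x 0 1 s"
  have fr: "frame {x, i} {} s s1" if "frame {i, x} {} ?s s1" for s1
    using that by (auto simp: frame_def)
  have "runs (For i e (NSet x (NAdd (NV x) (NV x)))) ?s (5 * G) (\<lambda>s'. nmem s' x 0 = 2 ^ N \<and>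
      frame (insert i (nat_writes (NSet x (NAdd (NV x) (NV x))))) (real_writes (NSet x (NAdd (NV x) (NV x)))) ?s s')"
  proof (rule runs_For[where I = "\<lambda>k s. nmem s x 0 = 2 ^ k" and a = 1 and d = 0 and G = G])
    fix k and s1 :: state assume "nmem s1 x 0 = 2 ^ k"
    then show "runs (NSet x (NAdd (NV x) (NV x))) s1 (1 * G ^ 0) (\<lambda>s. nmem s x 0 = 2 ^ Suc k)"
      by (intro runs_NWrite) auto
  qed (use assms fr in auto)
  note F = this
  show ?thesis unfolding Pow2_def
    by (rule runs_NWrite_Seq[where T' = "5 * G"], unfold nval.simps, rule runs_post[OF F]) (use assms fr in auto)
qed

section \<open>The search program\<close>

text \<open>A counter \<open>c < B ^ (3 * L)\<close> encodes a chain through its base-\<open>B\<close> digits, three for each entry; the parent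
  digit is truncated to \<open>k\<close>, which the program computes as \<open>r - (r - k)\<close>.\<close>

fun guess :: "nat \<Rightarrow> nat \<Rightarrow> real \<Rightarrow> nat \<Rightarrow> real" where
  "guess B c t 0 = t"
| "guess B c t (Suc k) = real (c div B ^ (3 * k) mod B + 1) / real (c div B ^ (3 * k + 1) mod B + 1) *
     guess B c t (min (c div B ^ (3 * k + 2) mod B) k)"

text \<open>Repeated subtraction replaces division. The quotient is put back into \<open>x\<close>,
  so consecutive calls deliver the digits from the lowest upwards.\<close>

definition DivMod :: "bank \<Rightarrow> com" where
  "DivMod d = Seq (NSet ''y'' (NConst 0)) (Seq
     (While (BNot (NLess (NV ''x'') (NV ''B'')))
       (Seq (NSet ''x'' (NSub (NV ''x'') (NV ''B''))) (NSet ''y'' (Succ ''y''))))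
     (Seq (NSet d (NV ''x'')) (NSet ''x'' (NV ''y''))))"

lemma writes_DivMod [simp]: "nat_writes (DivMod d) = {''x'', ''y'', d}" "real_writes (DivMod d) = {}"
  by (auto simp: DivMod_def)

lemma runs_DivMod:
  assumes d: "d \<notin> {''x'', ''y'', ''B''}" and B: "nmem s ''B'' 0 = B" "B \<ge> 1" and c: "nmem s ''x'' 0 = c" "c \<le> G" "1 \<le> G"
  shows "runs (DivMod d) s (7 * G) (\<lambda>s'. nmem s' d 0 = c mod B \<and> nmem s' ''x'' 0 = c div B \<and> frame {''x'', ''y'', d} {} s s')"
proof -
  let ?I = "\<lambda>s1. nmem s1 ''x'' 0 + nmem s1 ''y'' 0 * B = c \<and> nmem s1 ''B'' 0 = B"
  let ?b = "BNot (NLess (NV ''x'') (NV ''B''))"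
  let ?s = "nwrite ''y'' 0 0 s"
  let ?w = "Seq (NSet ''x'' (NSub (NV ''x'') (NV ''B''))) (NSet ''y'' (Succ ''y''))"
  have W: "runs (While ?b ?w) ?s (1 + nmem ?s ''x'' 0 * (2 + 1)) (\<lambda>s'. ?I s' \<and> \<not> bval ?b s')"
  proof (rule runs_While[where V = "\<lambda>s. nmem s ''x'' 0"])
    show "?I ?s" using B c by simp
    fix s1 assume I: "?I s1" and b: "bval ?b s1"
    have "B \<le> nmem s1 ''x'' 0" using I b by auto
    then show "runs ?w s1 2 (\<lambda>s2. ?I s2 \<and> nmem s2 ''x'' 0 < nmem s1 ''x'' 0)"
      using I B(2) by (intro runs_NWrite_Seq[where T' = 1] runs_NWrite) auto
  qed
  have "runs (DivMod d) s (7 * G) (\<lambda>s'. nmem s' d 0 = c mod B \<and> nmem s' ''x'' 0 = c div B)"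
    unfolding DivMod_def
  proof (rule runs_NWrite_Seq[where T' = "6 * G"], unfold nval.simps, rule runs_Seq[OF W])
    fix s1 assume a: "?I s1 \<and> \<not> bval ?b s1"
    let ?x = "nmem s1 ''x'' 0" and ?y = "nmem s1 ''y'' 0"
    have lt: "?x < B" and e: "c = ?x + ?y * B" using a by auto
    have "c mod B = ?x" "c div B = ?y" unfolding e using lt B(2) by auto
    then show "runs (Seq (NSet d (NV ''x'')) (NSet ''x'' (NV ''y''))) s1 2 (\<lambda>s'. nmem s' d 0 = c mod B \<and> nmem s' ''x'' 0 = c div B)"
      using d by (intro runs_NWrite_Seq[where T' = 1] runs_NWrite) auto
  qed (use c in auto)
  from runs_frame[OF this] show ?thesis by (rule runs_post) (simp add: insert_commute)
qed

definition Decode :: com where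
  "Decode = Seq (NSet ''x'' (NV ''c'')) (For ''k'' (NV ''L'') (Seq (DivMod ''p'') (Seq (DivMod ''q'') (Seq (DivMod ''r'')
     (RWrite ''v'' (Succ ''k'')
       (RMul (RDiv (ROfNat (Succ ''p'')) (ROfNat (Succ ''q'')))
         (RRead ''v'' (NSub (NV ''r'') (NSub (NV ''r'') (NV ''k''))))))))))"

text \<open>After \<open>k\<close> rounds \<open>x\<close> holds \<open>c div B ^ (3 * k)\<close>.
  The base time must already be in cell 0 of \<open>v\<close>, which is never overwritten since
  entries are written from cell 1 on.\<close>

lemma runs_Decode:
  assumes s: "nmem s ''B'' 0 = B" "nmem s ''L'' 0 = L" "nmem s ''c'' 0 = c" "rmem s ''v'' 0 = t"
    and G: "B \<ge> 1" "c \<le> G" "L \<le> G" "1 \<le> G"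
  shows "runs Decode s (27 * G ^ 2) (\<lambda>s'. (\<forall>i\<le>L. rmem s' ''v'' i = guess B c t i) \<and>
    frame {''x'', ''y'', ''p'', ''q'', ''r'', ''k''} {''v''} s s')"
proof -
  let ?w = "RWrite ''v'' (Succ ''k'')
       (RMul (RDiv (ROfNat (Succ ''p'')) (ROfNat (Succ ''q'')))
         (RRead ''v'' (NSub (NV ''r'') (NSub (NV ''r'') (NV ''k'')))))"
  let ?cr = "Seq (DivMod ''r'') ?w"
  let ?cq = "Seq (DivMod ''q'') ?cr"
  let ?c = "Seq (DivMod ''p'') ?cq"
  let ?s = "nwrite ''x'' 0 c s"
  let ?I = "\<lambda>k s1. nmem s1 ''x'' 0 = c div B ^ (3 * k) \<and> (\<forall>i\<le>k. rmem s1 ''v'' i = guess B c t i)"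
  have F: "runs (For ''k'' (NV ''L'') ?c) ?s (26 * G ^ 2) (\<lambda>s'. ?I L s' \<and>
      loop_frame ''k'' ?c ?s s')"
  proof (rule runs_For[where I = ?I and N = L and a = 22 and d = 1 and G = G])
    show "?I 0 ?s" using s by simp
    fix k s1 assume k: "k < L" and I: "?I k s1" and nk: "nmem s1 ''k'' 0 = k"
      and fr: "loop_frame ''k'' ?c ?s s1"
    have B: "nmem s1 ''B'' 0 = B" using fr s by (simp add: frame_def)
    have dv: "c div B ^ N div B = c div B ^ Suc N" for N by (simp add: div_mult2_eq[symmetric] mult.commute)
    have le: "c div N \<le> G" for N using G(2) div_le_dividend le_trans by blast
    show "runs ?c s1 (22 * G ^ 1) (?I (Suc k))"
    proof (rule runs_Seq[OF runs_DivMod[of "''p''" s1 B "c div B ^ (3 * k)" G]])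
      fix s2 assume s2: "nmem s2 ''p'' 0 = c div B ^ (3 * k) mod B \<and> nmem s2 ''x'' 0 = c div B ^ (3 * k) div B \<and>
        frame {''x'', ''y'', ''p''} {} s1 s2"
      have B2: "nmem s2 ''B'' 0 = B" using s2 B by (simp add: frame_def)
      have x2: "nmem s2 ''x'' 0 = c div B ^ (3 * k + 1)" using s2 dv[of "3 * k"] by simp
      show "runs ?cq s2 (15 * G) (?I (Suc k))"
      proof (rule runs_Seq[OF runs_DivMod[of "''q''" s2 B "c div B ^ (3 * k + 1)" G]])
        fix s3 assume s3: "nmem s3 ''q'' 0 = c div B ^ (3 * k + 1) mod B \<and> nmem s3 ''x'' 0 = c div B ^ (3 * k + 1) div B \<and>
          frame {''x'', ''y'', ''q''} {} s2 s3"
        have B3: "nmem s3 ''B'' 0 = B" using s3 B2 by (simp add: frame_def)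
        have x3: "nmem s3 ''x'' 0 = c div B ^ (3 * k + 2)" using s3 dv[of "3 * k + 1"] by simp
        show "runs ?cr s3 (8 * G) (?I (Suc k))"
        proof (rule runs_Seq[OF runs_DivMod[of "''r''" s3 B "c div B ^ (3 * k + 2)" G]])
          fix s4 assume s4: "nmem s4 ''r'' 0 = c div B ^ (3 * k + 2) mod B \<and> nmem s4 ''x'' 0 = c div B ^ (3 * k + 2) div B \<and>
            frame {''x'', ''y'', ''r''} {} s3 s4"
          have x4: "nmem s4 ''x'' 0 = c div B ^ (3 * Suc k)"

          proof -
            have "3 * Suc k = Suc (3 * k + 2)" by simp
            then show ?thesis using s4 dv[of "3 * k + 2"] by metis
          qed
          have p4: "nmem s4 ''p'' 0 = c div B ^ (3 * k) mod B" "nmem s4 ''q'' 0 = c div B ^ (3 * k + 1) mod B"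
              "nmem s4 ''k'' 0 = k" "rmem s4 ''v'' = rmem s1 ''v''"
            using s2 s3 s4 nk by (simp_all add: frame_def)
          have mn: "r - (r - k) = min r k" for r :: nat by simp
          let ?r = "c div B ^ (3 * k + 2) mod B"
          have "rmem s1 ''v'' (min ?r k) = guess B c t (min ?r k)" using I by simp
          then show "runs ?w s4 G (?I (Suc k))"
            using I s4 G(4) by (intro runs_RWrite) (auto simp: x4 p4 mn le_Suc_eq simp del: diff_diff_cancel)
        qed (use B3 x3 le G in auto)
      qed (use B2 x2 le G in auto)
    qed (use B I le G in auto)
  qed (use G s in \<open>auto simp: power2_eq_square frame_def\<close>)
  have T: "26 * G ^ 2 < 27 * G ^ 2" using G by simp
  show ?thesis unfolding Decode_def
    by (rule runs_NWrite_Seq[where T' = "26 * G ^ 2"], unfold nval.simps s, rule runs_post[OF F])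
      (use T in \<open>auto simp: frame_def\<close>)
qed

section \<open>Computing the density estimate\<close>

text \<open>Without rounding, a multiple is recognized by adding up \<open>v (b + 1)\<close> until
  the target is reached and comparing exactly. The flag \<open>g\<close> is set and never cleared
  here, so a loop over \<open>b\<close> computes a disjunction.\<close>

definition MemTest :: com where
  "MemTest = (let x = RMul (ROfNat (Succ ''a'')) (RRead ''v'' (Succ ''k'')) in
     Seq (RSet ''Y'' (ROfNat (NConst 0))) (Seq
       (While (RLess (RV ''Y'') x) (RSet ''Y'' (RAdd (RV ''Y'') (RRead ''v'' (Succ ''b'')))))
       (Cond (RLess x (RV ''Y'')) Skip (NSet ''g'' (NConst 1)))))"

lemma writes_MemTest [simp]: "nat_writes MemTest = {''g''}" "real_writes MemTest = {''Y''}"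
  by (auto simp: MemTest_def Let_def)

lemma runs_MemTest:
  assumes s: "nmem s ''a'' 0 = a" "nmem s ''k'' 0 = k" "nmem s ''b'' 0 = b" "rmem s ''v'' = v"
    and pos: "v (Suc b) > 0" "v (Suc k) > 0" and le: "real (Suc a) * v (Suc k) \<le> real (G ^ 2) * v (Suc b)" "1 \<le> G"
  shows "runs MemTest s (6 * G ^ 2) (\<lambda>s'. nmem s' ''g'' 0 =
    (if real (Suc a) * v (Suc k) \<in> mults (v (Suc b)) then 1 else nmem s ''g'' 0))"
proof -
  define x w where "x = real (Suc a) * v (Suc k)" and "w = v (Suc b)"
  have xw: "x > 0" "w > 0" using pos by (auto simp: x_def w_def)
  let ?x = "RMul (ROfNat (Succ ''a'')) (RRead ''v'' (Succ ''k''))"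
  let ?b = "RLess (RV ''Y'') ?x" and ?c = "RSet ''Y'' (RAdd (RV ''Y'') (RRead ''v'' (Succ ''b'')))"
  let ?s = "rwrite ''Y'' 0 0 s"
  let ?f = "frame {} {''Y''} s"
  \<comment> \<open>\<open>Y\<close> is a multiple of \<open>w\<close> whose predecessor is still
    below \<open>x\<close>. On exit it is the least multiple not below \<open>x\<close>, so
    \<open>x\<close> is a multiple exactly if it equals \<open>Y\<close>.\<close>
  let ?I = "\<lambda>s1. ?f s1 \<and> (\<exists>l. rmem s1 ''Y'' 0 = real l * w \<and> (l = 0 \<or> real (l - 1) * w < x))"
  have ev: "rval ?x s1 = x" "rval (RRead ''v'' (Succ ''b'')) s1 = w" if "?f s1" for s1
    using that s by (auto simp: frame_def x_def w_def add.commute)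
  let ?V = "\<lambda>s1. nat \<lceil>(x - rmem s1 ''Y'' 0) / w\<rceil>"
  have W: "runs (While ?b ?c) ?s (1 + ?V ?s * (1 + 1)) (\<lambda>s'. ?I s' \<and> \<not> bval ?b s')"
  proof (rule runs_While[where V = ?V])
    show "?I ?s" by (auto simp: frame_def intro!: exI[of _ 0])
    fix s1 assume I: "?I s1" and b: "bval ?b s1"
    then obtain l where l: "rmem s1 ''Y'' 0 = real l * w" by blast
    have f: "?f s1" using I by blast
    have lt: "real l * w < x" using b ev(1)[OF f] l by simp
    have "0 < (x - real l * w) / w" using lt xw by simp
    moreover have "(x - (real l * w + w)) / w = (x - real l * w) / w - 1" using xw by (simp add: field_simps)
    ultimately have V: "nat \<lceil>(x - (real l * w + w)) / w\<rceil> < nat \<lceil>(x - real l * w) / w\<rceil>" by linarith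
    let ?s2 = "rwrite ''Y'' 0 (real l * w + w) s1"
    have "?I ?s2" using f lt by (auto simp: frame_def algebra_simps intro!: exI[of _ "Suc l"])
    then show "runs ?c s1 1 (\<lambda>s2. ?I s2 \<and> ?V s2 < ?V s1)"
      using ev(2)[OF f] V l by (intro runs_RWrite) auto
  qed
  have V0: "?V ?s \<le> G ^ 2"
  proof -
    have "x / w \<le> real (G ^ 2)" using le(1) xw unfolding x_def[symmetric] w_def[symmetric] by (simp add: field_simps)
    then show ?thesis by (simp add: nat_le_iff ceiling_le_iff)
  qed
  have "1 \<le> G ^ 2" using le by simp
  then have "n \<le> G ^ 2 \<Longrightarrow> 1 + n * (1 + 1) + 2 \<le> 5 * G ^ 2" for n by simp
  from this[OF V0] have V0': "1 + ?V ?s * (1 + 1) + 2 \<le> 5 * G ^ 2" "5 * G ^ 2 < 6 * G ^ 2"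
    using le(2) by simp_all
  show ?thesis unfolding MemTest_def Let_def x_def[symmetric] w_def[symmetric]
  proof (rule runs_RWrite_Seq[where T' = "5 * G ^ 2"], unfold rval.simps nval.simps of_nat_0, rule runs_Seq[OF W])
    fix s1 assume a: "?I s1 \<and> \<not> bval ?b s1"
    then obtain l where l: "rmem s1 ''Y'' 0 = real l * w" "l = 0 \<or> real (l - 1) * w < x" by blast
    have f: "?f s1" using a by blast
    have ge: "x \<le> real l * w" using a ev(1)[OF f] l by simp
    have "real l * w = x \<longleftrightarrow> x \<in> mults w"
    proof
      assume "real l * w = x"
      moreover have "l \<ge> 1" using ge xw by (cases l) auto
      ultimately show "x \<in> mults w" unfolding in_mults_iff by auto
    next
      assume "x \<in> mults w"
      then obtain a where a: "x = real a * w" unfolding in_mults_iff by blast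
      have l0: "l \<noteq> 0" using ge xw by (cases l) auto
      then have "real (l - 1) < real a" using l(2) a xw by simp
      moreover have "a \<le> l" using ge xw unfolding a by simp
      ultimately have "l = a" using l0 by linarith
      then show "real l * w = x" using a by simp
    qed
    then have "\<not> x < real l * w \<longleftrightarrow> x \<in> mults w" using ge by linarith
    moreover have "nmem s1 ''g'' 0 = nmem s ''g'' 0" using f by (simp add: frame_def)
    ultimately show "runs (Cond (RLess ?x (RV ''Y'')) Skip (NSet ''g'' (NConst 1))) s1 2
      (\<lambda>s'. nmem s' ''g'' 0 = (if x \<in> mults w then 1 else nmem s ''g'' 0))"
      using ev(1)[OF f] l(1) by (intro runs_Cond[where T' = 1] runs_Skip runs_NWrite) auto
  qed (use V0' in auto)
qed

definition CountFresh :: com where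
  "CountFresh = Seq (NSet ''z'' (NConst 0)) (For ''a'' (NV ''A'') (Seq (NSet ''g'' (NConst 0))
     (Seq (For ''b'' (NV ''k'') MemTest)
       (Cond (NLess (NV ''g'') (NConst 1)) (NSet ''z'' (Succ ''z'')) Skip))))"

lemma writes_CountFresh [simp]: "nat_writes CountFresh = {''z'', ''a'', ''g'', ''b''}" "real_writes CountFresh = {''Y''}"
  by (auto simp: CountFresh_def)

lemma fresh_Suc: "fresh v k (Suc A) = fresh v k A \<union>
    (if real (Suc A) * v (Suc k) \<in> lat (v ` {1..k}) then {} else {Suc A})"
  unfolding fresh_def by (auto simp: le_Suc_eq simp del: of_nat_Suc)

lemma in_lat_image_iff: "x \<in> lat (v ` {1..k}) \<longleftrightarrow> (\<exists>b<k. x \<in> mults (v (Suc b)))"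
proof -
  have "{1..k} = Suc ` {..<k}" by (auto simp: image_iff) (metis Suc_le_D Suc_le_lessD lessThan_iff)
  then show ?thesis unfolding lat_def by auto
qed

lemma runs_CountFresh:
  assumes s: "nmem s ''A'' 0 = A" "nmem s ''k'' 0 = k" "rmem s ''v'' = v"
    and pos: "\<forall>i\<in>{1..Suc k}. v i > 0"
    and le: "\<forall>i\<in>{1..k}. real A * v (Suc k) \<le> real (G ^ 2) * v i" and G: "A \<le> G" "k \<le> G" "1 \<le> G"
  shows "runs CountFresh s (18 * G ^ 4) (\<lambda>s'. nmem s' ''z'' 0 = card (fresh v k A))"
proof -
  let ?m = "Cond (NLess (NV ''g'') (NConst 1)) (NSet ''z'' (Succ ''z'')) Skip"
  let ?c = "Seq (NSet ''g'' (NConst 0)) (Seq (For ''b'' (NV ''k'') MemTest) ?m)"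
  let ?s = "nwrite ''z'' 0 0 s"
  let ?I = "\<lambda>a s1. nmem s1 ''z'' 0 = card (fresh v k a)"
  have F: "runs (For ''a'' (NV ''A'') ?c) ?s (17 * G ^ 4) (\<lambda>s'. ?I A s' \<and>
      loop_frame ''a'' ?c ?s s')"
  proof (rule runs_For[where I = ?I and N = A and a = 13 and d = 3 and G = G])
    fix a s1 assume a: "a < A" and I: "?I a s1" and na: "nmem s1 ''a'' 0 = a"
      and fr: "loop_frame ''a'' ?c ?s s1"
    have s1: "nmem s1 ''k'' 0 = k" "rmem s1 ''v'' = v" using fr s by (simp_all add: frame_def)
    let ?x = "real (Suc a) * v (Suc k)"
    let ?s1 = "nwrite ''g'' 0 0 s1"
    let ?J = "\<lambda>b s2. nmem s2 ''g'' 0 = (if \<exists>j<b. ?x \<in> mults (v (Suc j)) then 1 else 0)"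
    have F2: "runs (For ''b'' (NV ''k'') MemTest) ?s1 (10 * G ^ 3) (\<lambda>s'. ?J k s' \<and>
        loop_frame ''b'' MemTest ?s1 s')"
    proof (rule runs_For[where I = ?J and N = k and a = 6 and d = 2 and G = G])
      fix b s2 assume b: "b < k" and J: "?J b s2" and nb: "nmem s2 ''b'' 0 = b"
        and fr2: "loop_frame ''b'' MemTest ?s1 s2"
      have s2: "nmem s2 ''a'' 0 = a" "nmem s2 ''k'' 0 = k" "rmem s2 ''v'' = v"
        using fr2 s1 na by (simp_all add: frame_def)
      have "?x \<le> real A * v (Suc k)" using a pos[rule_format, of "Suc k"] by (intro mult_right_mono) auto
      also have "\<dots> \<le> real (G ^ 2) * v (Suc b)" using le b by auto
      finally have "?x \<le> real (G ^ 2) * v (Suc b)" .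
      then have "runs MemTest s2 (6 * G ^ 2) (\<lambda>s'. nmem s' ''g'' 0 = (if ?x \<in> mults (v (Suc b)) then 1 else nmem s2 ''g'' 0))"
        using pos b by (intro runs_MemTest[OF s2(1,2) nb s2(3)] G) auto
      then show "runs MemTest s2 (6 * G ^ 2) (?J (Suc b))"
        by (rule runs_post) (use J in \<open>auto simp: less_Suc_eq\<close>)
    qed (use G s1 in \<open>auto simp: power_numeral_reduce frame_def\<close>)
    have T: "10 * G ^ 3 + 2 < 13 * G ^ 3"
      using one_le_power[OF G(3), of 3] by linarith
    show "runs ?c s1 (13 * G ^ 3) (?I (Suc a))"
    proof (rule runs_NWrite_Seq[where T' = "10 * G ^ 3 + 2"], unfold nval.simps, rule runs_Seq[OF F2])
      fix s3 assume s3: "?J k s3 \<and> loop_frame ''b'' MemTest ?s1 s3"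
      have z: "nmem s3 ''z'' 0 = card (fresh v k a)" using s3 I by (simp add: frame_def)
      have "?J k s3" using s3 by blast
      then have g: "nmem s3 ''g'' 0 < 1 \<longleftrightarrow> ?x \<notin> lat (v ` {1..k})" unfolding in_lat_image_iff by auto
      have "finite (fresh v k a)" "Suc a \<notin> fresh v k a" unfolding fresh_def by auto
      then show "runs ?m s3 2 (?I (Suc a))"
        using z g by (intro runs_Cond[where T' = 1] runs_Skip runs_NWrite) (auto simp: fresh_Suc simp del: of_nat_Suc)
    qed (use T in auto)
  qed (use G s in \<open>auto simp: fresh_def power_numeral_reduce frame_def\<close>)
  have T: "17 * G ^ 4 < 18 * G ^ 4" using G by simp
  show ?thesis unfolding CountFresh_def
    by (rule runs_NWrite_Seq[where T' = "17 * G ^ 4"], unfold nval.simps, rule runs_post[OF F]) (use T in auto)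
qed

definition Density :: com where
  "Density = Seq (RSet ''d'' (ROfNat (NConst 0))) (For ''k'' (NV ''L'') (Seq CountFresh
     (RSet ''d'' (RAdd (RV ''d'') (RDiv (ROfNat (NV ''z''))
       (RMul (ROfNat (NV ''A'')) (RRead ''v'' (Succ ''k''))))))))"

text \<open>The ratio bound limits the membership tests: a target of at most \<open>A * v k\<close>
  is reached in about \<open>A ^ 2\<close> steps of length \<open>v i\<close>. The loops over
  \<open>b\<close>, \<open>a\<close> and \<open>k\<close> then raise the exponent from 2 to
  5.\<close>

lemma runs_Density:
  assumes s: "nmem s ''A'' 0 = A" "nmem s ''L'' 0 = L" "rmem s ''v'' = v"
    and pos: "\<forall>i\<in>{1..L}. v i > 0"
    and le: "\<forall>i\<in>{1..L}. \<forall>k\<in>{1..L}. v k \<le> real A * v i" and G: "A \<le> G" "L \<le> G" "1 \<le> G"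
  shows "runs Density s (24 * G ^ 5) (\<lambda>s'. rmem s' ''d'' 0 = dens_est v L A)"
proof -
  let ?c = "Seq CountFresh (RSet ''d'' (RAdd (RV ''d'') (RDiv (ROfNat (NV ''z''))
       (RMul (ROfNat (NV ''A'')) (RRead ''v'' (Succ ''k''))))))"
  let ?s = "rwrite ''d'' 0 0 s"
  let ?I = "\<lambda>k s1. rmem s1 ''d'' 0 = dens_est v k A"
  have F: "runs (For ''k'' (NV ''L'') ?c) ?s (23 * G ^ 5) (\<lambda>s'. ?I L s' \<and>
      loop_frame ''k'' ?c ?s s')"
  proof (rule runs_For[where I = ?I and N = L and a = 19 and d = 4 and G = G])
    fix k s1 assume k: "k < L" and I: "?I k s1" and nk: "nmem s1 ''k'' 0 = k"
      and fr: "loop_frame ''k'' ?c ?s s1"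
    have s1: "nmem s1 ''A'' 0 = A" "rmem s1 ''v'' = v" using fr s by (simp_all add: frame_def)
    have le': "real A * v (Suc k) \<le> real (G ^ 2) * v i" if "i \<in> {1..k}" for i
    proof -
      have "real A * v (Suc k) \<le> real A * (real A * v i)" using le that k by (intro mult_left_mono) auto
      also have "\<dots> = real (A ^ 2) * v i" by (simp add: power2_eq_square)
      also have "\<dots> \<le> real (G ^ 2) * v i" using pos[rule_format, of i] that k power_mono[OF G(1), of 2]
        by (intro mult_right_mono of_nat_mono) auto
      finally show ?thesis .
    qed
    have "runs CountFresh s1 (18 * G ^ 4) (\<lambda>s'. nmem s' ''z'' 0 = card (fresh v k A))"
      by (rule runs_CountFresh[OF s1(1) nk s1(2)]) (use pos k le' G in auto)
    note C = runs_frame[OF this]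
    show "runs ?c s1 (19 * G ^ 4) (?I (Suc k))"
    proof (rule runs_Seq[OF C])
      fix s2 assume s2: "nmem s2 ''z'' 0 = card (fresh v k A) \<and> com_frame CountFresh s1 s2"
      then show "runs (RSet ''d'' (RAdd (RV ''d'') (RDiv (ROfNat (NV ''z''))
       (RMul (ROfNat (NV ''A'')) (RRead ''v'' (Succ ''k'')))))) s2 1 (?I (Suc k))"
        using I s1 nk by (intro runs_RWrite) (auto simp: frame_def dens_est_def)
    qed (use G in simp)
  qed (use G s in \<open>auto simp: dens_est_def power_numeral_reduce frame_def\<close>)
  have T: "23 * G ^ 5 < 24 * G ^ 5" using G by simp
  show ?thesis unfolding Density_def
    by (rule runs_RWrite_Seq[where T' = "23 * G ^ 5"], unfold nval.simps rval.simps of_nat_0, rule runs_post[OF F]) (use T in auto)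
qed

section \<open>Choosing the interval of a commodity\<close>

definition Eoq :: "rexp \<Rightarrow> rexp" where
  "Eoq x = RAdd (RDiv (RRead ''K'' (Succ ''i'')) x) (RMul (RRead ''H'' (Succ ''i'')) x)"

definition Offer :: "rexp \<Rightarrow> com" where
  "Offer x = Cond (RLess (Eoq x) (RV ''q''))
     (Seq (RSet ''q'' (Eoq x)) (RWrite ''W'' (Succ ''i'') x)) Skip"

lemma writes_Offer [simp]: "nat_writes (Offer x) = {}" "real_writes (Offer x) = {''q'', ''W''}"
  by (auto simp: Offer_def)

lemma rval_Eoq:
  "nmem s ''i'' 0 = i \<Longrightarrow> rval (Eoq x) s = eoq_cost (rmem s ''K'' (Suc i)) (rmem s ''H'' (Suc i)) (rval x s)"
  unfolding Eoq_def eoq_cost_def by simp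

text \<open>This makes \<open>choice\<close> a loop invariant over the offers made so far, starting
  from the private option and the empty set.\<close>

lemma choice_insert:
  "choice k0 k h cs w c \<Longrightarrow> choice k0 k h (insert x cs) (if eoq_cost k h x < c then x else w)
    (if eoq_cost k h x < c then eoq_cost k h x else c)"
  unfolding choice_def by auto

text \<open>\<open>Offer\<close> stores the new cost in \<open>q\<close> before it evaluates
  \<open>x\<close> again for \<open>W\<close>; hence the value of \<open>x\<close> must be stable
  under writing \<open>q\<close>.\<close>

lemma runs_Offer:
  assumes s: "nmem s ''i'' 0 = i" "rmem s ''K'' (Suc i) = k" "rmem s ''H'' (Suc i) = h"
    and x: "rval x s = r" "\<And>y. rval x (rwrite ''q'' 0 y s) = r"
    and ch: "choice k0 k h cs (rmem s ''W'' (Suc i)) (rmem s ''q'' 0)"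
  shows "runs (Offer x) s 3 (\<lambda>s'. choice k0 k h (insert r cs) (rmem s' ''W'' (Suc i)) (rmem s' ''q'' 0) \<and>
    (\<forall>j. j \<noteq> Suc i \<longrightarrow> rmem s' ''W'' j = rmem s ''W'' j))"
  unfolding Offer_def
  using choice_insert[OF ch, of r] rval_Eoq[OF s(1), of x] s x
  by (intro runs_Cond[where T' = 2] runs_RWrite_Seq[where T' = 1] runs_RWrite runs_Skip) auto

definition ChooseItem :: com where
  "ChooseItem =
     (let i = Succ ''i'' in
     Seq (RWrite ''W'' i (RSqrt (RDiv (RRead ''K'' i) (RRead ''H'' i))))
     (Seq (RSet ''q'' (RAdd (Eoq (RRead ''W'' i)) (RDiv (RV ''K'') (RRead ''W'' i))))
     (Seq (For ''k'' (NV ''L'') (Offer (RRead ''v'' (Succ ''k''))))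
          (For ''l'' (NV ''X'') (Offer (RMul (ROfNat (Succ ''l'')) (RRead ''v'' (NConst 1))))))))"

lemma writes_ChooseItem [simp]: "nat_writes ChooseItem = {''k'', ''l''}" "real_writes ChooseItem = {''q'', ''W''}"
  by (auto simp: ChooseItem_def Let_def)

lemma runs_ChooseItem:
  assumes s: "nmem s ''i'' 0 = i" "nmem s ''L'' 0 = L" "nmem s ''X'' 0 = X" "rmem s ''v'' = v"
      "rmem s ''K'' = K" "rmem s ''H'' = H"
    and G: "L \<le> G" "X \<le> G" "1 \<le> G"
  shows "runs ChooseItem s (17 * G) (\<lambda>s'. choice (K 0) (K (Suc i)) (H (Suc i)) (offers L X v)
      (rmem s' ''W'' (Suc i)) (rmem s' ''q'' 0) \<and> (\<forall>j. j \<noteq> Suc i \<longrightarrow> rmem s' ''W'' j = rmem s ''W'' j))"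
proof -
  let ?i = "Succ ''i''"
  let ?o1 = "Offer (RRead ''v'' (Succ ''k''))"
  let ?o2 = "Offer (RMul (ROfNat (Succ ''l'')) (RRead ''v'' (NConst 1)))"
  let ?ch = "\<lambda>cs s1. choice (K 0) (K (Suc i)) (H (Suc i)) cs (rmem s1 ''W'' (Suc i)) (rmem s1 ''q'' 0) \<and>
      (\<forall>j. j \<noteq> Suc i \<longrightarrow> rmem s1 ''W'' j = rmem s ''W'' j)"
  define E where "E = sqrt (K (Suc i) / H (Suc i))"
  define s1 where "s1 = rwrite ''W'' (Suc i) E s"
  define s2 where "s2 = rwrite ''q'' 0 (eoq_cost (K (Suc i)) (H (Suc i)) E + K 0 / E) s1"
  have s2: "nmem s2 ''i'' 0 = i" "nmem s2 ''L'' 0 = L" "nmem s2 ''X'' 0 = X" "rmem s2 ''v'' = v"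
      "rmem s2 ''K'' = K" "rmem s2 ''H'' = H" "?ch {} s2"
    unfolding s2_def s1_def using s by (auto simp: choice_def E_def)
  have F1: "runs (For ''k'' (NV ''L'') ?o1) s2 (7 * G) (\<lambda>s'. ?ch (v ` {1..L}) s' \<and>
      loop_frame ''k'' ?o1 s2 s')"
  proof (rule runs_For[where I = "\<lambda>k. ?ch (v ` {1..k})" and N = L and a = 3 and d = 0 and G = G])
    fix k s3 assume I: "?ch (v ` {1..k}) s3" and nk: "nmem s3 ''k'' 0 = k"
      and fr: "loop_frame ''k'' ?o1 s2 s3"
    have s3: "nmem s3 ''i'' 0 = i" "rmem s3 ''K'' (Suc i) = K (Suc i)" "rmem s3 ''H'' (Suc i) = H (Suc i)" "rmem s3 ''v'' = v"
      using fr s2 by (simp_all add: frame_def)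
    have "v ` {1..Suc k} = insert (v (Suc k)) (v ` {1..k})" by (auto simp: atLeastAtMostSuc_conv)
    then show "runs ?o1 s3 (3 * G ^ 0) (?ch (v ` {1..Suc k}))"
      using runs_post[OF runs_Offer[OF s3(1,2,3), of "RRead ''v'' (Succ ''k'')" "v (Suc k)" "K 0" "v ` {1..k}"]] I s3 nk
      by simp
  qed (use s2 G in \<open>auto simp: frame_def\<close>)
  have F2: "runs (For ''l'' (NV ''X'') ?o2) s3 (7 * G) (?ch (offers L X v))"
    if a: "?ch (v ` {1..L}) s3 \<and> loop_frame ''k'' ?o1 s2 s3" for s3
  proof (rule runs_post[OF runs_For[where I = "\<lambda>l. ?ch (offers L l v)" and N = X and a = 3 and d = 0 and G = G]])
    show "?ch (offers L 0 v) s3" using a by (simp add: offers_def)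
    fix l s4 assume I: "?ch (offers L l v) s4" and nl: "nmem s4 ''l'' 0 = l"
      and fr: "loop_frame ''l'' ?o2 s3 s4"
    have s4: "nmem s4 ''i'' 0 = i" "rmem s4 ''K'' (Suc i) = K (Suc i)" "rmem s4 ''H'' (Suc i) = H (Suc i)" "rmem s4 ''v'' = v"
      using fr a s2 by (simp_all add: frame_def)
    have "offers L (Suc l) v = insert (real (Suc l) * v 1) (offers L l v)"
      by (auto simp: offers_def atLeastAtMostSuc_conv)
    then show "runs ?o2 s4 (3 * G ^ 0) (?ch (offers L (Suc l) v))"
      using runs_post[OF runs_Offer[OF s4(1,2,3), of "RMul (ROfNat (Succ ''l'')) (RRead ''v'' (NConst 1))"
          "real (Suc l) * v 1" "K 0" "offers L l v"]] I s4 nl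
      by simp
  qed (use G a s2 in \<open>auto simp: frame_def\<close>)
  have "runs (Seq (For ''k'' (NV ''L'') ?o1) (For ''l'' (NV ''X'') ?o2)) s2 (14 * G) (?ch (offers L X v))"
    by (rule runs_Seq[OF F1 F2]) auto
  moreover have "rval (RSqrt (RDiv (RRead ''K'' ?i) (RRead ''H'' ?i))) s = E" "nval ?i s = Suc i"
    using s by (simp_all add: E_def)
  moreover have "rval (RAdd (Eoq (RRead ''W'' ?i)) (RDiv (RV ''K'') (RRead ''W'' ?i))) s1 =
      eoq_cost (K (Suc i)) (H (Suc i)) E + K 0 / E"
    using s rval_Eoq[of s1 i] by (simp add: s1_def)
  ultimately show ?thesis unfolding ChooseItem_def Let_def using G
    by (intro runs_RWrite_Seq[where T' = "16 * G"] runs_RWrite_Seq[where T' = "14 * G"]) (simp_all add: s1_def s2_def)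
qed

text \<open>A new leading digit is added as a multiple of \<open>B ^ D\<close>, which the lower
  digits do not see.\<close>

lemma digits_exist:
  assumes "\<And>i. i < D \<Longrightarrow> f i < B"
  shows "\<exists>c < B ^ D. \<forall>i<D. c div B ^ i mod B = (f i :: nat)"
  using assms
proof (induction D)
  case (Suc D)
  then obtain c where c: "c < B ^ D" "\<forall>i<D. c div B ^ i mod B = f i" by fastforce
  have fD: "f D < B" using Suc.prems by simp
  define c' where "c' = c + f D * B ^ D"
  have "c' < B ^ D + f D * B ^ D" using c unfolding c'_def by simp
  also have "\<dots> = Suc (f D) * B ^ D" by simp
  also have "\<dots> \<le> B * B ^ D" using fD by (intro mult_right_mono) auto
  finally have "c' < B ^ Suc D" by simp
  moreover have "c' div B ^ i mod B = f i" if i: "i < Suc D" for i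
  proof (cases "i = D")
    case True
    have "B ^ D \<noteq> 0" using c by (metis not_less_zero)
    then have "c' div B ^ D = f D" using c unfolding c'_def by simp
    then show ?thesis using True fD by simp
  next
    case False
    then have iD: "i < D" using i by simp
    have B0: "B ^ i \<noteq> 0" using fD by simp
    have "B ^ D = B ^ i * (B * B ^ (D - i - 1))"
      using iD by (simp flip: power_add power_Suc)
    then have "c' = c + B ^ i * (f D * (B * B ^ (D - i - 1)))" unfolding c'_def by simp
    then have "c' div B ^ i = c div B ^ i + f D * (B * B ^ (D - i - 1))" using B0 by simp
    also have "\<dots> mod B = (c div B ^ i + B * (f D * B ^ (D - i - 1))) mod B" by (simp add: ac_simps)
    also have "\<dots> = c div B ^ i mod B" by simp
    finally show ?thesis using c iD by simp
  qed
  ultimately show ?case by blast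
qed simp

text \<open>Numerators and denominators are stored minus one, because digits start at 0. A parent
  index fits into a digit because it is below \<open>L \<le> B\<close>, and truncating it to
  \<open>k\<close> does not change it.\<close>

lemma guess_exists:
  assumes ch: "is_chain B L t v" and L: "L \<le> B"
  shows "\<exists>c < B ^ (3 * L). \<forall>k\<le>L. guess B c t k = v k"
proof -
  have "\<forall>k. \<exists>j p q. k < L \<longrightarrow> j \<le> k \<and> p \<in> {1..B} \<and> q \<in> {1..B} \<and> v (Suc k) = real p / real q * v j"
    using ch unfolding is_chain_def by blast
  then obtain J P Q where JPQ: "\<And>k. k < L \<Longrightarrow> J k \<le> k \<and> P k \<in> {1..B} \<and> Q k \<in> {1..B} \<and>
      v (Suc k) = real (P k) / real (Q k) * v (J k)" by metis
  define f where "f i = (if i mod 3 = 0 then P (i div 3) - 1 else if i mod 3 = 1 then Q (i div 3) - 1 else J (i div 3))" for i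
  have "f i < B" if "i < 3 * L" for i
  proof -
    have k: "i div 3 < L" using that by (simp add: less_mult_imp_div_less mult.commute)
    have "1 \<le> P (i div 3)" "P (i div 3) \<le> B" "1 \<le> Q (i div 3)" "Q (i div 3) \<le> B" "J (i div 3) \<le> i div 3"
      using JPQ[OF k] by auto
    then have "P (i div 3) - 1 < B" "Q (i div 3) - 1 < B" "J (i div 3) < B" using k L by linarith+
    then show ?thesis unfolding f_def by auto
  qed
  then obtain c where c: "c < B ^ (3 * L)" "\<forall>i<3 * L. c div B ^ i mod B = f i" using digits_exist by blast
  have "guess B c t k = v k" if "k \<le> L" for k
    using that
  proof (induction k rule: less_induct)
    case (less k)
    show ?case
    proof (cases k)
      case 0
      then show ?thesis using ch by (simp add: is_chain_def)
    next
      case (Suc k')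
      then have k': "k' < L" using less.prems by simp
      have m: "(3 * k') mod 3 = 0" "(3 * k') div 3 = k'" "(3 * k' + 1) mod 3 = 1" "(3 * k' + 1) div 3 = k'"
        "(3 * k' + 2) mod 3 = 2" "(3 * k' + 2) div 3 = k'" by presburger+
      have d: "c div B ^ (3 * k') mod B = P k' - 1" "c div B ^ (3 * k' + 1) mod B = Q k' - 1"
          "c div B ^ (3 * k' + 2) mod B = J k'"
        using c(2)[rule_format, of "3 * k'"] c(2)[rule_format, of "3 * k' + 1"] c(2)[rule_format, of "3 * k' + 2"] k' m
        unfolding f_def by simp_all
      have pq: "P k' - 1 + 1 = P k'" "Q k' - 1 + 1 = Q k'" "J k' \<le> k'" using JPQ[OF k'] by auto
      have "guess B c t k = real (P k') / real (Q k') * guess B c t (J k')"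
        unfolding Suc guess.simps d pq using pq(3) by (simp add: min_absorb1)
      also have "guess B c t (J k') = v (J k')" using less.IH[of "J k'"] pq(3) Suc less.prems by simp
      finally show ?thesis using JPQ[OF k'] Suc by simp
    qed
  qed
  then show ?thesis using c by blast
qed

text \<open>Every counter decodes to some chain, so the search gets by without a validity
  check.\<close>

lemma guess_is_chain: "B \<ge> 1 \<Longrightarrow> is_chain B L t (guess B c t)"
  unfolding is_chain_def
proof (intro conjI allI impI)
  fix k assume B: "B \<ge> 1"
  show "\<exists>j\<le>k. \<exists>p\<in>{1..B}. \<exists>q\<in>{1..B}. guess B c t (Suc k) = real p / real q * guess B c t j"
    by (rule exI[of _ "min (c div B ^ (3 * k + 2) mod B) k"], rule conjI, simp,
        rule bexI[of _ "c div B ^ (3 * k) mod B + 1"], rule bexI[of _ "c div B ^ (3 * k + 1) mod B + 1"])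
      (use B in \<open>auto simp: Suc_le_eq\<close>)
qed simp

text \<open>The bank \<open>v\<close> agrees with \<open>guess\<close> only up to index
  \<open>L\<close>, and \<open>Save\<close> copies \<open>W\<close> to \<open>T\<close> only on
  \<open>{1..n}\<close>.\<close>

lemma outcome_cong:
  assumes "\<And>k. k \<le> L \<Longrightarrow> v k = v' k" "L \<ge> 1" "\<And>i. i \<in> {1..n} \<Longrightarrow> W i = W' i"
  shows "outcome K H n L X A v W e = outcome K H n L X A v' W' e"
proof -
  have im: "v ` {1..k} = v' ` {1..k}" if "k \<le> L" for k using assms(1) that by (intro image_cong) auto
  have "fresh v k A = fresh v' k A" if "k < L" for k
    unfolding fresh_def using im[of k] assms(1)[of "Suc k"] that by simp
  then have d: "dens_est v L A = dens_est v' L A" unfolding dens_est_def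
    by (intro sum.cong) (use assms(1) in auto)
  have "offers L X v = offers L X v'" unfolding offers_def using im[of L] assms(1,2) by simp
  then show ?thesis unfolding outcome_def d using assms(3) by simp
qed

definition Cost :: com where
  "Cost = Seq (RSet ''e'' (RMul (RV ''K'') (RV ''d'')))
    (For ''i'' (NV ''n'') (Seq ChooseItem (RSet ''e'' (RAdd (RV ''e'') (RV ''q'')))))"

lemma runs_Cost:
  assumes s: "nmem s ''n'' 0 = n" "nmem s ''L'' 0 = L" "nmem s ''X'' 0 = X" "rmem s ''v'' = v"
      "rmem s ''K'' = K" "rmem s ''H'' = H" "rmem s ''d'' 0 = dens_est v L A"
    and G: "L \<le> G" "X \<le> G" "1 \<le> G" "n \<le> G"
  shows "runs Cost s (23 * G ^ 2) (\<lambda>s'. outcome K H n L X A v (rmem s' ''W'') (rmem s' ''e'' 0))"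
proof -
  let ?c = "Seq ChooseItem (RSet ''e'' (RAdd (RV ''e'') (RV ''q'')))"
  let ?s = "rwrite ''e'' 0 (K 0 * dens_est v L A) s"
  let ?ch = "\<lambda>j. choice (K 0) (K j) (H j) (offers L X v)"
  let ?I = "\<lambda>i s1. \<exists>c. (\<forall>j\<in>{1..i}. ?ch j (rmem s1 ''W'' j) (c j)) \<and>
    rmem s1 ''e'' 0 = K 0 * dens_est v L A + (\<Sum>j=1..i. c j)"
  have F: "runs (For ''i'' (NV ''n'') ?c) ?s (22 * G ^ 2) (\<lambda>s'. ?I n s' \<and>
      loop_frame ''i'' ?c ?s s')"
  proof (rule runs_For[where I = ?I and N = n and a = 18 and d = 1 and G = G])
    fix i s1 assume I: "?I i s1" and ni: "nmem s1 ''i'' 0 = i"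
      and fr: "loop_frame ''i'' ?c ?s s1"
    have s1: "nmem s1 ''L'' 0 = L" "nmem s1 ''X'' 0 = X" "rmem s1 ''v'' = v" "rmem s1 ''K'' = K" "rmem s1 ''H'' = H"
      using fr s by (simp_all add: frame_def)
    obtain c where c: "\<forall>j\<in>{1..i}. ?ch j (rmem s1 ''W'' j) (c j)" "rmem s1 ''e'' 0 = K 0 * dens_est v L A + (\<Sum>j=1..i. c j)"
      using I by blast
    show "runs ?c s1 (18 * G ^ 1) (?I (Suc i))"
    proof (rule runs_Seq[OF runs_frame[OF runs_ChooseItem[OF ni s1 G(1-3)]]])
      fix s2 assume s2: "(?ch (Suc i) (rmem s2 ''W'' (Suc i)) (rmem s2 ''q'' 0) \<and>
        (\<forall>j. j \<noteq> Suc i \<longrightarrow> rmem s2 ''W'' j = rmem s1 ''W'' j)) \<and> com_frame ChooseItem s1 s2"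
      have e2: "rmem s2 ''e'' 0 = rmem s1 ''e'' 0" using s2 by (simp add: frame_def)
      have "\<forall>j\<in>{1..Suc i}. ?ch j (rmem s2 ''W'' j) ((c(Suc i := rmem s2 ''q'' 0)) j)"
        using s2 c(1) by (auto simp: le_Suc_eq)
      moreover have "(\<Sum>j=1..Suc i. (c(Suc i := r)) j) = (\<Sum>j=1..i. c j) + r" for r
      proof -
        have "(\<Sum>j=1..i. (c(Suc i := r)) j) = (\<Sum>j=1..i. c j)" by (rule sum.cong) auto
        then show ?thesis by simp
      qed
      ultimately have "?I (Suc i) (rwrite ''e'' 0 (rmem s2 ''e'' 0 + rmem s2 ''q'' 0) s2)"
        using c(2) e2 by (intro exI[of _ "c(Suc i := rmem s2 ''q'' 0)"]) auto
      then show "runs (RSet ''e'' (RAdd (RV ''e'') (RV ''q''))) s2 1 (?I (Suc i))"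
        by (intro runs_RWrite) auto
    qed (use G in simp)
  qed (use G s in \<open>auto simp: power2_eq_square frame_def\<close>)
  have T: "22 * G ^ 2 < 23 * G ^ 2" using G by simp
  have ev: "rval (RMul (RV ''K'') (RV ''d'')) s = K 0 * dens_est v L A" using s by simp
  show ?thesis unfolding Cost_def
    by (rule runs_RWrite_Seq[where T' = "22 * G ^ 2"], unfold ev nval.simps, rule runs_post[OF F])
      (use T in \<open>auto simp: outcome_def\<close>)
qed

section \<open>Enumerating all candidates\<close>

text \<open>The test expresses, by de Morgan, that nothing has been stored yet or that
  \<open>e\<close> improves on \<open>best\<close>.\<close>

definition Save :: com where
  "Save = Cond (BNot (BAnd (BNot (NLess (NV ''f'') (NConst 1))) (BNot (RLess (RV ''e'') (RV ''best'')))))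
    (Seq (RSet ''best'' (RV ''e'')) (Seq (NSet ''f'' (NConst 1))
      (For ''i'' (NV ''n'') (RWrite ''T'' (Succ ''i'') (RRead ''W'' (Succ ''i''))))))
    Skip"

lemma runs_Save:
  assumes s: "nmem s ''n'' 0 = n" and G: "1 \<le> G" "n \<le> G"
  shows "runs Save s (8 * G) (\<lambda>s'. if nmem s ''f'' 0 < 1 \<or> rmem s ''e'' 0 < rmem s ''best'' 0
    then nmem s' ''f'' 0 = 1 \<and> rmem s' ''best'' 0 = rmem s ''e'' 0 \<and> (\<forall>i\<in>{1..n}. rmem s' ''T'' i = rmem s ''W'' i)
    else s' = s)"
proof -
  let ?c = "RWrite ''T'' (Succ ''i'') (RRead ''W'' (Succ ''i''))"
  let ?s = "nwrite ''f'' 0 1 (rwrite ''best'' 0 (rmem s ''e'' 0) s)"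
  have F: "runs (For ''i'' (NV ''n'') ?c) ?s (5 * G) (\<lambda>s'. (\<forall>i\<in>{1..n}. rmem s' ''T'' i = rmem s ''W'' i) \<and>
      loop_frame ''i'' ?c ?s s')"
  proof (rule runs_For[where I = "\<lambda>k s'. \<forall>i\<in>{1..k}. rmem s' ''T'' i = rmem s ''W'' i" and N = n and a = 1 and d = 0 and G = G])
    fix k s1 assume I: "\<forall>i\<in>{1..k}. rmem s1 ''T'' i = rmem s ''W'' i" and nk: "nmem s1 ''i'' 0 = k"
      and fr: "loop_frame ''i'' ?c ?s s1"
    have "rmem s1 ''W'' = rmem s ''W''" using fr by (simp add: frame_def)
    then show "runs ?c s1 (1 * G ^ 0) (\<lambda>s'. \<forall>i\<in>{1..Suc k}. rmem s' ''T'' i = rmem s ''W'' i)"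
      using I nk by (intro runs_RWrite) (auto simp: le_Suc_eq)
  qed (use G s in \<open>auto simp: frame_def\<close>)
  show ?thesis unfolding Save_def
  proof (rule runs_Cond[where T' = "7 * G"])
    assume "bval (BNot (BAnd (BNot (NLess (NV ''f'') (NConst 1))) (BNot (RLess (RV ''e'') (RV ''best''))))) s"
    then have b: "nmem s ''f'' 0 < 1 \<or> rmem s ''e'' 0 < rmem s ''best'' 0" by auto
    show "runs (Seq (RSet ''best'' (RV ''e'')) (Seq (NSet ''f'' (NConst 1)) (For ''i'' (NV ''n'') ?c))) s (7 * G)
      (\<lambda>s'. if nmem s ''f'' 0 < 1 \<or> rmem s ''e'' 0 < rmem s ''best'' 0
        then nmem s' ''f'' 0 = 1 \<and> rmem s' ''best'' 0 = rmem s ''e'' 0 \<and> (\<forall>i\<in>{1..n}. rmem s' ''T'' i = rmem s ''W'' i)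
        else s' = s)"
      by (rule runs_RWrite_Seq[where T' = "6 * G"], rule runs_NWrite_Seq[where T' = "5 * G"], unfold nval.simps rval.simps,
          rule runs_post[OF F]) (use b G in \<open>auto simp: frame_def\<close>)
  qed (use G in \<open>auto intro!: runs_Skip\<close>)
qed

definition TryGuess :: com where
  "TryGuess = Seq Decode (Seq Density (Seq Cost Save))"

text \<open>The flag \<open>f\<close> is zero until the first estimate has been stored in \<open>best\<close> and its policy in \<open>T\<close>.\<close>

definition best_of :: "(nat \<times> nat \<Rightarrow> (nat \<Rightarrow> real) \<Rightarrow> real \<Rightarrow> bool) \<Rightarrow> (nat \<times> nat) set \<Rightarrow> state \<Rightarrow> bool" where
  "best_of R S s \<longleftrightarrow> (\<forall>p\<in>S. \<exists>W e. R p W e \<and> rmem s ''best'' 0 \<le> e) \<and>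
    (if nmem s ''f'' 0 < 1 then S = {} else \<exists>p\<in>S. R p (rmem s ''T'') (rmem s ''best'' 0))"

lemma best_of_cong:
  "nmem s' ''f'' = nmem s ''f'' \<Longrightarrow> rmem s' ''T'' = rmem s ''T'' \<Longrightarrow> rmem s' ''best'' = rmem s ''best'' \<Longrightarrow>
    best_of R S s \<Longrightarrow> best_of R S s'"
  by (simp add: best_of_def)

lemma writes_defs [simp]:
  "nat_writes Decode = {''x'', ''y'', ''p'', ''q'', ''r'', ''k''}" "real_writes Decode = {''v''}"
  "nat_writes Density = {''z'', ''a'', ''g'', ''b'', ''k''}" "real_writes Density = {''d'', ''Y''}"
  "nat_writes Cost = {''i'', ''k'', ''l''}" "real_writes Cost = {''e'', ''q'', ''W''}"
  "nat_writes Save = {''f'', ''i''}" "real_writes Save = {''best'', ''T''}"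
  by (auto simp: Decode_def Density_def Cost_def Save_def)

text \<open>Entries lie between \<open>t / B ^ L\<close> and \<open>t * B ^ L\<close>, so
  \<open>B ^ (2 * L) \<le> A\<close> supplies the ratio bound of the density computation. Frames
  work per bank, hence the base time in cell 0 of \<open>v\<close>, which is reused for the next
  counter, has to be carried in the postcondition. The constant is 82 = 27 + 24 + 23 + 8.\<close>

lemma runs_TryGuess:
  assumes s: "nmem s ''n'' 0 = n" "nmem s ''L'' 0 = L" "nmem s ''X'' 0 = X" "nmem s ''A'' 0 = A" "nmem s ''B'' 0 = B"
      "nmem s ''c'' 0 = c" "rmem s ''K'' = K" "rmem s ''H'' = H" "rmem s ''v'' 0 = t"
    and G: "L \<le> G" "X \<le> G" "1 \<le> G" "n \<le> G" "A \<le> G" "c \<le> G" and B: "B \<ge> 1" and L: "L \<ge> 1" and t: "t > 0"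
    and A: "B ^ (2 * L) \<le> A"
    and R: "R p = outcome K H n L X A (guess B c t)" and b: "best_of R S s"
  shows "runs TryGuess s (82 * G ^ 5) (\<lambda>s'. best_of R (insert p S) s' \<and> rmem s' ''v'' 0 = t)"
proof -
  have fr0: "com_frame Decode s s1" if "frame {''x'', ''y'', ''p'', ''q'', ''r'', ''k''} {''v''} s s1" for s1
    using that by simp
  have pw: "G \<le> G ^ 5" "G ^ 2 \<le> G ^ 5" using G by (auto intro: power_increasing self_le_power)
  show ?thesis unfolding TryGuess_def
  proof (rule runs_Seq[OF runs_Decode[OF s(5,2,6,9) B G(6,1,3)]])
    fix s1 assume a1: "(\<forall>i\<le>L. rmem s1 ''v'' i = guess B c t i) \<and> frame {''x'', ''y'', ''p'', ''q'', ''r'', ''k''} {''v''} s s1"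
    define v where "v = rmem s1 ''v''"
    have v0: "v 0 = t" using a1 unfolding v_def by force
    have v: "\<And>i. i \<le> L \<Longrightarrow> v i = guess B c t i" using a1 unfolding v_def by blast
    have bnd: "t / real B ^ L \<le> v i \<and> v i \<le> t * real B ^ L \<and> v i > 0" if "i \<le> L" for i
    proof -
      have pw: "real B ^ i \<le> real B ^ L" using that B by (intro power_increasing) auto
      have "t / real B ^ L \<le> t / real B ^ i" "t * real B ^ i \<le> t * real B ^ L"
        using t B pw by (auto intro!: divide_left_mono)
      then show ?thesis using is_chain_bounds[OF guess_is_chain[OF B] t that, where c1 = c] v[OF that] by force
    qed
    have ratio: "v k \<le> real A * v i" if "i \<le> L" "k \<le> L" for i k
    proof -
      have "v k \<le> t * real B ^ L" using bnd that by blast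
      also have "\<dots> = real (B ^ (2 * L)) * (t / real B ^ L)" using B by (simp add: mult_2 power_add)
      also have "\<dots> \<le> real A * v i" using bnd[OF that(1)] t A by (intro mult_mono of_nat_mono) auto
      finally show ?thesis .
    qed
    have s1: "nmem s1 ''n'' 0 = n" "nmem s1 ''L'' 0 = L" "nmem s1 ''X'' 0 = X" "nmem s1 ''A'' 0 = A"
        "rmem s1 ''K'' = K" "rmem s1 ''H'' = H" "nmem s1 ''f'' = nmem s ''f''" "rmem s1 ''T'' = rmem s ''T''"
        "rmem s1 ''best'' = rmem s ''best''"
      using a1 s by (simp_all add: frame_def)
    have D: "runs Density s1 (24 * G ^ 5) (\<lambda>s'. rmem s' ''d'' 0 = dens_est v L A)"
      by (rule runs_Density[OF s1(4,2) v_def[symmetric]]) (use bnd ratio G in auto)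
    show "runs (Seq Density (Seq Cost Save)) s1 (24 * G ^ 5 + 31 * G ^ 2) (\<lambda>s'. best_of R (insert p S) s' \<and> rmem s' ''v'' 0 = t)"
    proof (rule runs_Seq[OF runs_frame[OF D]])
      fix s2 assume a2: "rmem s2 ''d'' 0 = dens_est v L A \<and> com_frame Density s1 s2"
      have s2: "nmem s2 ''n'' 0 = n" "nmem s2 ''L'' 0 = L" "nmem s2 ''X'' 0 = X" "rmem s2 ''v'' = v" "rmem s2 ''K'' = K"
          "rmem s2 ''H'' = H" "nmem s2 ''f'' = nmem s ''f''" "rmem s2 ''T'' = rmem s ''T''" "rmem s2 ''best'' = rmem s ''best''"
        using a2 s1 by (simp_all add: frame_def v_def)
      show "runs (Seq Cost Save) s2 (31 * G ^ 2) (\<lambda>s'. best_of R (insert p S) s' \<and> rmem s' ''v'' 0 = t)"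
      proof (rule runs_Seq[OF runs_frame[OF runs_Cost[OF s2(1-6) conjunct1[OF a2] G(1-4)]]])
        fix s3 assume a3: "outcome K H n L X A v (rmem s3 ''W'') (rmem s3 ''e'' 0) \<and> com_frame Cost s2 s3"
        have s3: "nmem s3 ''n'' 0 = n" "nmem s3 ''f'' = nmem s ''f''" "rmem s3 ''T'' = rmem s ''T''" "rmem s3 ''best'' = rmem s ''best''"
          "rmem s3 ''v'' = v"
          using a3 s2 by (simp_all add: frame_def)
        have b3: "best_of R S s3" using best_of_cong[OF s3(2-4) b] .
        have o3: "R p W (rmem s3 ''e'' 0)" if "\<forall>i\<in>{1..n}. W i = rmem s3 ''W'' i" for W
          unfolding R using a3 that by (subst outcome_cong[OF v[symmetric] L, where W' = "rmem s3 ''W''"]) auto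
        show "runs Save s3 (8 * G ^ 2) (\<lambda>s'. best_of R (insert p S) s' \<and> rmem s' ''v'' 0 = t)"
        proof (rule runs_conseq[OF runs_frame[OF runs_Save[OF s3(1) G(3,4)]]])
          fix s4
          assume a4: "(if nmem s3 ''f'' 0 < 1 \<or> rmem s3 ''e'' 0 < rmem s3 ''best'' 0
            then nmem s4 ''f'' 0 = 1 \<and> rmem s4 ''best'' 0 = rmem s3 ''e'' 0 \<and> (\<forall>i\<in>{1..n}. rmem s4 ''T'' i = rmem s3 ''W'' i)
            else s4 = s3) \<and> com_frame Save s3 s4"
          have "rmem s4 ''v'' 0 = t" using a4 s3(5) v0 by (simp add: frame_def)
          moreover have "best_of R (insert p S) s4"
          proof (cases "nmem s3 ''f'' 0 < 1 \<or> rmem s3 ''e'' 0 < rmem s3 ''best'' 0")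
            case True
            then have s4: "nmem s4 ''f'' 0 = 1" "rmem s4 ''best'' 0 = rmem s3 ''e'' 0"
              "R p (rmem s4 ''T'') (rmem s3 ''e'' 0)" using a4 o3 by auto
            have "\<exists>W e. R p' W e \<and> rmem s3 ''e'' 0 \<le> e" if "p' \<in> S" for p'
            proof (cases "nmem s3 ''f'' 0 < 1")
              case True
              then show ?thesis using b3 that unfolding best_of_def by auto
            next
              case False
              then have "rmem s3 ''e'' 0 \<le> rmem s3 ''best'' 0" using \<open>nmem s3 ''f'' 0 < 1 \<or> _\<close> by auto
              then show ?thesis using b3 that unfolding best_of_def by (meson order_trans)
            qed
            then show ?thesis using s4 unfolding best_of_def by auto
          next
            case False
            then have "s4 = s3" using a4 by simp
            moreover have "\<exists>W e. R p W e \<and> rmem s3 ''best'' 0 \<le> e" using o3[of "rmem s3 ''W''"] False by force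
            ultimately show ?thesis using b3 False unfolding best_of_def by auto
          qed
          ultimately show "best_of R (insert p S) s4 \<and> rmem s4 ''v'' 0 = t" by blast
        qed (use G self_le_power[of G 2] in simp)
      qed simp
    qed simp
  qed (use pw in simp)
qed

text \<open>No sorting takes place: the initial segment belonging to \<open>j\<close> is recognized
  by comparing ratios in one pass. Program counters start at 0, so the cells read are those of
  commodities \<open>i + 1\<close> and \<open>j + 1\<close>.\<close>

definition BaseTime :: com where
  "BaseTime = (let i = Succ ''i''; j = Succ ''j'' in
    Seq (RSet ''u'' (RV ''K'')) (Seq (RSet ''w'' (ROfNat (NConst 0))) (Seq
      (For ''i'' (NV ''n'') (Cond (RLess (RDiv (RRead ''K'' j) (RRead ''H'' j)) (RDiv (RRead ''K'' i) (RRead ''H'' i)))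
        Skip (Seq (RSet ''u'' (RAdd (RV ''u'') (RRead ''K'' i))) (RSet ''w'' (RAdd (RV ''w'') (RRead ''H'' i))))))
      (RSet ''v'' (RSqrt (RDiv (RV ''u'') (RV ''w'')))))))"

lemma writes_BaseTime [simp]: "nat_writes BaseTime = {''i''}" "real_writes BaseTime = {''u'', ''w'', ''v''}"
  by (auto simp: BaseTime_def Let_def)

lemma runs_BaseTime:
  assumes s: "nmem s ''n'' 0 = n" "nmem s ''j'' 0 = j" "rmem s ''K'' = K" "rmem s ''H'' = H"
    and G: "1 \<le> G" "n \<le> G"
  shows "runs BaseTime s (10 * G) (\<lambda>s'. rmem s' ''v'' 0 = base_time K H n (Suc j))"
proof -
  let ?i = "Succ ''i''" and ?j = "Succ ''j''"
  let ?c = "Cond (RLess (RDiv (RRead ''K'' ?j) (RRead ''H'' ?j)) (RDiv (RRead ''K'' ?i) (RRead ''H'' ?i)))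
        Skip (Seq (RSet ''u'' (RAdd (RV ''u'') (RRead ''K'' ?i))) (RSet ''w'' (RAdd (RV ''w'') (RRead ''H'' ?i))))"
  let ?s = "rwrite ''w'' 0 0 (rwrite ''u'' 0 (K 0) s)"
  let ?S = "\<lambda>k. {i\<in>{1..k}. \<not> K (Suc j) / H (Suc j) < K i / H i}"
  let ?I = "\<lambda>k s1. rmem s1 ''u'' 0 = K 0 + (\<Sum>i\<in>?S k. K i) \<and> rmem s1 ''w'' 0 = (\<Sum>i\<in>?S k. H i)"
  have F: "runs (For ''i'' (NV ''n'') ?c) ?s (7 * G) (\<lambda>s'. ?I n s' \<and>
      loop_frame ''i'' ?c ?s s')"
  proof (rule runs_For[where I = ?I and N = n and a = 3 and d = 0 and G = G])
    fix k s1 assume I: "?I k s1" and nk: "nmem s1 ''i'' 0 = k"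
      and fr: "loop_frame ''i'' ?c ?s s1"
    have s1: "nmem s1 ''j'' 0 = j" "rmem s1 ''K'' = K" "rmem s1 ''H'' = H" using fr s by (simp_all add: frame_def)
    have S: "?S (Suc k) = (if K (Suc j) / H (Suc j) < K (Suc k) / H (Suc k) then ?S k else insert (Suc k) (?S k))"
      by (auto simp: le_Suc_eq)
    have fin: "finite (?S k)" "Suc k \<notin> ?S k" by auto
    have b: "bval (RLess (RDiv (RRead ''K'' ?j) (RRead ''H'' ?j)) (RDiv (RRead ''K'' ?i) (RRead ''H'' ?i))) s1 \<longleftrightarrow>
        K (Suc j) / H (Suc j) < K (Suc k) / H (Suc k)" using s1 nk by simp
    show "runs ?c s1 (3 * G ^ 0) (?I (Suc k))"
    proof (rule runs_Cond[where T' = 2], unfold b)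
      assume "K (Suc j) / H (Suc j) < K (Suc k) / H (Suc k)"
      then show "runs Skip s1 2 (?I (Suc k))" using I S by (intro runs_Skip) auto
    next
      assume "\<not> K (Suc j) / H (Suc j) < K (Suc k) / H (Suc k)"
      then show "runs (Seq (RSet ''u'' (RAdd (RV ''u'') (RRead ''K'' ?i))) (RSet ''w'' (RAdd (RV ''w'') (RRead ''H'' ?i)))) s1 2 (?I (Suc k))"
        using I S fin s1 nk by (intro runs_RWrite_Seq[where T' = 1] runs_RWrite) auto
    qed simp
  qed (use G s in \<open>auto simp: frame_def\<close>)
  have K0: "rval (RV ''K'') s = K 0" using s by simp
  show ?thesis unfolding BaseTime_def Let_def
  proof (rule runs_RWrite_Seq[where T' = "9 * G"], rule runs_RWrite_Seq[where T' = "8 * G"], unfold K0,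
      unfold nval.simps rval.simps of_nat_0, rule runs_Seq[OF F])
    fix s1 assume "?I n s1 \<and> loop_frame ''i'' ?c ?s s1"
    then show "runs (RSet ''v'' (RSqrt (RDiv (RV ''u'') (RV ''w'')))) s1 G (\<lambda>s'. rmem s' ''v'' 0 = base_time K H n (Suc j))"
      using G by (intro runs_RWrite) (auto simp: base_time_def)
  qed (use G in auto)
qed

text \<open>\<open>A\<close> may serve as the bound for the counter \<open>c\<close> because the
  parameters are set so that \<open>A = B ^ (3 * L)\<close>.\<close>

definition Search :: com where
  "Search = Seq (NSet ''f'' (NConst 0)) (For ''j'' (NV ''n'') (Seq BaseTime (For ''c'' (NV ''A'') TryGuess)))"

lemma writes_TryGuess [simp]:
  "nat_writes TryGuess = {''x'', ''y'', ''p'', ''q'', ''r'', ''k'', ''z'', ''a'', ''g'', ''b'', ''i'', ''l'', ''f''}"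
  "real_writes TryGuess = {''v'', ''d'', ''Y'', ''e'', ''q'', ''W'', ''best'', ''T''}"
  by (auto simp: TryGuess_def)

text \<open>Pairs are evaluated in lexicographic order, and both loops maintain
  \<open>best_of\<close> for the pairs done so far. They raise the exponent from 5 to 7.\<close>

lemma runs_Search:
  assumes s: "nmem s ''n'' 0 = n" "nmem s ''L'' 0 = L" "nmem s ''X'' 0 = X" "nmem s ''A'' 0 = A" "nmem s ''B'' 0 = B"
      "rmem s ''K'' = K" "rmem s ''H'' = H"
    and G: "L \<le> G" "X \<le> G" "1 \<le> G" "n \<le> G" "A \<le> G" and B: "B \<ge> 1" and L: "L \<ge> 1"
    and t: "\<And>j. j \<in> {1..n} \<Longrightarrow> base_time K H n j > 0" and A: "B ^ (2 * L) \<le> A"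
  shows "runs Search s (101 * G ^ 7) (best_of (\<lambda>(j, c). outcome K H n L X A (guess B c (base_time K H n (Suc j))))
    ({..<n} \<times> {..<A}))"
proof -
  let ?R = "\<lambda>(j, c). outcome K H n L X A (guess B c (base_time K H n (Suc j)))"
  let ?inner = "For ''c'' (NV ''A'') TryGuess"
  let ?c = "Seq BaseTime ?inner"
  let ?s = "nwrite ''f'' 0 0 s"
  let ?I = "\<lambda>j. best_of ?R ({..<j} \<times> {..<A})"
  have F: "runs (For ''j'' (NV ''n'') ?c) ?s (100 * G ^ 7) (\<lambda>s'. ?I n s' \<and>
      loop_frame ''j'' ?c ?s s')"
  proof (rule runs_For[where I = ?I and N = n and a = 96 and d = 6 and G = G])
    show "nval (NV ''n'') s1 = n" if "loop_frame ''j'' ?c ?s s1" for s1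
      using that s by (simp add: frame_def)
    show "?I 0 ?s" by (simp add: best_of_def)
    show "?I k (nwrite ''j'' 0 v s1)" if "?I k s1" for k s1 v
      by (rule best_of_cong[OF _ _ _ that]) simp_all
    fix j s1 assume j: "j < n" and I: "?I j s1" and nj: "nmem s1 ''j'' 0 = j"
      and fr: "loop_frame ''j'' ?c ?s s1"
    have s1: "nmem s1 ''n'' 0 = n" "nmem s1 ''L'' 0 = L" "nmem s1 ''X'' 0 = X" "nmem s1 ''A'' 0 = A" "nmem s1 ''B'' 0 = B"
      "rmem s1 ''K'' = K" "rmem s1 ''H'' = H" using fr s by (simp_all add: frame_def)
    have tj: "base_time K H n (Suc j) > 0" using t j by simp
    show "runs ?c s1 (96 * G ^ 6) (?I (Suc j))"
    proof (rule runs_Seq[OF runs_frame[OF runs_BaseTime[OF s1(1) nj s1(6,7) G(3,4)]]])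
      fix s2 assume a2: "rmem s2 ''v'' 0 = base_time K H n (Suc j) \<and> com_frame BaseTime s1 s2"
      have s2: "nmem s2 ''n'' 0 = n" "nmem s2 ''L'' 0 = L" "nmem s2 ''X'' 0 = X" "nmem s2 ''A'' 0 = A" "nmem s2 ''B'' 0 = B"
        "rmem s2 ''K'' = K" "rmem s2 ''H'' = H" using a2 s1 by (simp_all add: frame_def)
      have I2: "?I j s2" by (rule best_of_cong[OF _ _ _ I]) (use a2 in \<open>simp_all add: frame_def\<close>)
      let ?J = "\<lambda>c s3. best_of ?R ({..<j} \<times> {..<A} \<union> {j} \<times> {..<c}) s3 \<and> rmem s3 ''v'' 0 = base_time K H n (Suc j)"
      show "runs ?inner s2 (86 * G ^ 6) (?I (Suc j))"
      proof (rule runs_post[OF runs_For[where I = ?J and N = A and a = 82 and d = 5 and G = G]])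
        show "nval (NV ''A'') s3 = A" if "loop_frame ''c'' TryGuess s2 s3" for s3
          using that s2 by (simp add: frame_def)
        show "?J 0 s2" using I2 a2 by simp
        show "?J k (nwrite ''c'' 0 v s3)" if "?J k s3" for k s3 v
          using that best_of_cong[of "nwrite ''c'' 0 v s3" s3] by simp
        fix c s3 assume c: "c < A" and J: "?J c s3" and nc: "nmem s3 ''c'' 0 = c"
          and fr3: "loop_frame ''c'' TryGuess s2 s3"
        have s3: "nmem s3 ''n'' 0 = n" "nmem s3 ''L'' 0 = L" "nmem s3 ''X'' 0 = X" "nmem s3 ''A'' 0 = A" "nmem s3 ''B'' 0 = B"
          "rmem s3 ''K'' = K" "rmem s3 ''H'' = H" using fr3 s2 by (simp_all add: frame_def)
        have cG: "c \<le> G" using c G by simp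
        let ?S = "{..<j} \<times> {..<A} \<union> {j} \<times> {..<c}"
        have "insert (j, c) ?S = {..<j} \<times> {..<A} \<union> {j} \<times> {..<Suc c}" by auto
        moreover have "runs TryGuess s3 (82 * G ^ 5) (\<lambda>s'. best_of ?R (insert (j, c) ?S) s' \<and> rmem s' ''v'' 0 = base_time K H n (Suc j))"
          by (rule runs_TryGuess[OF s3(1-5) nc s3(6,7) conjunct2[OF J] G cG B L tj A _ conjunct1[OF J]]) simp
        ultimately show "runs TryGuess s3 (82 * G ^ 5) (?J (Suc c))" by simp
      next
        fix s'
        have "{..<j} \<times> {..<A} \<union> {j} \<times> {..<A} = {..<Suc j} \<times> {..<A}" by auto
        then show "?J A s' \<and> loop_frame ''c'' TryGuess s2 s' \<Longrightarrow> ?I (Suc j) s'"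
          by simp
      qed (use G in \<open>auto simp: power_numeral_reduce\<close>)
    qed (use G self_le_power[of G 6] in simp)
  qed (use G in \<open>auto simp: power_numeral_reduce BaseTime_def Let_def\<close>)
  have T: "100 * G ^ 7 < 101 * G ^ 7" using G by simp
  show ?thesis unfolding Search_def
    by (rule runs_NWrite_Seq[where T' = "100 * G ^ 7"], unfold nval.simps, rule runs_post[OF F]) (use T in auto)
qed

section \<open>Parameters and the main theorem\<close>

text \<open>Powers of two are tried so that the logarithm of \<open>m\<close> is an integer,
  available as \<open>s\<close> for the later products.\<close>

definition Double :: com where
  "Double = While (RLess (RMul (ROfNat (NV ''m'')) (RV ''eps'')) (ROfNat (NConst 32)))
    (Seq (NSet ''m'' (NAdd (NV ''m'') (NV ''m''))) (NSet ''s'' (Succ ''s'')))"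

lemma writes_Double [simp]: "nat_writes Double = {''m'', ''s''}" "real_writes Double = {}"
  by (auto simp: Double_def)

lemma runs_Double:
  assumes s: "nmem s ''m'' 0 = 2" "nmem s ''s'' 0 = 1" "rmem s ''eps'' 0 = \<epsilon>"
    and S: "S \<ge> 1" "32 \<le> 2 ^ S * \<epsilon>" "\<And>r. 1 \<le> r \<Longrightarrow> r < S \<Longrightarrow> 2 ^ r * \<epsilon> < 32"
  shows "runs Double s (1 + 3 * S) (\<lambda>s'. nmem s' ''s'' 0 = S \<and> nmem s' ''m'' 0 = 2 ^ S)"
proof -
  let ?I = "\<lambda>s1. 1 \<le> nmem s1 ''s'' 0 \<and> nmem s1 ''s'' 0 \<le> S \<and> nmem s1 ''m'' 0 = 2 ^ nmem s1 ''s'' 0 \<and> rmem s1 ''eps'' 0 = \<epsilon>"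
  let ?b = "RLess (RMul (ROfNat (NV ''m'')) (RV ''eps'')) (ROfNat (NConst 32))"
  let ?c = "Seq (NSet ''m'' (NAdd (NV ''m'') (NV ''m''))) (NSet ''s'' (Succ ''s''))"
  have "runs (While ?b ?c) s (1 + (S - nmem s ''s'' 0) * (2 + 1)) (\<lambda>s'. ?I s' \<and> \<not> bval ?b s')"
  proof (rule runs_While[where V = "\<lambda>s. S - nmem s ''s'' 0"])
    show "?I s" using s S by simp
    fix s1 assume I: "?I s1" and b: "bval ?b s1"
    then have "2 ^ nmem s1 ''s'' 0 * \<epsilon> < 32" by auto
    then have "nmem s1 ''s'' 0 \<noteq> S" using S(2) by auto
    then have "nmem s1 ''s'' 0 < S" using I by simp
    then show "runs ?c s1 2 (\<lambda>s2. ?I s2 \<and> S - nmem s2 ''s'' 0 < S - nmem s1 ''s'' 0)"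
      using I by (intro runs_NWrite_Seq[where T' = 1] runs_NWrite) auto
  qed
  then show ?thesis unfolding Double_def
  proof (rule runs_conseq)
    fix s' assume a: "?I s' \<and> \<not> bval ?b s'"
    then have "\<not> 2 ^ nmem s' ''s'' 0 * \<epsilon> < 32" by auto
    then have "nmem s' ''s'' 0 = S" using a S(3)[of "nmem s' ''s'' 0"] by force
    then show "nmem s' ''s'' 0 = S \<and> nmem s' ''m'' 0 = 2 ^ S" using a by simp
  qed (use s in simp)
qed

definition NDouble :: "nexp \<Rightarrow> nexp" where "NDouble e = NAdd e e"

text \<open>Three doublings give the exponent \<open>8 * s\<close> of \<open>B\<close>. With
  \<open>P = L * s\<close>, three doublings of \<open>P + 2 * P\<close> give the exponent
  \<open>24 * L * s\<close> of \<open>A\<close>.\<close>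

definition Parameters :: com where
  "Parameters = Seq (NSet ''m'' (NConst 2)) (Seq (NSet ''s'' (NConst 1)) (Seq Double
    (Seq (Mul ''L'' ''i'' (NV ''m'') (NV ''s''))
    (Seq (Mul ''P'' ''i'' (NV ''L'') (NV ''s''))
    (Seq (Pow2 ''B'' ''i'' (NDouble (NDouble (NDouble (NV ''s'')))))
    (Seq (Pow2 ''A'' ''i'' (NDouble (NDouble (NDouble (NAdd (NV ''P'') (NDouble (NV ''P'')))))))
         (Mul ''X'' ''i'' (NV ''n'') (NV ''m''))))))))"

lemma runs_Parameters:
  assumes s: "nmem s ''n'' 0 = n" "rmem s ''eps'' 0 = \<epsilon>"
    and S: "S \<ge> 1" "32 \<le> 2 ^ S * \<epsilon>" "\<And>r. 1 \<le> r \<Longrightarrow> r < S \<Longrightarrow> 2 ^ r * \<epsilon> < 32"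
    and G: "2 ^ S * S * S * 24 \<le> G" "n \<le> G"
  shows "runs Parameters s (40 * G) (\<lambda>s'. nmem s' ''n'' 0 = n \<and> nmem s' ''L'' 0 = 2 ^ S * S \<and>
    nmem s' ''X'' 0 = n * 2 ^ S \<and> nmem s' ''B'' 0 = 2 ^ (8 * S) \<and> nmem s' ''A'' 0 = 2 ^ (24 * (2 ^ S * S * S)) \<and> rmem s' = rmem s)"
proof -
  let ?Q = "\<lambda>s'. nmem s' ''n'' 0 = n \<and> nmem s' ''L'' 0 = 2 ^ S * S \<and> nmem s' ''X'' 0 = n * 2 ^ S \<and>
    nmem s' ''B'' 0 = 2 ^ (8 * S) \<and> nmem s' ''A'' 0 = 2 ^ (24 * (2 ^ S * S * S)) \<and> rmem s' = rmem s"
  let ?c3 = "Mul ''L'' ''i'' (NV ''m'') (NV ''s'')"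
  let ?c4 = "Mul ''P'' ''i'' (NV ''L'') (NV ''s'')"
  let ?c5 = "Pow2 ''B'' ''i'' (NDouble (NDouble (NDouble (NV ''s''))))"
  let ?c6 = "Pow2 ''A'' ''i'' (NDouble (NDouble (NDouble (NAdd (NV ''P'') (NDouble (NV ''P''))))))"
  let ?c7 = "Mul ''X'' ''i'' (NV ''n'') (NV ''m'')"
  let ?m = "2 ^ S :: nat"
  have "1 \<le> ?m" "?m \<le> ?m * S" "S \<le> ?m * S" "?m * S \<le> ?m * S * S" using S(1) by auto
  then have G': "1 \<le> G" "S \<le> G" "?m \<le> G" "?m * S \<le> G" "8 * S \<le> G" "24 * (?m * S * S) \<le> G" using G(1) by linarith+
  let ?fr = "\<lambda>X s s'. frame X {} s s'"
  let ?s1 = "nwrite ''s'' 0 1 (nwrite ''m'' 0 2 s)"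
  show ?thesis unfolding Parameters_def
  proof (rule runs_NWrite_Seq[where T' = "38 * G + 1"], rule runs_NWrite_Seq[where T' = "38 * G"], unfold nval.simps,
      rule runs_Seq[OF runs_frame[OF runs_Double[OF _ _ _ S]]])
    show "nmem ?s1 ''m'' 0 = 2" "nmem ?s1 ''s'' 0 = 1" "rmem ?s1 ''eps'' 0 = \<epsilon>" using s by simp_all
    fix s2 assume a2: "(nmem s2 ''s'' 0 = S \<and> nmem s2 ''m'' 0 = 2 ^ S) \<and> com_frame Double ?s1 s2"
    have s2: "nmem s2 ''s'' 0 = S" "nmem s2 ''m'' 0 = ?m" "nmem s2 ''n'' 0 = n" "rmem s2 = rmem s"
      using a2 s by (auto simp: frame_def)
    have 3: "runs ?c3 s2 (6 * G) (\<lambda>s'. nmem s' ''L'' 0 = ?m * S \<and> ?fr {''L'', ''i''} s2 s')"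
      by (rule runs_Mul) (use s2 G' in \<open>auto simp: frame_def\<close>)
    show "runs (Seq ?c3 (Seq ?c4 (Seq ?c5 (Seq ?c6 ?c7)))) s2 (30 * G) ?Q"
    proof (rule runs_Seq[OF 3])
      fix s3 assume a3: "nmem s3 ''L'' 0 = ?m * S \<and> ?fr {''L'', ''i''} s2 s3"
      have s3: "nmem s3 ''s'' 0 = S" "nmem s3 ''m'' 0 = ?m" "nmem s3 ''n'' 0 = n" "rmem s3 = rmem s" "nmem s3 ''L'' 0 = ?m * S"
        using a3 s2 by (auto simp: frame_def)
      have 4: "runs ?c4 s3 (6 * G) (\<lambda>s'. nmem s' ''P'' 0 = ?m * S * S \<and> ?fr {''P'', ''i''} s3 s')"
        by (rule runs_Mul) (use s3 G' in \<open>auto simp: frame_def\<close>)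
      show "runs (Seq ?c4 (Seq ?c5 (Seq ?c6 ?c7))) s3 (24 * G) ?Q"
      proof (rule runs_Seq[OF 4])
        fix s4 assume a4: "nmem s4 ''P'' 0 = ?m * S * S \<and> ?fr {''P'', ''i''} s3 s4"
        have s4: "nmem s4 ''s'' 0 = S" "nmem s4 ''m'' 0 = ?m" "nmem s4 ''n'' 0 = n" "rmem s4 = rmem s"
          "nmem s4 ''L'' 0 = ?m * S" "nmem s4 ''P'' 0 = ?m * S * S"
          using a4 s3 by (auto simp: frame_def)
        have 5: "runs ?c5 s4 (6 * G)
            (\<lambda>s'. nmem s' ''B'' 0 = 2 ^ (8 * S) \<and> ?fr {''B'', ''i''} s4 s')"
          by (rule runs_Pow2) (use s4 G' in \<open>auto simp: frame_def NDouble_def\<close>)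
        show "runs (Seq ?c5 (Seq ?c6 ?c7)) s4 (18 * G) ?Q"
        proof (rule runs_Seq[OF 5])
          fix s5 assume a5: "nmem s5 ''B'' 0 = 2 ^ (8 * S) \<and> ?fr {''B'', ''i''} s4 s5"
          have s5: "nmem s5 ''m'' 0 = ?m" "nmem s5 ''n'' 0 = n" "rmem s5 = rmem s"
            "nmem s5 ''L'' 0 = ?m * S" "nmem s5 ''P'' 0 = ?m * S * S" "nmem s5 ''B'' 0 = 2 ^ (8 * S)"
            using a5 s4 by (auto simp: frame_def)
          have 6: "runs ?c6 s5 (6 * G)
              (\<lambda>s'. nmem s' ''A'' 0 = 2 ^ (24 * (?m * S * S)) \<and> ?fr {''A'', ''i''} s5 s')"
            by (rule runs_Pow2) (use s5 G' in \<open>auto simp: frame_def NDouble_def\<close>)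
          show "runs (Seq ?c6 ?c7) s5 (12 * G) ?Q"
          proof (rule runs_Seq[OF 6])
            fix s6 assume a6: "nmem s6 ''A'' 0 = 2 ^ (24 * (?m * S * S)) \<and> ?fr {''A'', ''i''} s5 s6"
            have s6: "nmem s6 ''m'' 0 = ?m" "nmem s6 ''n'' 0 = n" "rmem s6 = rmem s"
              "nmem s6 ''L'' 0 = ?m * S" "nmem s6 ''B'' 0 = 2 ^ (8 * S)" "nmem s6 ''A'' 0 = 2 ^ (24 * (?m * S * S))"
              using a6 s5 by (auto simp: frame_def)
            have 7: "runs ?c7 s6 (6 * G) (\<lambda>s'. nmem s' ''X'' 0 = n * ?m \<and> ?fr {''X'', ''i''} s6 s')"
              by (rule runs_Mul) (use s6 G' G in \<open>auto simp: frame_def\<close>)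
            show "runs ?c7 s6 (6 * G) ?Q"
              by (rule runs_post[OF 7]) (use s6 in \<open>auto simp: frame_def\<close>)
          qed simp
        qed simp
      qed simp
    qed simp
  qed (use G' in auto)
qed

text \<open>By Bernoulli \<open>(1 + 1 / m) ^ m \<ge> 2\<close>, so \<open>m * S\<close> classes
  reach \<open>2 ^ S = m\<close>. From \<open>S \<le> 2 ^ S\<close> follows
  \<open>L \<le> m ^ 2\<close>, so \<open>B = m ^ 8\<close> meets the polynomial requirements. As a
  power of two, \<open>B ^ (2 * L)\<close> has exponent \<open>16 * L * S\<close>; the remaining
  \<open>8 * L * S\<close> in the exponent of \<open>A\<close> absorb the factors
  \<open>2 ^ (L + 2)\<close> and \<open>m\<close>.\<close>

lemma parameter_bounds:
  assumes S: "S \<ge> 1" and defs: "m = 2 ^ S" "L = m * S" "B = 2 ^ (8 * S)" "A = 2 ^ (24 * (L * S))"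
  shows "real m \<le> (1 + 1 / real m) ^ L" "m ^ 6 \<le> B" "L ^ 2 * m \<le> B" "L \<le> B"
    "2 ^ (L + 2) * m * B ^ (2 * L) \<le> A" "B ^ (2 * L) \<le> A" "B ^ (3 * L) = A" "m \<le> A" "L \<le> A" "m * S * S * 24 \<le> A"
proof -
  have m: "m \<ge> 2" using S defs(1) self_le_power[of 2 S] by simp
  have "real m = 2 ^ S" by (simp add: defs)
  also have "\<dots> \<le> ((1 + 1 / real m) ^ m) ^ S"
  proof (rule power_mono)
    have "1 + real m * (1 / real m) \<le> (1 + 1 / real m) ^ m"
      by (rule Bernoulli_inequality) (simp add: order_trans[of "-1" 0])
    then show "2 \<le> (1 + 1 / real m) ^ m" using m by simp
  qed simp
  finally show "real m \<le> (1 + 1 / real m) ^ L" by (simp add: defs(2) power_mult)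
  have pm: "m ^ k = 2 ^ (S * k)" for k by (simp add: defs(1) power_mult)
  show "m ^ 6 \<le> B" unfolding pm defs(3) by (rule power_increasing) auto
  have Sm: "S \<le> m" unfolding defs(1) by (simp add: less_imp_le)
  have Lm: "L \<le> m ^ 2" unfolding defs(2) using Sm by (simp add: power2_eq_square)
  have "L ^ 2 * m \<le> (m ^ 2) ^ 2 * m" by (intro mult_right_mono power_mono Lm) auto
  also have "\<dots> = m ^ 5" by (simp add: power_numeral_reduce)
  also have "\<dots> \<le> B" unfolding pm defs(3) by (rule power_increasing) auto
  finally show "L ^ 2 * m \<le> B" .
  have "m ^ 2 \<le> B" unfolding pm defs(3) by (rule power_increasing) auto
  then show "L \<le> B" using Lm by linarith
  have L: "2 \<le> L" "S \<le> L" unfolding defs(2) using S m mult_le_mono[of 2 m 1 S] mult_le_mono[of 1 m S S] by auto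
  have LS: "L \<le> L * S" using S by simp
  have "2 ^ (L + 2) * m * B ^ (2 * L) = 2 ^ (L + 2 + S + 8 * S * (2 * L))"
    unfolding defs(3) power_mult[symmetric] by (simp only: defs(1) power_add)
  also have "\<dots> \<le> A" unfolding defs(4)
  proof (rule power_increasing)
    have "8 * S * (2 * L) = 16 * (L * S)" by simp
    then show "L + 2 + S + 8 * S * (2 * L) \<le> 24 * (L * S)" using L LS by linarith
  qed simp
  finally show "2 ^ (L + 2) * m * B ^ (2 * L) \<le> A" .
  show "B ^ (3 * L) = A" unfolding defs(3,4) by (simp add: power_mult[symmetric] mult.commute mult.left_commute)
  have B1: "B \<ge> 1" unfolding defs(3) by simp
  show "B ^ (2 * L) \<le> A" unfolding \<open>B ^ (3 * L) = A\<close>[symmetric] using B1 by (intro power_increasing) auto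
  have big: "24 * (L * S) \<le> A" unfolding defs(4) by (rule less_imp_le[OF less_exp])
  then show "m * S * S * 24 \<le> A" by (simp add: defs(2) mult.commute)
  show "L \<le> A" using big LS by linarith
  have "m \<le> L" unfolding defs(2) using S by simp
  then show "m \<le> A" using \<open>L \<le> A\<close> by linarith
qed

text \<open>The left-hand side is \<open>A ^ 8\<close>, as 192 = 8 * 24. For large
  \<open>\<epsilon>\<close> the doubling stops at \<open>S = 1\<close>, where \<open>m\<close> is
  not controlled by \<open>1 / \<epsilon>\<close> but the exponent is the constant 384. Otherwise
  \<open>2 ^ S < 64 / \<epsilon>\<close> and \<open>S \<le> 14 * ln (2 + 1 / \<epsilon>)\<close>,
  and 2408448 = 192 * 64 * 14 ^ 2.\<close>

lemma runtime_bound: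
  fixes \<epsilon> :: real
  assumes e: "\<epsilon> > 0" and S: "S \<ge> 1" "S = 1 \<or> 2 ^ S * \<epsilon> < 64"
  shows "real (2 ^ (192 * (2 ^ S * S * S))) \<le> 2 ^ 384 * 2 powr (2408448 * (1 / \<epsilon>) * ln (2 + 1 / \<epsilon>) ^ 2)"
proof (cases "S = 1")
  case True
  have "0 \<le> 2408448 * (1 / \<epsilon>) * ln (2 + 1 / \<epsilon>) ^ 2" using e by simp
  then have "1 \<le> 2 powr (2408448 * (1 / \<epsilon>) * ln (2 + 1 / \<epsilon>) ^ 2)" by (rule ge_one_powr_ge_zero[rotated]) simp
  then show ?thesis using True by simp
next
  case False
  define x where "x = 1 / \<epsilon>"
  have x: "x > 0" using e by (simp add: x_def)
  have m: "2 ^ S \<le> 64 * x" using False S e by (simp add: x_def field_simps)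
  \<comment> \<open>The constant 64 = 2 ^ 6 is folded into the power of \<open>2 + x\<close>; later
    \<open>ln 2 \<ge> 1 / 2\<close> turns the exponent 7 into the factor 14.\<close>
  have "64 * x \<le> (2 + x) ^ 6 * (2 + x)"
  proof (rule mult_mono)
    have "(2::real) ^ 6 \<le> (2 + x) ^ 6" using x by (intro power_mono) auto
    then show "64 \<le> (2 + x) ^ 6" by simp
  qed (use x in auto)
  then have "2 ^ S \<le> (2 + x) ^ 7" using m by (simp add: power_numeral_reduce mult.commute mult.left_commute)
  then have "ln (2 ^ S) \<le> ln ((2 + x) ^ 7)" using x by (subst ln_le_cancel_iff) auto
  then have "real S * ln 2 \<le> 7 * ln (2 + x)" using x by (simp add: ln_realpow)
  moreover have "1 / 2 \<le> ln (2::real)" using exp_half_le2 by (subst ln_ge_iff) auto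
  then have "real S * (1 / 2) \<le> real S * ln 2" by (intro mult_left_mono) auto
  ultimately have S14: "real S \<le> 14 * ln (2 + x)" by linarith
  have "real (192 * (2 ^ S * S * S)) = 192 * (2 ^ S * (real S * real S))" by simp
  also have "\<dots> \<le> 192 * ((64 * x) * ((14 * ln (2 + x)) * (14 * ln (2 + x))))"
    using m S14 x by (intro mult_left_mono mult_mono) auto
  also have "\<dots> = 2408448 * x * ln (2 + x) ^ 2" by (simp add: power2_eq_square)
  finally have "2 powr real (192 * (2 ^ S * S * S)) \<le> 2 powr (2408448 * x * ln (2 + x) ^ 2)" by (rule powr_mono) simp
  also have "\<dots> \<le> 2 ^ 384 * 2 powr (2408448 * x * ln (2 + x) ^ 2)"
    using mult_right_mono[of 1 "2 ^ 384" "2 powr (2408448 * x * ln (2 + x) ^ 2)"] by simp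
  finally show ?thesis unfolding x_def by (simp only: powr_realpow of_nat_power of_nat_numeral zero_less_numeral)
qed

text \<open>The stored value is compared with every policy \<open>T'\<close> separately, so that the
  infimum may or may not be attained. A factor \<open>1 + 9 / m\<close> is lost in the best chain
  for \<open>T'\<close>, and \<open>1 + 1 / m\<close> in passing from the stored estimate to the
  true cost.\<close>

lemma best_outcome_approximates:
  assumes inst: "jrp_instance n K H" and e: "\<epsilon> > 0"
    and S: "S \<ge> 1" and m: "m = 2 ^ S" and L: "L = m * S" and B: "B = 2 ^ (8 * S)" and A: "A = 2 ^ (24 * (L * S))"
    and X: "X = n * m" and eps: "32 \<le> real m * \<epsilon>"
    and R: "R = (\<lambda>(j, c). outcome K H n L X A (guess B c (base_time K H n (Suc j))))"
    and b: "best_of R ({..<n} \<times> {..<A}) s"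
    and t: "\<And>j. j \<in> {1..n} \<Longrightarrow> base_time K H n j > 0"
  shows "policy n (rmem s ''T'')"
    and "total_cost n K H (rmem s ''T'') \<le> (1 + \<epsilon>) * (INF T' \<in> {T'. policy n T'}. total_cost n K H T')"
proof -
  note pb = parameter_bounds[OF S m L B A]
  have m1: "m \<ge> 1" using m by simp
  have L1: "L \<ge> 1" using L S m by simp
  have B1: "B \<ge> 1" using B by simp
  have n1: "n \<ge> 1" using inst unfolding jrp_instance_def by simp
  have A1: "A \<ge> 1" using A by simp
  have "(0, 0) \<in> {..<n} \<times> {..<A}" using n1 A1 by auto
  then have "{..<n} \<times> {..<A} \<noteq> {}" by blast
  then obtain j c where jc: "j < n" "c < A" "outcome K H n L X A (guess B c (base_time K H n (Suc j))) (rmem s ''T'') (rmem s ''best'' 0)"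
    using b unfolding best_of_def R by (auto split: if_splits)
  have tj: "base_time K H n (Suc j) > 0" using t jc(1) by simp
  note snd = outcome_sound[OF inst guess_is_chain[OF B1] tj m1 L1 B1 pb(5) jc(3)]
  show "policy n (rmem s ''T'')" by (rule snd(1))
  let ?F = "total_cost n K H"
  have m32: "32 / real m \<le> \<epsilon>" using eps m1 by (simp add: field_simps)
  have bound: "?F (rmem s ''T'') \<le> (1 + \<epsilon>) * ?F T'" if T': "policy n T'" for T'
  proof -
    obtain j v where j: "j \<in> {1..n}" "is_chain B L (base_time K H n j) v"
      "\<And>W e. outcome K H n L X A v W e \<Longrightarrow> e \<le> (1 + 9 / real m) * ?F T'"
      using good_chain_exists[OF inst T' m1 L1 pb(1,2,3,5) X] by blast
    obtain c where c: "c < B ^ (3 * L)" "\<forall>k\<le>L. guess B c (base_time K H n j) k = v k"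
      using guess_exists[OF j(2) pb(4)] by blast
    have "(j - 1, c) \<in> {..<n} \<times> {..<A}" using j(1) c(1) pb(7) by auto
    then obtain W e where We: "outcome K H n L X A (guess B c (base_time K H n (Suc (j - 1)))) W e" "rmem s ''best'' 0 \<le> e"
      using b unfolding best_of_def R by fastforce
    have "outcome K H n L X A v W e"
      using We(1) outcome_cong[of L "guess B c (base_time K H n j)" v n W W] c(2) L1 j(1) by simp
    then have le: "rmem s ''best'' 0 \<le> (1 + 9 / real m) * ?F T'" using j(3) We(2) by force
    have F0: "?F T' > 0"
    proof -
      have KH: "K 0 > 0" "\<And>i. i \<in> {1..n} \<Longrightarrow> K i > 0 \<and> H i > 0" using inst unfolding jrp_instance_def by auto
      have "0 < K 0 / T' 1" using KH T' n1 unfolding policy_def by simp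
      also have "\<dots> \<le> joint_cost n (K 0) T'" using joint_cost_ge[OF T' _ KH(1)] n1 by simp
      also have "\<dots> \<le> ?F T'" unfolding total_cost_def
        using sum_nonneg[of "{1..n}" "\<lambda>i. eoq_cost (K i) (H i) (T' i)"] eoq_cost_pos KH T'
        unfolding policy_def by (smt (verit))
      finally show ?thesis .
    qed
    have "?F (rmem s ''T'') \<le> (1 + 1 / real m) * ((1 + 9 / real m) * ?F T')"
      using snd(2) mult_left_mono[OF le, of "1 + 1 / real m"] by simp
    also have "\<dots> = ((1 + 1 / real m) * (1 + 9 / real m)) * ?F T'" by simp
    also have "\<dots> \<le> (1 + \<epsilon>) * ?F T'"
    proof (rule mult_right_mono)
      define y where "y = 1 / real m"
      have y: "0 \<le> y" "y \<le> 1" "32 * y \<le> \<epsilon>" using m1 m32 unfolding y_def by auto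
      \<comment> \<open>Hence the product is at most \<open>1 + 19 * y\<close>, well within
        \<open>32 * y \<le> \<epsilon>\<close>.\<close>
      have "y * y \<le> y" using y by (simp add: mult_left_le)
      then have "(1 + y) * (1 + 9 * y) \<le> 1 + \<epsilon>" using y by (simp add: algebra_simps)
      then show "(1 + 1 / real m) * (1 + 9 / real m) \<le> 1 + \<epsilon>" unfolding y_def by simp
    qed (use F0 in simp)
    finally show ?thesis .
  qed
  have "?F (rmem s ''T'') / (1 + \<epsilon>) \<le> (INF T' \<in> {T'. policy n T'}. ?F T')"
  proof (rule cINF_greatest)
    show "{T'. policy n T'} \<noteq> {}" using snd(1) by blast
    fix T' assume "T' \<in> {T'. policy n T'}"
    then show "?F (rmem s ''T'') / (1 + \<epsilon>) \<le> ?F T'" using bound[of T'] e by (simp add: field_simps)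
  qed
  then show "?F (rmem s ''T'') \<le> (1 + \<epsilon>) * (INF T' \<in> {T'. policy n T'}. ?F T')" using e by (simp add: field_simps)
qed

lemma base_time_pos:
  assumes inst: "jrp_instance n K H" and j: "j \<in> {1..n}"
  shows "base_time K H n j > 0"
proof -
  let ?S = "{i\<in>{1..n}. \<not> K j / H j < K i / H i}"
  have KH: "K 0 > 0" "\<And>i. i \<in> {1..n} \<Longrightarrow> K i > 0 \<and> H i > 0" using inst unfolding jrp_instance_def by auto
  have "j \<in> ?S" using j by simp
  then have "(\<Sum>i\<in>?S. K i) > 0" "(\<Sum>i\<in>?S. H i) > 0" using KH(2) by (auto intro!: sum_pos)
  then show ?thesis unfolding base_time_def using KH(1) by simp
qed

text \<open>The input state holds 0 outside the relevant indices, so its banks may differ there from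
  the given functions. The correctness proof works with the banks themselves.\<close>

lemma instance_cong:
  assumes "\<And>i. i \<in> {0..n} \<Longrightarrow> K i = K' i" "\<And>i. i \<in> {1..n} \<Longrightarrow> H i = H' i"
  shows "jrp_instance n K H = jrp_instance n K' H'" "total_cost n K H T = total_cost n K' H' T"
proof -
  show "jrp_instance n K H = jrp_instance n K' H'" unfolding jrp_instance_def using assms by auto
  have "(\<Sum>i=1..n. eoq_cost (K i) (H i) (T i)) = (\<Sum>i=1..n. eoq_cost (K' i) (H' i) (T i))"
    by (rule sum.cong) (use assms in auto)
  then show "total_cost n K H T = total_cost n K' H' T" unfolding total_cost_def using assms(1)[of 0] by simp
qed

theorem theorem1p3:
  "\<exists>(prog :: com) (C :: real) (c :: real) (d :: nat) (k :: nat).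
     \<forall>(\<epsilon> :: real) (n :: nat) (K :: nat \<Rightarrow> real) (H :: nat \<Rightarrow> real).
       \<epsilon> > 0 \<and> jrp_instance n K H \<longrightarrow>
       (\<exists>t s. exec prog (jrp_input \<epsilon> n K H) t s \<and>
              real t \<le> C * 2 powr (c * (1 / \<epsilon>) * ln (2 + 1 / \<epsilon>) ^ d) * real n ^ k \<and>
              policy n (jrp_output s) \<and>
              total_cost n K H (jrp_output s)
                \<le> (1 + \<epsilon>) * (INF T' \<in> {T'. policy n T'}. total_cost n K H T'))"
proof (rule exI[of _ "Seq Parameters Search"], rule exI[of _ "141 * 2 ^ 384"], rule exI[of _ 2408448], rule exI[of _ 2],
    rule exI[of _ 8], intro allI impI, elim conjE)
  fix \<epsilon> :: real and n :: nat and K0 H0 :: "nat \<Rightarrow> real"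
  assume e: "\<epsilon> > 0" and inst0: "jrp_instance n K0 H0"
  define s0 where "s0 = jrp_input \<epsilon> n K0 H0"
  define K H where "K = rmem s0 ''K''" and "H = rmem s0 ''H''"
  have KH: "\<And>i. i \<in> {0..n} \<Longrightarrow> K0 i = K i" "\<And>i. i \<in> {1..n} \<Longrightarrow> H0 i = H i"
    unfolding K_def H_def s0_def jrp_input_def by auto
  have inst: "jrp_instance n K H" and cost: "total_cost n K0 H0 = total_cost n K H"
    using inst0 instance_cong[OF KH] by auto
  have s0: "nmem s0 ''n'' 0 = n" "rmem s0 ''eps'' 0 = \<epsilon>" unfolding s0_def jrp_input_def by simp_all
  have n1: "n \<ge> 1" using inst unfolding jrp_instance_def by simp
  obtain r where r: "32 / \<epsilon> < 2 ^ r" using real_arch_pow[of 2 "32 / \<epsilon>"] by auto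
  have "1 \<le> Suc r \<and> 32 \<le> 2 ^ Suc r * \<epsilon>" using r e by (simp add: field_simps)
  define S where "S = (LEAST S. 1 \<le> S \<and> 32 \<le> 2 ^ S * \<epsilon>)"
  have S: "1 \<le> S" "32 \<le> 2 ^ S * \<epsilon>"
    using LeastI[of "\<lambda>S. 1 \<le> S \<and> 32 \<le> 2 ^ S * \<epsilon>", OF \<open>1 \<le> Suc r \<and> _\<close>] unfolding S_def by auto
  have Smin: "2 ^ r * \<epsilon> < 32" if "1 \<le> r" "r < S" for r
    using not_less_Least[of r "\<lambda>S. 1 \<le> S \<and> 32 \<le> 2 ^ S * \<epsilon>"] that unfolding S_def by auto
  have S64: "S = 1 \<or> 2 ^ S * \<epsilon> < 64"
  proof (cases "S = 1")
    case False
    then obtain r where r: "S = Suc r" "1 \<le> r" using S(1) by (cases S) auto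
    then show ?thesis using Smin[of r] by (simp add: mult.commute)
  qed simp
  define m L B A X where "m = (2::nat) ^ S" and "L = m * S" and "B = (2::nat) ^ (8 * S)" and "A = (2::nat) ^ (24 * (L * S))"
    and "X = n * m"
  note pb = parameter_bounds[OF S(1) m_def L_def B_def A_def]
  \<comment> \<open>A common bound for \<open>n\<close>, \<open>L\<close>, \<open>X\<close> and
    \<open>A\<close>. In \<open>G ^ 8\<close> it separates into \<open>n ^ 8\<close> and
    \<open>A ^ 8\<close>, the polynomial and the exponential part of the running time.\<close>
  define G where "G = n * A"
  have A1: "A \<ge> 1" unfolding A_def by simp
  have AG: "A \<le> G" "n \<le> G" unfolding G_def using n1 A1 by auto
  have AG': "L \<le> G" "1 \<le> G" using AG(1) pb(9) A1 by linarith+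
  then have G: "L \<le> G" "X \<le> G" "1 \<le> G" "n \<le> G" "A \<le> G"
    using AG pb(9) A1 mult_le_mono2[OF pb(8), of n] by (auto simp: X_def G_def)
  have mS: "2 ^ S * S * S * 24 \<le> G" using pb(10) AG(1) unfolding m_def by linarith
  have B1: "B \<ge> 1" unfolding B_def by simp
  have L1: "L \<ge> 1" unfolding L_def m_def using S(1) by simp
  let ?R = "\<lambda>(j, c). outcome K H n L X A (guess B c (base_time K H n (Suc j)))"
  have "runs (Seq Parameters Search) s0 (141 * G ^ 8) (best_of ?R ({..<n} \<times> {..<A}))"
  proof (rule runs_Seq[OF runs_Parameters[OF s0 S Smin mS G(4)]])
    fix s1 :: state assume "nmem s1 ''n'' 0 = n \<and> nmem s1 ''L'' 0 = 2 ^ S * S \<and>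
      nmem s1 ''X'' 0 = n * 2 ^ S \<and> nmem s1 ''B'' 0 = 2 ^ (8 * S) \<and> nmem s1 ''A'' 0 = 2 ^ (24 * (2 ^ S * S * S)) \<and> rmem s1 = rmem s0"
    then have s1: "nmem s1 ''n'' 0 = n" "nmem s1 ''L'' 0 = L" "nmem s1 ''X'' 0 = X" "nmem s1 ''A'' 0 = A" "nmem s1 ''B'' 0 = B"
      "rmem s1 ''K'' = K" "rmem s1 ''H'' = H"
      by (simp_all add: m_def L_def X_def A_def B_def K_def H_def)
    show "runs Search s1 (101 * G ^ 7) (best_of ?R ({..<n} \<times> {..<A}))"
      by (rule runs_Search[OF s1 G B1 L1 base_time_pos[OF inst] pb(6)])
  next
    have "40 * G \<le> 40 * G ^ 8" "101 * G ^ 7 \<le> 101 * G ^ 8"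
      using G(3) self_le_power[of G 8] power_increasing[of 7 8 G] by simp_all
    then show "40 * G + 101 * G ^ 7 \<le> 141 * G ^ 8" by linarith
  qed
  then obtain t s where run: "exec (Seq Parameters Search) s0 t s" "t \<le> 141 * G ^ 8" "best_of ?R ({..<n} \<times> {..<A}) s"
    unfolding runs_def by blast
  have "real t \<le> 141 * (real A ^ 8 * real n ^ 8)"
    using of_nat_mono[OF run(2), where 'a = real] by (simp add: G_def power_mult_distrib mult.commute)
  also have "A ^ 8 = 2 ^ (192 * (2 ^ S * S * S))"
    unfolding A_def L_def m_def by (simp add: power_mult[symmetric] mult.commute mult.left_commute)
  then have "real A ^ 8 = real (2 ^ (192 * (2 ^ S * S * S)))" by (metis of_nat_power)
  also have "141 * (real (2 ^ (192 * (2 ^ S * S * S))) * real n ^ 8) \<le>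
      141 * ((2 ^ 384 * 2 powr (2408448 * (1 / \<epsilon>) * ln (2 + 1 / \<epsilon>) ^ 2)) * real n ^ 8)"
    by (intro mult_left_mono mult_right_mono runtime_bound[OF e S(1) S64]) auto
  finally have time: "real t \<le> 141 * 2 ^ 384 * 2 powr (2408448 * (1 / \<epsilon>) * ln (2 + 1 / \<epsilon>) ^ 2) * real n ^ 8"
    by (simp only: mult.assoc)
  have eps: "32 \<le> real m * \<epsilon>" using S(2) by (simp add: m_def)
  note approx = best_outcome_approximates[OF inst e S(1) m_def L_def B_def A_def X_def eps refl run(3) base_time_pos[OF inst]]
  show "\<exists>t s. exec (Seq Parameters Search) (jrp_input \<epsilon> n K0 H0) t s \<and>
      real t \<le> 141 * 2 ^ 384 * 2 powr (2408448 * (1 / \<epsilon>) * ln (2 + 1 / \<epsilon>) ^ 2) * real n ^ 8 \<and>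
      policy n (jrp_output s) \<and>
      total_cost n K0 H0 (jrp_output s) \<le> (1 + \<epsilon>) * (INF T' \<in> {T'. policy n T'}. total_cost n K0 H0 T')"
    unfolding cost jrp_output_def using run(1) time approx unfolding s0_def by blast
qed

end
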